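(* Let $0<\alpha\le1$, $d\in\{1,2\}$, let $L^d$ be a symmetric link function satisfying Property B, suppose the input variables satisfy Assumption I and are independent of the fractional Poisson process $\{N^\alpha(t)\}_{t\ge0}$, and let $A^\alpha_n(t)=n^{-\alpha/2}((\mathcal S^\alpha_{L^d(i,j),n}(t)))_{1\le i,j\le n}$, $t\ge 0$. Let $p\in\mathbb N$, $0\le t_0<t_1<\dots<t_p$, and $A^\alpha_{r,n}=n^{-1/2}(A_n^\alpha(t_r)-A_n^\alpha(t_{r-1}))$, $1\le r\le p$. Let $g=A^\alpha_{r_1,n}\cdots A^\alpha_{r_l,n}$ be a monomial with $l\ge1$, $r_j\in\{1,\dots,p\}$, and put $k_r=\frac12\#\{j:r_j=r\}$. Let $F^\alpha_{t_0,\dots,t_p}(x_0,\dots,x_p)=\mathbb P\{L^\alpha(t_0)\le x_0,\dots,L^\alpha(t_p)\le x_p\}$ be the finite dimensional distribution of an inverse $\alpha$-stable subordinator $\{L^\alpha(t)\}_{t\ge0}$. If the limits $\lim_{n\to\infty}\#\Pi(\chi_g(w))/n^{1+m}$ exist for all $w\in\mathcal P_2(2m,g)$, $m\ge1$, then $$\lim_{n\to\infty}\frac{\mathbb E\,\mathrm{Trace}(A^\alpha_{r_1,n}\cdots A^\alpha_{r_l,n})}{n}=0\quad\text{if } l=2m-1,\ m\ge1,$$ and, if $l=2m$, $m\ge1$, $$\lim_{n\to\infty}\frac{\mathbb E\,\mathrm{Trace}(A^\alpha_{r_1,n}\cdots A^\alpha_{r_l,n})}{n}=\int_{[0,\infty)^{p+1}}\prod_{r=1}^p(x_r-x_{r-1})^{k_r}\sum_{w\in\mathcal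 P_2(2m,g)}\lim_{n\to\infty}\frac{\#\Pi(\chi_g(w))}{n^{1+m}}\ \mathrm dF^\alpha_{t_0,\dots,t_p}(x_0,\dots,x_p)$$ (which is $0$ if $\mathcal P_2(2m,g)$ is empty).
   Context: $\{H^\alpha(t)\}_{t\ge0}$ is an $\alpha$-stable subordinator ($0<\alpha<1$): non-decreasing Lévy process with $\mathbb Ee^{-uH^\alpha(t)}=e^{-tu^\alpha}$, $u>0$. Its inverse is $L^\alpha(t)=\inf\{s\ge0:H^\alpha(s)\ge t\}$, and $L^1(t)=t$ for $\alpha=1$. The fractional Poisson process is $N^\alpha(t)=N(L^\alpha(t))$, with $N$ a homogeneous Poisson process of rate one independent of $L^\alpha$. (The process $L^\alpha$ is not to be confused with the link function $L^d$.) Assumption I: $\{X_{i,j,k},X_{i,k}: i,j\ge0,\ k\ge1\}$ are independent real random variables with mean zero and variance one, and for each $l\ge3$, $\sup_{i,j,k}\mathbb E[|X_{i,j,k}|^l+|X_{i,k}|^l]<\infty$. Stopped walks (the same $N^\alpha$ for all entries): $\mathcal S^\alpha_{i,j,n}(t)=\sum_{k=1}^{N^\alpha(nt)}X_{i,j,k}$ (used if $d=2$) and $\mathcal S^\alpha_{i,n}(t)=\sum_{k=1}^{N^\alpha(nt)}X_{i,k}$ (used if $d=1$). Link function: for $d\in\{1,2\}$, a sequence of functions $L^d=L^d_n:\{1,\dots,n\}^2\to\mathbb Z^d$ (with values in the index set of the input variables). It is symmetric if $L^d(i,j)=L^d(j,i)$ for all $i,j$. Property B: $\sup_n\sup_{r\in\mathbb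 Z_+^d}\sup_{1\le i\le n}\#\{j:1\le j\le n,\ L^d(i,j)=r\}<\infty$. Circuits and words: a circuit of length $l$ is a function $\pi:\{0,1,\dots,l\}\to\{1,\dots,n\}$ with $\pi(0)=\pi(l)$. A word of length $l$ is a sequence of $l$ letters whose first occurrences are in alphabetical order (equivalently a partition of $\{1,\dots,l\}$); $w(i)$ is its $i$th letter. $\Pi(w)$ (depending on $n$) is the set of circuits $\pi$ of length $l$ such that $w(i)=w(j)$ if and only if $L^d(\pi(i-1),\pi(i))=L^d(\pi(j-1),\pi(j))$. A word is pair-matched if each letter appears exactly twice; $\mathcal P_2(2m)$ is the set of pair-matched words of length $2m$. For a monomial $g$ of length $2m$ with indices $r_1,\dots,r_{2m}$, an indexed word carries the index $r_j$ on its $j$th letter, letters with different indices being different; $\mathcal P_2(2m,g)$ is the set of indexed words in which each indexed letter appears exactly twice (so the two positions $i,j$ of a letter satisfy $r_i=r_j$), and $\chi_g:\mathcal P_2(2m,g)\to\mathcal P_2(2m)$ is the map dropping the indices. *)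

theory Defs
  imports "HOL-Probability.Probability" "Jordan_Normal_Form.Matrix"
begin

section \<open>Levy processes, subordinators and the fractional Poisson process\<close>

text \<open>
  Stochastic processes are indexed by real times; only times \<open>t \<ge> 0\<close> are meaningful.
\<close>

context prob_space
begin

definition levy_process :: "(real \<Rightarrow> 'a \<Rightarrow> real) \<Rightarrow> bool" where
  "levy_process Z \<longleftrightarrow>
     (\<forall>t\<ge>0. random_variable borel (Z t)) \<and>
     (AE \<omega> in M. Z 0 \<omega> = 0) \<and>
     (\<forall>(s :: nat \<Rightarrow> real) n. 0 \<le> s 0 \<and> (\<forall>i<n. s i < s (Suc i)) \<longrightarrow>
        indep_vars (\<lambda>_. borel) (\<lambda>i \<omega>. Z (s (Suc i)) \<omega> - Z (s i) \<omega>) {..<n}) \<and>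
     (\<forall>s\<ge>0. \<forall>h\<ge>0. distr M borel (\<lambda>\<omega>. Z (s + h) \<omega> - Z s \<omega>) = distr M borel (Z h)) \<and>
     (AE \<omega> in M. (\<forall>t\<ge>0. continuous (at_right t) (\<lambda>s. Z s \<omega>)) \<and>
                 (\<forall>t>0. \<exists>l. ((\<lambda>s. Z s \<omega>) \<longlongrightarrow> l) (at_left t)))"

definition stable_subordinator :: "real \<Rightarrow> (real \<Rightarrow> 'a \<Rightarrow> real) \<Rightarrow> bool" where
  "stable_subordinator \<alpha> H \<longleftrightarrow>
     levy_process H \<and>
     (AE \<omega> in M. mono_on {0..} (\<lambda>t. H t \<omega>)) \<and>
     (\<forall>t\<ge>0. \<forall>u>0. expectation (\<lambda>\<omega>. exp (- u * H t \<omega>)) = exp (- t * u powr \<alpha>))"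

text \<open>
  The set in the infimum is nonempty almost surely, because \<open>H s\<close> tends to infinity almost surely;
  on the remaining null set \<open>Inf {}\<close> is an arbitrary real number.
\<close>

definition inverse_stable_subordinator :: "real \<Rightarrow> (real \<Rightarrow> 'a \<Rightarrow> real) \<Rightarrow> bool" where
  "inverse_stable_subordinator \<alpha> L \<longleftrightarrow>
     (if \<alpha> = 1 then \<forall>\<omega>\<in>space M. \<forall>t\<ge>0. L t \<omega> = t
      else \<exists>H. stable_subordinator \<alpha> H \<and>
             (\<forall>\<omega>\<in>space M. \<forall>t\<ge>0. L t \<omega> = Inf {s. 0 \<le> s \<and> t \<le> H s \<omega>}))"

text \<open>
  The homogeneous Poisson process of rate one: the Levy process whose value at time \<open>t\<close> is Poisson
  distributed with parameter \<open>t\<close>.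
\<close>

definition unit_poisson_process :: "(real \<Rightarrow> 'a \<Rightarrow> nat) \<Rightarrow> bool" where
  "unit_poisson_process N \<longleftrightarrow>
     levy_process (\<lambda>t \<omega>. real (N t \<omega>)) \<and>
     (\<forall>t>0. distr M (count_space UNIV) (N t) = measure_pmf (poisson_pmf t))"

text \<open>
  Events generated by a family of real random variables, and independence of two such families
  (\<^const>\<open>indep_vars\<close> would require equal index types). Measurability of the members of both
  families is part of \<^const>\<open>indep_set\<close>.
\<close>

definition gen_events :: "'i set \<Rightarrow> ('i \<Rightarrow> 'a \<Rightarrow> real) \<Rightarrow> 'a set set" where
  "gen_events I Y = sigma_sets (space M) {Y i -` B \<inter> space M | i B. i \<in> I \<and> B \<in> sets borel}"

definition indep_families ::
  "'i set \<Rightarrow> ('i \<Rightarrow> 'a \<Rightarrow> real) \<Rightarrow> 'j set \<Rightarrow> ('j \<Rightarrow> 'a \<Rightarrow> real) \<Rightarrow> bool" where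
  "indep_families I Y J Z \<longleftrightarrow> indep_set (gen_events I Y) (gen_events J Z)"

end

definition fractional_poisson ::
  "(real \<Rightarrow> 'a \<Rightarrow> nat) \<Rightarrow> (real \<Rightarrow> 'a \<Rightarrow> real) \<Rightarrow> real \<Rightarrow> 'a \<Rightarrow> nat" where
  "fractional_poisson N L t \<omega> = N (L t \<omega>) \<omega>"


section \<open>Finite dimensional distributions\<close>

definition fdd ::
  "'a measure \<Rightarrow> (real \<Rightarrow> 'a \<Rightarrow> real) \<Rightarrow> (nat \<Rightarrow> real) \<Rightarrow> nat \<Rightarrow> (nat \<Rightarrow> real) \<Rightarrow> real" where
  "fdd M L t p x = measure M {\<omega> \<in> space M. \<forall>r\<le>p. L (t r) \<omega> \<le> x r}"

text \<open>
  The measure \<open>dF\<close> belonging to the distribution function \<open>F = fdd M L t p\<close>, that is, the joint law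
  of \<open>(L (t 0), \<dots>, L (t p))\<close>; points of \<open>\<real>\<^sup>p\<^sup>+\<^sup>1\<close> are extensional functions on \<open>{0..p}\<close>.
  The next two lemmas show that it is the unique measure with distribution function \<open>F\<close>.
\<close>

definition fdd_measure ::
  "'a measure \<Rightarrow> (real \<Rightarrow> 'a \<Rightarrow> real) \<Rightarrow> (nat \<Rightarrow> real) \<Rightarrow> nat \<Rightarrow> (nat \<Rightarrow> real) measure" where
  "fdd_measure M L t p = distr M (PiM {0..p} (\<lambda>_. borel)) (\<lambda>\<omega>. \<lambda>r\<in>{0..p}. L (t r) \<omega>)"

lemma emeasure_fdd_measure_orthant:
  assumes "prob_space M" and "\<And>r. r \<le> p \<Longrightarrow> L (t r) \<in> borel_measurable M"
  shows "emeasure (fdd_measure M L t p) (\<Pi>\<^sub>E r\<in>{0..p}. {..x r}) = ennreal (fdd M L t p x)"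
proof -
  interpret prob_space M by fact
  have m: "(\<lambda>\<omega>. \<lambda>r\<in>{0..p}. L (t r) \<omega>) \<in> measurable M (PiM {0..p} (\<lambda>_. borel))"
    using assms(2) by (intro measurable_restrict) auto
  have "(\<lambda>\<omega>. \<lambda>r\<in>{0..p}. L (t r) \<omega>) -` (\<Pi>\<^sub>E r\<in>{0..p}. {..x r}) \<inter> space M
      = {\<omega> \<in> space M. \<forall>r\<le>p. L (t r) \<omega> \<le> x r}"
    by (auto simp: PiE_iff)
  then show ?thesis
    unfolding fdd_measure_def fdd_def using m
    by (subst emeasure_distr) (auto simp: emeasure_eq_measure intro!: sets_PiM_I_finite)
qed

lemma fdd_measure_unique:
  assumes M: "prob_space M" and L: "\<And>r. r \<le> p \<Longrightarrow> L (t r) \<in> borel_measurable M"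
    and sets: "sets \<mu> = sets (PiM {0..p} (\<lambda>_. borel :: real measure))"
    and F: "\<And>x. emeasure \<mu> (\<Pi>\<^sub>E r\<in>{0..p}. {..x r}) = ennreal (fdd M L t p x)"
  shows "\<mu> = fdd_measure M L t p"
proof (rule measure_eqI_generator_eq)
  let ?E = "{Pi\<^sub>E {0..p} A | A. \<forall>r\<in>{0..p}. A r \<in> range (\<lambda>a::real. {..a})}"
  let ?\<Omega> = "\<Pi>\<^sub>E r\<in>{0..p}. (UNIV :: real set)"
  show "Int_stable ?E"
  proof (rule Int_stableI, clarify)
    fix A B :: "nat \<Rightarrow> real set"
    assume A: "\<forall>r\<in>{0..p}. A r \<in> range (\<lambda>a. {..a})" and B: "\<forall>r\<in>{0..p}. B r \<in> range (\<lambda>a. {..a})"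
    have "Pi\<^sub>E {0..p} A \<inter> Pi\<^sub>E {0..p} B = (\<Pi>\<^sub>E r\<in>{0..p}. A r \<inter> B r)"
      by (auto simp: PiE_iff)
    moreover have "\<forall>r\<in>{0..p}. A r \<inter> B r \<in> range (\<lambda>a. {..a})"
    proof
      fix r assume "r \<in> {0..p}"
      then obtain a b where "A r = {..a}" "B r = {..b}" using A B by blast
      then have "A r \<inter> B r = {..min a b}" by auto
      then show "A r \<inter> B r \<in> range (\<lambda>a. {..a})" by blast
    qed
    ultimately show "\<exists>C. Pi\<^sub>E {0..p} A \<inter> Pi\<^sub>E {0..p} B = Pi\<^sub>E {0..p} C \<and>
        (\<forall>r\<in>{0..p}. C r \<in> range (\<lambda>a. {..a}))"
      by (intro exI[of _ "\<lambda>r. A r \<inter> B r"]) simp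
  qed
  show "?E \<subseteq> Pow ?\<Omega>"
    by (auto simp: PiE_iff)
  show "emeasure \<mu> X = emeasure (fdd_measure M L t p) X" if X: "X \<in> ?E" for X
  proof -
    obtain A where A: "X = Pi\<^sub>E {0..p} A" "\<forall>r\<in>{0..p}. A r \<in> range (\<lambda>a. {..a})"
    proof -
      from X have "\<exists>A. X = Pi\<^sub>E {0..p} A \<and> (\<forall>r\<in>{0..p}. A r \<in> range (\<lambda>a. {..a}))"
        by (rule CollectD)
      then show thesis using that by (elim exE conjE)
    qed
    from A(2) have "\<forall>r\<in>{0..p}. \<exists>a. A r = {..a}" by (simp add: image_iff)
    from bchoice[OF this] obtain x where x: "\<forall>r\<in>{0..p}. A r = {..x r}" by (elim exE)
    have "X = (\<Pi>\<^sub>E r\<in>{0..p}. {..x r})"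
      unfolding A(1) using x by (intro PiE_cong) simp
    then show ?thesis
      using F emeasure_fdd_measure_orthant[where L = L and t = t, OF M L] by simp
  qed
  have gen: "sets (PiM {0..p} (\<lambda>_. borel :: real measure)) = sigma_sets ?\<Omega> ?E"
  proof -
    let ?P = "{{f \<in> ?\<Omega>. \<forall>i\<in>j. f i \<in> A i} | A j.
                 j \<in> {{0..p}} \<and> A \<in> Pi j (\<lambda>_. range (\<lambda>a::real. {..a}))}"
    have "sets (PiM {0..p} (\<lambda>_. sigma UNIV (range (\<lambda>a::real. {..a})))) = sets (sigma ?\<Omega> ?P)"
    proof (rule sets_PiM_sigma)
      show "\<exists>S\<subseteq>range (\<lambda>a::real. {..a}). countable S \<and> UNIV = \<Union>S" if "i \<in> {0..p}" for i
      proof (intro exI[of _ "range (\<lambda>n::nat. {..real n})"] conjI)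
        show "UNIV = (\<Union>n::nat. {..real n})" by (auto simp: real_arch_simple)
      qed auto
    qed auto
    also have "\<dots> = sigma_sets ?\<Omega> ?P"
      by (rule sets_measure_of) blast
    also have "?P = ?E"
    proof (intro Collect_cong)
      fix Y
      have "{f \<in> ?\<Omega>. \<forall>i\<in>{0..p}. f i \<in> A i} = Pi\<^sub>E {0..p} A" for A :: "nat \<Rightarrow> real set"
        unfolding PiE_def Pi_def by auto
      then show "(\<exists>A j. Y = {f \<in> ?\<Omega>. \<forall>i\<in>j. f i \<in> A i} \<and>
             j \<in> {{0..p}} \<and> A \<in> Pi j (\<lambda>_. range (\<lambda>a::real. {..a}))) \<longleftrightarrow>
           (\<exists>A. Y = Pi\<^sub>E {0..p} A \<and> (\<forall>r\<in>{0..p}. A r \<in> range (\<lambda>a. {..a})))"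
        by (simp add: Pi_iff)
    qed
    finally show ?thesis by (simp add: borel_eq_atMost)
  qed
  show "sets \<mu> = sigma_sets ?\<Omega> ?E"
    using sets gen by simp
  show "sets (fdd_measure M L t p) = sigma_sets ?\<Omega> ?E"
    using gen by (simp add: fdd_measure_def)
  show "range (\<lambda>n::nat. \<Pi>\<^sub>E r\<in>{0..p}. {..real n}) \<subseteq> ?E"
  proof (rule image_subsetI)
    show "(\<Pi>\<^sub>E r\<in>{0..p}. {..real n}) \<in> ?E" for n :: nat
      by (intro CollectI exI[of _ "\<lambda>_. {..real n}"]) simp
  qed
  show "(\<Union>n::nat. \<Pi>\<^sub>E r\<in>{0..p}. {..real n}) = ?\<Omega>"
  proof
    show "?\<Omega> \<subseteq> (\<Union>n::nat. \<Pi>\<^sub>E r\<in>{0..p}. {..real n})"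
    proof
      fix y :: "nat \<Rightarrow> real" assume y: "y \<in> ?\<Omega>"
      obtain n :: nat where "Max (y ` {0..p}) \<le> real n" using real_arch_simple by blast
      then have "\<forall>r\<in>{0..p}. y r \<le> real n" by auto
      then show "y \<in> (\<Union>n::nat. \<Pi>\<^sub>E r\<in>{0..p}. {..real n})" using y by (auto simp: PiE_iff)
    qed
  qed (auto simp: PiE_iff)
  show "emeasure \<mu> (\<Pi>\<^sub>E r\<in>{0..p}. {..real i}) \<noteq> \<infinity>" for i :: nat
    using F[of "\<lambda>_. real i"] by simp
qed


section \<open>Input variables and link functions\<close>

text \<open>
  Elements of \<open>\<int>\<^sup>d\<close> are integer lists of length \<open>d\<close>. The input variable \<open>X\<^sub>i\<^sub>,\<^sub>j\<^sub>,\<^sub>k\<close> is \<open>X [i, j] k\<close> and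
  \<open>X\<^sub>i\<^sub>,\<^sub>k\<close> is \<open>X [i] k\<close>.
\<close>

definition Zplus :: "nat \<Rightarrow> int list set" where
  "Zplus d = {r. length r = d \<and> (\<forall>x\<in>set r. 0 \<le> x)}"

definition input_index :: "(int list \<times> nat) set" where
  "input_index = (Zplus 1 \<union> Zplus 2) \<times> {1..}"

context prob_space
begin

definition assumption_I :: "(int list \<Rightarrow> nat \<Rightarrow> 'a \<Rightarrow> real) \<Rightarrow> bool" where
  "assumption_I X \<longleftrightarrow>
     indep_vars (\<lambda>_. borel) (\<lambda>(r, k). X r k) input_index \<and>
     (\<forall>(r, k)\<in>input_index.
        integrable M (X r k) \<and> expectation (X r k) = 0 \<and>
        integrable M (\<lambda>\<omega>. (X r k \<omega>)\<^sup>2) \<and> variance (X r k) = 1) \<and>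
     (\<forall>l\<ge>3. (SUP i\<in>{0..}. SUP j\<in>{0..}. SUP k\<in>{1..}.
        (\<integral>\<^sup>+ \<omega>. ennreal (\<bar>X [i, j] k \<omega>\<bar> ^ l + \<bar>X [i] k \<omega>\<bar> ^ l) \<partial>M)) < \<infinity>)"

end

definition link_function :: "nat \<Rightarrow> (nat \<Rightarrow> nat \<Rightarrow> nat \<Rightarrow> int list) \<Rightarrow> bool" where
  "link_function d Ld \<longleftrightarrow> (\<forall>n. \<forall>i\<in>{1..n}. \<forall>j\<in>{1..n}. Ld n i j \<in> Zplus d)"

definition symmetric_link :: "(nat \<Rightarrow> nat \<Rightarrow> nat \<Rightarrow> int list) \<Rightarrow> bool" where
  "symmetric_link Ld \<longleftrightarrow> (\<forall>n. \<forall>i\<in>{1..n}. \<forall>j\<in>{1..n}. Ld n i j = Ld n j i)"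

definition property_B :: "nat \<Rightarrow> (nat \<Rightarrow> nat \<Rightarrow> nat \<Rightarrow> int list) \<Rightarrow> bool" where
  "property_B d Ld \<longleftrightarrow>
     bdd_above {card {j \<in> {1..n}. Ld n i j = r} | n r i. r \<in> Zplus d \<and> i \<in> {1..n}}"


section \<open>Matrices of stopped walks\<close>

definition stopped_walk ::
  "(int list \<Rightarrow> nat \<Rightarrow> 'a \<Rightarrow> real) \<Rightarrow> (real \<Rightarrow> 'a \<Rightarrow> nat) \<Rightarrow> int list \<Rightarrow> nat \<Rightarrow> real \<Rightarrow> 'a \<Rightarrow> real" where
  "stopped_walk X N\<alpha> r n t \<omega> = (\<Sum>k = 1..N\<alpha> (real n * t) \<omega>. X r k \<omega>)"

text \<open>Entries of \<^typ>\<open>'a mat\<close> are numbered from \<open>0\<close>, arguments of the link function from \<open>1\<close>.\<close>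

definition A_mat ::
  "real \<Rightarrow> (nat \<Rightarrow> nat \<Rightarrow> nat \<Rightarrow> int list) \<Rightarrow> (int list \<Rightarrow> nat \<Rightarrow> 'a \<Rightarrow> real) \<Rightarrow> (real \<Rightarrow> 'a \<Rightarrow> nat) \<Rightarrow>
     nat \<Rightarrow> real \<Rightarrow> 'a \<Rightarrow> real mat" where
  "A_mat \<alpha> Ld X N\<alpha> n t \<omega> =
     real n powr (- \<alpha> / 2) \<cdot>\<^sub>m
       Matrix.mat n n (\<lambda>(i, j). stopped_walk X N\<alpha> (Ld n (i + 1) (j + 1)) n t \<omega>)"

definition A_incr ::
  "real \<Rightarrow> (nat \<Rightarrow> nat \<Rightarrow> nat \<Rightarrow> int list) \<Rightarrow> (int list \<Rightarrow> nat \<Rightarrow> 'a \<Rightarrow> real) \<Rightarrow> (real \<Rightarrow> 'a \<Rightarrow> nat) \<Rightarrow>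
     (nat \<Rightarrow> real) \<Rightarrow> nat \<Rightarrow> 'a \<Rightarrow> nat \<Rightarrow> real mat" where
  "A_incr \<alpha> Ld X N\<alpha> t n \<omega> r =
     real n powr (- 1 / 2) \<cdot>\<^sub>m (A_mat \<alpha> Ld X N\<alpha> n (t r) \<omega> - A_mat \<alpha> Ld X N\<alpha> n (t (r - 1)) \<omega>)"

text \<open>The product \<open>A r\<^sub>1 * \<dots> * A r\<^sub>l\<close> of \<open>n \<times> n\<close> matrices for \<open>rs = [r\<^sub>1, \<dots>, r\<^sub>l]\<close>.\<close>

definition monomial_mat :: "nat \<Rightarrow> (nat \<Rightarrow> real mat) \<Rightarrow> nat list \<Rightarrow> real mat" where
  "monomial_mat n A rs = foldr (\<lambda>r B. A r * B) rs (1\<^sub>m n)"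

definition mat_trace :: "real mat \<Rightarrow> real" where
  "mat_trace A = sum_list (diag_mat A)"


section \<open>Words and circuits\<close>

text \<open>
  The letters are \<open>0, 1, 2, \<dots>\<close>, and the \<open>i\<close>th letter of the word \<open>w\<close> is \<open>w ! (i - 1)\<close>. First
  occurrences are in alphabetical order: every letter either occurred before or is the first
  letter not used before.
\<close>

definition is_word :: "nat list \<Rightarrow> bool" where
  "is_word w \<longleftrightarrow> (\<forall>i<length w. w ! i \<in> set (take i w) \<or> w ! i = card (set (take i w)))"

definition word_circuits ::
  "(nat \<Rightarrow> nat \<Rightarrow> nat \<Rightarrow> int list) \<Rightarrow> nat \<Rightarrow> nat list \<Rightarrow> (nat \<Rightarrow> nat) set" where
  "word_circuits Ld n w =
     {\<pi> \<in> {0..length w} \<rightarrow>\<^sub>E {1..n}. \<pi> 0 = \<pi> (length w) \<and>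
        (\<forall>i\<in>{1..length w}. \<forall>j\<in>{1..length w}.
           w ! (i - 1) = w ! (j - 1) \<longleftrightarrow>
           Ld n (\<pi> (i - 1)) (\<pi> i) = Ld n (\<pi> (j - 1)) (\<pi> j))}"

text \<open>
  An indexed letter is a pair of a letter and an index. As letters with different indices are
  different, dropping the indices identifies no two distinct indexed letters.
\<close>

definition indexed_words :: "nat list \<Rightarrow> (nat \<times> nat) list set" where
  "indexed_words rs =
     {v. map snd v = rs \<and> is_word (map fst v) \<and>
         (\<forall>x\<in>set v. \<forall>y\<in>set v. snd x \<noteq> snd y \<longrightarrow> fst x \<noteq> fst y)}"

definition pair_indexed_words :: "nat list \<Rightarrow> (nat \<times> nat) list set" where
  "pair_indexed_words rs = {v \<in> indexed_words rs. \<forall>x\<in>set v. count_list v x = 2}"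

definition drop_indices :: "(nat \<times> nat) list \<Rightarrow> nat list" where
  "drop_indices v = map fst v"

lemma is_word_letter_less:
  assumes "is_word w" and "a \<in> set w"
  shows "a < length w"
proof -
  define i where "i = (LEAST i. i < length w \<and> w ! i = a)"
  have ex: "\<exists>i. i < length w \<and> w ! i = a" using assms(2) by (auto simp: in_set_conv_nth)
  have i: "i < length w" "w ! i = a" using LeastI_ex[OF ex] by (auto simp: i_def)
  have "a \<notin> set (take i w)"
  proof
    assume "a \<in> set (take i w)"
    then obtain j where "j < i" "w ! j = a" using i by (auto simp: in_set_conv_nth)
    then show False using i not_less_Least[of j "\<lambda>i. i < length w \<and> w ! i = a"]
      by (auto simp: i_def)
  qed
  then have "a = card (set (take i w))" using assms(1) i by (auto simp: is_word_def)
  also have "\<dots> \<le> i" using card_length[of "take i w"] by simp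
  finally show ?thesis using i by simp
qed

lemma finite_pair_indexed_words: "finite (pair_indexed_words rs)"
proof (rule finite_subset)
  show "pair_indexed_words rs \<subseteq>
      {v. set v \<subseteq> {..<length rs} \<times> set rs \<and> length v = length rs}"
  proof
    fix v assume "v \<in> pair_indexed_words rs"
    then have v: "map snd v = rs" "is_word (map fst v)"
      by (auto simp: pair_indexed_words_def indexed_words_def)
    have "set v \<subseteq> {..<length rs} \<times> set rs"
    proof
      fix x assume x: "x \<in> set v"
      then have "fst x < length rs"
        using is_word_letter_less[OF v(2), of "fst x"] arg_cong[OF v(1), of length] by auto
      moreover have "snd x \<in> set rs" using x v(1) by auto
      ultimately show "x \<in> {..<length rs} \<times> set rs" by (cases x) auto
    qed
    then show "v \<in> {v. set v \<subseteq> {..<length rs} \<times> set rs \<and> length v = length rs}"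
      using arg_cong[OF v(1), of length] by auto
  qed
  show "finite {v. set v \<subseteq> {..<length rs} \<times> set rs \<and> length v = length rs}"
    by (intro finite_lists_length_eq) auto
qed

text \<open>
  The exponent \<open>k\<^sub>r = #{j. r\<^sub>j = r} / 2\<close>. If one of these numbers is not an integer, there is no
  pair-matched indexed word, and the factor multiplying the corresponding powers is an empty sum;
  so rounding down is harmless and gives natural exponents with \<open>0 ^ 0 = 1\<close>.
\<close>

definition half_count :: "nat list \<Rightarrow> nat \<Rightarrow> nat" where
  "half_count rs r = count_list rs r div 2"

end

theory Submission
  imports Defs "HOL-Combinatorics.Stirling" "HOL-Real_Asymp.Real_Asymp"
begin

text \<open>
  Given the fractional Poisson process \<open>N\<^sup>\<alpha>\<close>, the expected trace is a sum over circuits and, for each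
  circuit, over the summation indices of the stopped walks. A label that occurs only once contributes
  zero because the input variables are centred, and by Property B the circuits with fewer than \<open>l / 2\<close>
  labels are negligible. What remains are the circuits of pair-matched indexed words, and each of them
  contributes \<open>\<Prod>\<^sub>r (N\<^sup>\<alpha>(n t\<^sub>r) - N\<^sup>\<alpha>(n t\<^sub>r\<^sub>-\<^sub>1)) ^ k\<^sub>r\<close>.

  Conditioning on \<open>L\<^sup>\<alpha>\<close> turns the moments of these increments into Touchard polynomials of the
  increments of \<open>L\<^sup>\<alpha>\<close>. The event \<open>L\<^sup>\<alpha>(t) \<le> x\<close> is almost surely \<open>t \<le> H\<^sup>\<alpha>(x)\<close>, and the Laplace transform
  makes \<open>H\<^sup>\<alpha>\<close> self-similar, so \<open>L\<^sup>\<alpha>(n t)\<close> has the law of \<open>n\<^sup>\<alpha> L\<^sup>\<alpha>(t)\<close> jointly in \<open>t\<close>. After division by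
  the power of \<open>n\<^sup>\<alpha>\<close> the Touchard polynomials converge, dominatedly, to their leading monomials.
\<close>


section \<open>Freezing an independent countable random variable\<close>

context prob_space
begin

text \<open>The obstacle is averaging over a random time. Independence is known only for generated
  sigma-algebras, and the paths of \<open>N\<close> are regular only almost surely, so the average
  is taken only over countably many values of the conditioning variable. The stopping times of the
  walks are integer valued and can be frozen directly; the values of \<open>L\<close> are continuous
  and must first be moved to lattices.

  The error estimate is a count of exponents. The trace of a monomial of length \<open>l\<close>
  carries the factor n^(-(1+\<alpha>) l / 2). There are O(n^(1+u)) circuits with at most
  \<open>u\<close> labels, and the sums over walk indices have order at most n^(\<alpha> (l div 2))
  in expectation. A label pattern without unique labels that is not a pairing has at most
  \<open>(l - 1) div 2\<close> labels. After division by n the error is therefore O(1/n) for even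
  \<open>l\<close> and O(n^(-(1+\<alpha>)/2)) for odd \<open>l\<close>, where no pairing exists. For
  \<open>l = 2 * m\<close> the pairings have \<open>m\<close> labels, and their n^(1+m) circuits and
  the factor n^(\<alpha> m) balance the normalisation exactly.\<close>

definition gen_measure :: "'i set \<Rightarrow> ('i \<Rightarrow> 'a \<Rightarrow> real) \<Rightarrow> 'a measure" where
  "gen_measure I Y = sigma (space M) {Y i -` B \<inter> space M | i B. i \<in> I \<and> B \<in> sets borel}"

lemma space_gen_measure [simp]: "space (gen_measure I Y) = space M"
  unfolding gen_measure_def by (rule space_measure_of) auto

lemma sets_gen_measure: "sets (gen_measure I Y) = gen_events I Y"
  unfolding gen_measure_def gen_events_def by (rule sets_measure_of) auto

lemma measurable_gen_measure:
  assumes "i \<in> I" shows "Y i \<in> borel_measurable (gen_measure I Y)"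
proof (rule measurableI)
  fix B :: "real set" assume "B \<in> sets borel"
  then show "Y i -` B \<inter> space (gen_measure I Y) \<in> sets (gen_measure I Y)"
    using assms by (auto simp: sets_gen_measure gen_events_def intro!: sigma_sets.Basic)
qed simp

lemma indep_set_measurable:
  assumes ind: "indep_set (sets G) (sets K)" and "space G = space M" "space K = space M"
  shows "f \<in> measurable G N \<Longrightarrow> f \<in> measurable M N" "g \<in> measurable K N \<Longrightarrow> g \<in> measurable M N"
proof -
  have "sets G \<subseteq> events" "sets K \<subseteq> events"
    using ind by (auto simp: indep_set_def indep_sets_def split: bool.splits)
  then show "f \<in> measurable G N \<Longrightarrow> f \<in> measurable M N"
    "g \<in> measurable K N \<Longrightarrow> g \<in> measurable M N"
    using assms(2,3) by (auto simp: measurable_def)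
qed

lemma indep_set_imp_indep_var:
  assumes ind: "indep_set (sets G) (sets K)" and sp: "space G = space M" "space K = space M"
    and f: "f \<in> measurable G S" and g: "g \<in> measurable K T"
  shows "indep_var S f T g"
  unfolding indep_var_eq
proof (intro conjI)
  show "random_variable S f" "random_variable T g"
    using indep_set_measurable[OF ind sp] f g by blast+
  have 1: "sigma_sets (space M) {f -` A \<inter> space M |A. A \<in> sets S} \<subseteq> sets G"
    using measurable_sets[OF f] sp(1)
    by (subst sp(1)[symmetric], intro sets.sigma_sets_subset) auto
  have 2: "sigma_sets (space M) {g -` A \<inter> space M |A. A \<in> sets T} \<subseteq> sets K"
    using measurable_sets[OF g] sp(2)
    by (subst sp(2)[symmetric], intro sets.sigma_sets_subset) auto
  show "indep_set (sigma_sets (space M) {f -` A \<inter> space M |A. A \<in> sets S})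
     (sigma_sets (space M) {g -` A \<inter> space M |A. A \<in> sets T})"
    using ind unfolding indep_set_def
    by (rule indep_sets_mono_sets) (use 1 2 in \<open>auto split: bool.split\<close>)
qed

text \<open>On the event \<open>T = v\<close> the integrand is \<open>Y v\<close>, which is
  independent of that event and may be replaced by its mean; countability of the values lets the
  pieces be summed. Nonnegativity makes the interchange of sum and integral unconditional.\<close>

lemma freeze_nn_integral:
  fixes T :: "'a \<Rightarrow> 'c::countable" and Y :: "'c \<Rightarrow> 'a \<Rightarrow> real"
  assumes ind: "indep_set (sets G) (sets K)" and sp: "space G = space M" "space K = space M"
    and Y: "\<And>v. Y v \<in> borel_measurable G" and int: "\<And>v. integrable M (Y v)"
    and nonneg: "\<And>v \<omega>. \<omega> \<in> space M \<Longrightarrow> 0 \<le> Y v \<omega>"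
    and T: "T \<in> measurable K (count_space UNIV)"
  shows "(\<integral>\<^sup>+\<omega>. ennreal (Y (T \<omega>) \<omega>) \<partial>M) = (\<integral>\<^sup>+\<omega>. ennreal (expectation (Y (T \<omega>))) \<partial>M)"
proof -
  have [measurable]: "T \<in> measurable M (count_space UNIV)" "\<And>v. Y v \<in> borel_measurable M"
    using indep_set_measurable[OF ind sp] T Y by blast+
  have ind1: "\<integral>\<^sup>+\<omega>. ennreal (indicator {v} (T \<omega>) * Y v \<omega>) \<partial>M
      = \<integral>\<^sup>+\<omega>. ennreal (indicator {v} (T \<omega>) * expectation (Y v)) \<partial>M" for v
  proof -
    have iv: "indep_var borel (Y v) borel (\<lambda>\<omega>. indicator {v} (T \<omega>) :: real)"
      by (rule indep_set_imp_indep_var[OF ind sp Y]) (use T in measurable)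
    have i1: "integrable M (\<lambda>\<omega>. indicator {v} (T \<omega>) :: real)"
      by (rule integrable_const_bound[where B=1]) (auto simp: indicator_def)
    have i2: "integrable M (\<lambda>\<omega>. Y v \<omega> * indicator {v} (T \<omega>))"
      by (rule indep_var_integrable[OF iv int i1])
    have "expectation (\<lambda>\<omega>. Y v \<omega> * indicator {v} (T \<omega>))
        = expectation (Y v) * expectation (\<lambda>\<omega>. indicator {v} (T \<omega>))"
      by (rule indep_var_lebesgue_integral[OF iv int i1])
    moreover have "0 \<le> expectation (Y v)"
      by (rule Bochner_Integration.integral_nonneg_AE) (use nonneg in auto)
    ultimately show ?thesis using i1 i2
      by (subst (1 2) nn_integral_eq_integral)
        (auto simp: mult.commute intro!: nonneg mult_nonneg_nonneg)
  qed
  \<comment> \<open>A random index becomes a sum over all indices in which exactly one term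
    survives. Used for \<open>Y\<close> and for the constants \<open>expectation (Y v)\<close>, it
    brings both sides into the form of \<open>ind1\<close>.\<close>
  have split: "ennreal (Z (T \<omega>) \<omega>) = (\<integral>\<^sup>+v. ennreal (indicator {v} (T \<omega>) * Z v \<omega>) \<partial>count_space UNIV)"
    for Z :: "'c \<Rightarrow> 'a \<Rightarrow> real" and \<omega>
  proof -
    have "(\<integral>\<^sup>+v. ennreal (indicator {v} (T \<omega>) * Z v \<omega>) \<partial>count_space UNIV)
       = (\<integral>\<^sup>+v. ennreal (Z (T \<omega>) \<omega>) * indicator {T \<omega>} v \<partial>count_space UNIV)"
      by (intro nn_integral_cong) (auto simp: indicator_def)
    then show ?thesis by (simp add: nn_integral_cmult_indicator)
  qed
  show ?thesis
    unfolding split[of Y] split[of "\<lambda>v _. expectation (Y v)"]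
    by (subst (1 2) nn_integral_count_space_nn_integral) (auto simp: ind1)
qed

lemma freeze_expectation:
  fixes T :: "'a \<Rightarrow> 'c::countable" and Y :: "'c \<Rightarrow> 'a \<Rightarrow> real"
  assumes ind: "indep_set (sets G) (sets K)" and sp: "space G = space M" "space K = space M"
    and Y: "\<And>v. Y v \<in> borel_measurable G" and int: "\<And>v. integrable M (Y v)"
    and T: "T \<in> measurable K (count_space UNIV)"
    and bound: "integrable M (\<lambda>\<omega>. expectation (\<lambda>\<omega>'. \<bar>Y (T \<omega>) \<omega>'\<bar>))"
  shows "integrable M (\<lambda>\<omega>. Y (T \<omega>) \<omega>)" (is ?I)
    and "expectation (\<lambda>\<omega>. Y (T \<omega>) \<omega>) = expectation (\<lambda>\<omega>. expectation (Y (T \<omega>)))" (is ?E)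
proof -
  have [measurable]: "T \<in> measurable M (count_space UNIV)" "\<And>v. Y v \<in> borel_measurable M"
    using indep_set_measurable[OF ind sp] T Y by blast+
  have m: "(\<lambda>\<omega>. Z (T \<omega>) \<omega>) \<in> borel_measurable M"
    if [measurable]: "\<And>v. Z v \<in> borel_measurable M" for Z :: "'c \<Rightarrow> 'a \<Rightarrow> real"
    by (rule measurable_compose_countable'[where I=UNIV and g=T]) auto
  have fin: "integrable M (\<lambda>\<omega>. Z (T \<omega>) \<omega>) \<and>
      expectation (\<lambda>\<omega>. Z (T \<omega>) \<omega>) = expectation (\<lambda>\<omega>. expectation (Z (T \<omega>)))"
    if Z: "\<And>v. Z v \<in> borel_measurable G" "\<And>v. integrable M (Z v)" "\<And>v \<omega>. 0 \<le> Z v \<omega>"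
      and b: "integrable M (\<lambda>\<omega>. expectation (Z (T \<omega>)))" for Z :: "'c \<Rightarrow> 'a \<Rightarrow> real"
  proof -
    have mZ: "(\<lambda>\<omega>. Z (T \<omega>) \<omega>) \<in> borel_measurable M"
      by (rule m[of Z]) (use Z(2) in auto)
    have "(\<integral>\<^sup>+\<omega>. ennreal (Z (T \<omega>) \<omega>) \<partial>M) = ennreal (expectation (\<lambda>\<omega>. expectation (Z (T \<omega>))))"
      by (subst freeze_nn_integral[OF ind sp Z(1,2) _ T])
        (use Z(3) b in \<open>auto intro!: nn_integral_eq_integral Bochner_Integration.integral_nonneg\<close>)
    then show ?thesis using Z(3) mZ
      by (auto intro!: integrableI_nonneg simp: integral_eq_nn_integral
          Bochner_Integration.integral_nonneg)
  qed
  let ?p = "\<lambda>v \<omega>. max (Y v \<omega>) 0" and ?n = "\<lambda>v \<omega>. max (- Y v \<omega>) 0"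
  have ip: "integrable M (?p v)" and in': "integrable M (?n v)" for v using int[of v] by auto
  have mE: "(\<lambda>\<omega>. expectation (Z (T \<omega>))) \<in> borel_measurable M" for Z :: "'c \<Rightarrow> 'a \<Rightarrow> real"
    by (rule m[of "\<lambda>v _. expectation (Z v)"]) simp
  have bp: "integrable M (\<lambda>\<omega>. expectation (?p (T \<omega>)))"
    and bn: "integrable M (\<lambda>\<omega>. expectation (?n (T \<omega>)))"
    by (rule Bochner_Integration.integrable_bound[OF bound mE]; intro AE_I2;
      use int ip in' in \<open>auto intro!: integral_mono simp: Bochner_Integration.integral_nonneg\<close>)+
  have Yp: "?p v \<in> borel_measurable G" "?n v \<in> borel_measurable G" for v
    using Y[of v] by measurable
  note P = fin[of ?p, OF Yp(1) ip _ bp] and Q = fin[of ?n, OF Yp(2) in' _ bn]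
  have eq: "Y v \<omega> = ?p v \<omega> - ?n v \<omega>" for v \<omega> by auto
  have eE: "expectation (Y v) = expectation (?p v) - expectation (?n v)" for v
    unfolding Bochner_Integration.integral_diff[OF ip in', symmetric] eq[symmetric] ..
  have "integrable M (\<lambda>\<omega>. ?p (T \<omega>) \<omega> - ?n (T \<omega>) \<omega>)" using P Q by simp
  then show ?I by (simp add: eq[symmetric])
  have "expectation (\<lambda>\<omega>. Y (T \<omega>) \<omega>) = expectation (\<lambda>\<omega>. ?p (T \<omega>) \<omega> - ?n (T \<omega>) \<omega>)"
    by (rule Bochner_Integration.integral_cong) auto
  also have "\<dots> = expectation (\<lambda>\<omega>. expectation (Y (T \<omega>)))"
    using P Q bp bn by (simp add: eE)
  finally show ?E .
qed

text \<open>Freezing takes one variable with values in a countable type. Packing the coordinates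
  into a list covers vectors whose length is a parameter.\<close>

lemma measurable_list_count_space:
  fixes f :: "nat \<Rightarrow> 'a \<Rightarrow> 'c::countable"
  assumes "\<And>i. i < m \<Longrightarrow> f i \<in> measurable K (count_space UNIV)"
  shows "(\<lambda>\<omega>. map (\<lambda>i. f i \<omega>) [0..<m]) \<in> measurable K (count_space UNIV)"
proof (subst measurable_count_space_eq2_countable, intro conjI ballI)
  fix v :: "'c list"
  have "(\<lambda>\<omega>. map (\<lambda>i. f i \<omega>) [0..<m]) -` {v} \<inter> space K
     = (if length v = m then {\<omega> \<in> space K. \<forall>i\<in>{..<m}. f i \<omega> = v ! i} else {})"
  proof -
    have "map (\<lambda>i. f i \<omega>) [0..<m] = v \<longleftrightarrow> length v = m \<and> (\<forall>i\<in>{..<m}. f i \<omega> = v ! i)" for \<omega>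
      unfolding list_eq_iff_nth_eq by simp blast
    then show ?thesis by (auto simp del: map_eq_conv)
  qed
  moreover have "{\<omega> \<in> space K. \<forall>i\<in>{..<m}. f i \<omega> = v ! i} \<in> sets K"
  proof (intro sets.sets_Collect_finite_All)
    fix i assume "i \<in> {..<m}"
    then have "f i -` {v ! i} \<inter> space K \<in> sets K"
      by (intro measurable_sets[OF assms]) auto
    also have "f i -` {v ! i} \<inter> space K = {\<omega> \<in> space K. f i \<omega> = v ! i}" by auto
    finally show "{\<omega> \<in> space K. f i \<omega> = v ! i} \<in> sets K" .
  qed simp
  ultimately show "(\<lambda>\<omega>. map (\<lambda>i. f i \<omega>) [0..<m]) -` {v} \<inter> space K \<in> sets K" by simp
qed auto

end

section \<open>Poisson moments\<close>

text \<open>The \<open>k\<close>-th moment of the Poisson law with mean \<open>x\<close>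
  (\<open>poisson_moment\<close>), a monic polynomial of degree \<open>k\<close> with nonnegative
  coefficients.\<close>

definition touchard :: "nat \<Rightarrow> real \<Rightarrow> real" where
  "touchard k x = (\<Sum>j\<le>k. real (Stirling k j) * x ^ j)"

lemma touchard_nonneg: "0 \<le> x \<Longrightarrow> 0 \<le> touchard k x"
  by (simp add: touchard_def sum_nonneg)

lemma continuous_touchard: "continuous_on UNIV (touchard k)"
  unfolding touchard_def by (intro continuous_intros)

lemma borel_measurable_touchard [measurable]: "touchard k \<in> borel_measurable borel"
  by (rule borel_measurable_continuous_onI[OF continuous_touchard])

lemma touchard_mono: "0 \<le> x \<Longrightarrow> x \<le> y \<Longrightarrow> touchard k x \<le> touchard k y"
  unfolding touchard_def by (intro sum_mono mult_left_mono power_mono) auto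

text \<open>Every term has degree at most \<open>k\<close>, so its power of \<open>c\<close> is
  absorbed by the denominator. The resulting bound does not depend on \<open>c\<close>, which makes
  it a majorant for dominated convergence.\<close>

lemma touchard_scale_le:
  assumes "1 \<le> c" "0 \<le> x" shows "touchard k (c * x) / c ^ k \<le> touchard k x"
  unfolding touchard_def sum_divide_distrib
proof (rule sum_mono)
  fix j assume "j \<in> {..k}"
  then have "c ^ j / c ^ k \<le> 1" using assms by (simp add: power_increasing)
  then have "(c ^ j / c ^ k) * (real (Stirling k j) * x ^ j) \<le> 1 * (real (Stirling k j) * x ^ j)"
    using assms by (intro mult_right_mono) auto
  then show "real (Stirling k j) * (c * x) ^ j / c ^ k \<le> real (Stirling k j) * x ^ j"
    by (simp add: power_mult_distrib algebra_simps)
qed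

text \<open>The term of degree \<open>j\<close> keeps the factor c^(j-k), so only the leading term
  survives.\<close>

lemma touchard_scale_tendsto:
  assumes "filterlim c at_top F" shows "((\<lambda>n. touchard k (c n * x) / c n ^ k) \<longlongrightarrow> x ^ k) F"
proof -
  have pos: "eventually (\<lambda>n. 0 < c n) F"
    using assms by (simp add: filterlim_at_top_dense)
  have "((\<lambda>n. \<Sum>j\<le>k. real (Stirling k j) * x ^ j * inverse (c n ^ (k - j)))
      \<longlongrightarrow> (\<Sum>j\<le>k. if j = k then x ^ k else 0)) F"
  proof (intro tendsto_sum)
    fix j assume j: "j \<in> {..k}"
    show "((\<lambda>n. real (Stirling k j) * x ^ j * inverse (c n ^ (k - j)))
      \<longlongrightarrow> (if j = k then x ^ k else 0)) F"
    proof (cases "j = k")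
      case False
      then have "filterlim (\<lambda>n. c n ^ (k - j)) at_top F"
        using j assms by (intro filterlim_pow_at_top) auto
      then have "((\<lambda>n. inverse (c n ^ (k - j))) \<longlongrightarrow> 0) F"
        using filterlim_at_top_imp_at_infinity tendsto_inverse_0 filterlim_compose by blast
      then show ?thesis using False tendsto_mult_right_zero by auto
    qed simp
  qed
  moreover have "eventually (\<lambda>n. (\<Sum>j\<le>k. real (Stirling k j) * x ^ j * inverse (c n ^ (k - j)))
      = touchard k (c n * x) / c n ^ k) F"
    using pos
  proof eventually_elim
    fix n assume n: "0 < c n"
    show "(\<Sum>j\<le>k. real (Stirling k j) * x ^ j * inverse (c n ^ (k - j)))
      = touchard k (c n * x) / c n ^ k"
      unfolding touchard_def sum_divide_distrib
    proof (rule sum.cong)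
      fix j assume "j \<in> {..k}"
      then have "c n ^ k = c n ^ j * c n ^ (k - j)" by (simp flip: power_add)
      then show "real (Stirling k j) * x ^ j * inverse (c n ^ (k - j))
        = real (Stirling k j) * (c n * x) ^ j / c n ^ k"
        using n by (simp add: power_mult_distrib field_simps)
    qed simp
  qed
  ultimately show ?thesis by (simp add: Lim_transform_eventually)
qed

text \<open>Expansion in falling factorials, written as \<open>fact j * (n choose j)\<close>. The
  induction combines n (n)_j = (n)_(j+1) + j (n)_j with the recurrence of the Stirling numbers of
  the second kind.\<close>

lemma power_eq_sum_Stirling:
  "real n ^ k = (\<Sum>j\<le>k. real (Stirling k j) * (fact j * real (n choose j)))"
proof (induction k)
  case (Suc k)
  let ?f = "\<lambda>j. fact j * real (n choose j) :: real"
  have step: "real n * ?f j = ?f (Suc j) + real j * ?f j" for j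
  proof -
    have a: "real (Suc j * (n choose Suc j)) = real (n - j) * real (n choose j)"
      by (metis binomial_absorb_comp binomial_absorption of_nat_mult mult.commute)
    have b: "real (n - j) * real (n choose j) = (real n - real j) * real (n choose j)"
      by (cases "j \<le> n") (auto simp: of_nat_diff)
    have "(1 + real j) * real (n choose Suc j) = (real n - real j) * real (n choose j)"
      using a unfolding b of_nat_mult of_nat_Suc .
    then have "fact j * ((1 + real j) * real (n choose Suc j))
        = fact j * ((real n - real j) * real (n choose j))" by simp
    then show ?thesis by (simp add: algebra_simps)
  qed
  have "real n ^ Suc k = (\<Sum>j\<le>k. real (Stirling k j) * (real n * ?f j))"
    by (simp add: Suc sum_distrib_left algebra_simps)
  also have "\<dots> = (\<Sum>j\<le>k. real (Stirling k j) * ?f (Suc j)) + (\<Sum>j\<le>k. real j * real (Stirling k j) * ?f j)"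
    unfolding sum.distrib[symmetric] step by (intro sum.cong) (simp_all add: algebra_simps)
  \<comment> \<open>The added term vanishes because \<open>Stirling k (Suc k) = 0\<close>. In the
    next step the term for 0 vanishes through its factor \<open>j\<close>, so the whole sum can be
    shifted.\<close>
  also have "(\<Sum>j\<le>k. real j * real (Stirling k j) * ?f j)
     = (\<Sum>j\<le>Suc k. real j * real (Stirling k j) * ?f j)" by simp
  also have "\<dots> = (\<Sum>j\<le>k. real (Suc j) * real (Stirling k (Suc j)) * ?f (Suc j))"
    by (subst sum.atMost_Suc_shift) simp
  also have "(\<Sum>j\<le>k. real (Stirling k j) * ?f (Suc j)) + \<dots>
      = (\<Sum>j\<le>k. real (Stirling (Suc k) (Suc j)) * ?f (Suc j))"
    unfolding sum.distrib[symmetric] by (intro sum.cong) (simp_all add: algebra_simps)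
  also have "\<dots> = (\<Sum>j\<le>Suc k. real (Stirling (Suc k) j) * ?f j)"
    by (subst sum.atMost_Suc_shift) simp
  finally show ?case .
qed simp

text \<open>The Poisson weight of \<open>i + j\<close> times the falling factorial is
  \<open>\<mu> ^ j\<close> times the weight of \<open>i\<close>; what remains is the total mass
  1.\<close>

lemma poisson_factorial_moment:
  assumes "0 < \<mu>"
  shows "has_bochner_integral (measure_pmf (poisson_pmf \<mu>)) (\<lambda>n. fact j * real (n choose j)) (\<mu> ^ j)"
proof (rule has_bochner_integral_nn_integral)
  let ?g = "\<lambda>n. pmf (poisson_pmf \<mu>) n * (fact j * real (n choose j))"
  have "(\<lambda>i. \<mu> ^ i / fact i) sums exp \<mu>"
    using exp_converges[of \<mu>] by (simp add: divide_inverse_commute scaleR_conv_of_real)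
  then have "(\<lambda>i. \<mu> ^ j * exp (- \<mu>) * (\<mu> ^ i / fact i)) sums (\<mu> ^ j * exp (- \<mu>) * exp \<mu>)"
    by (rule sums_mult)
  moreover have "\<mu> ^ j * exp (- \<mu>) * (\<mu> ^ i / fact i) = ?g (i + j)" for i
  proof -
    have "fact (i + j) = (fact j * fact i * real ((i + j) choose j) :: real)"
      by (simp add: binomial_fact)
    then show ?thesis using assms by (simp add: power_add field_simps)
  qed
  ultimately have "(\<lambda>i. ?g (i + j)) sums (\<mu> ^ j)"
    by (simp add: exp_minus field_simps)
  \<comment> \<open>The unshifted series has \<open>j\<close> more terms, all zero because
    \<open>n choose j\<close> vanishes for \<open>n < j\<close>.\<close>
  then have sums: "?g sums (\<mu> ^ j)"
    by (subst (asm) sums_iff_shift) (simp add: binomial_eq_0)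
  have nn: "0 \<le> ?g n" for n by simp
  have "(\<integral>\<^sup>+n. ennreal (fact j * real (n choose j)) \<partial>measure_pmf (poisson_pmf \<mu>))
      = (\<integral>\<^sup>+n. ennreal (?g n) \<partial>count_space UNIV)"
    by (simp add: nn_integral_measure_pmf ennreal_mult del: pmf_poisson)
  also have "\<dots> = (\<Sum>n. ennreal (?g n))" by (simp add: nn_integral_count_space_nat)
  also have "\<dots> = ennreal (\<Sum>n. ?g n)"
    using sums nn by (intro suminf_ennreal2) (auto simp: sums_iff)
  also have "(\<Sum>n. ?g n) = \<mu> ^ j" using sums by (simp add: sums_iff)
  finally show "(\<integral>\<^sup>+n. ennreal (fact j * real (n choose j)) \<partial>measure_pmf (poisson_pmf \<mu>)) = ennreal (\<mu> ^ j)" .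
qed (use assms in auto)

lemma poisson_moment:
  assumes "0 < \<mu>"
  shows "has_bochner_integral (measure_pmf (poisson_pmf \<mu>)) (\<lambda>n. real n ^ k) (touchard k \<mu>)"
  unfolding power_eq_sum_Stirling touchard_def
  by (intro has_bochner_integral_sum has_bochner_integral_mult_right poisson_factorial_moment assms)

section \<open>Moments and path properties of the Poisson process\<close>

context prob_space
begin

lemma poisson_process_measurable:
  assumes N: "unit_poisson_process N" and "0 \<le> s"
  shows "(\<lambda>\<omega>. real (N s \<omega>)) \<in> borel_measurable M" "N s \<in> measurable M (count_space UNIV)"
proof -
  show *: "(\<lambda>\<omega>. real (N s \<omega>)) \<in> borel_measurable M"
    using assms by (auto simp: unit_poisson_process_def levy_process_def)
  \<comment> \<open>\<open>levy_process\<close> yields measurability of the real-valued process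
    only; rounding returns to \<open>nat\<close>.\<close>
  have "(\<lambda>\<omega>. nat \<lfloor>real (N s \<omega>)\<rfloor>) \<in> measurable M (count_space UNIV)"
    using * by measurable
  then show "N s \<in> measurable M (count_space UNIV)" by simp
qed

lemma poisson_process_0:
  assumes "unit_poisson_process N" shows "AE \<omega> in M. N 0 \<omega> = 0"
  using assms by (auto simp: unit_poisson_process_def levy_process_def)

lemma poisson_increment_distr:
  assumes N: "unit_poisson_process N" and s: "0 \<le> s" "s < u"
  shows "distr M borel (\<lambda>\<omega>. real (N u \<omega>) - real (N s \<omega>))
       = distr (measure_pmf (poisson_pmf (u - s))) borel real"
proof -
  have "distr M borel (\<lambda>\<omega>. real (N (s + (u - s)) \<omega>) - real (N s \<omega>))
      = distr M borel (\<lambda>\<omega>. real (N (u - s) \<omega>))"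
    using N s unfolding unit_poisson_process_def levy_process_def
    by (elim conjE) (simp only: diff_ge_0_iff_ge less_imp_le)
  also have "\<dots> = distr (distr M (count_space UNIV) (N (u - s))) borel real"
    using poisson_process_measurable[OF N, of "u - s"] s by (subst distr_distr) (auto simp: comp_def)
  also have "distr M (count_space UNIV) (N (u - s)) = measure_pmf (poisson_pmf (u - s))"
    using N s by (simp add: unit_poisson_process_def)
  finally show ?thesis by simp
qed

lemma poisson_increment_moment:
  assumes N: "unit_poisson_process N" and s: "0 \<le> s" "s < u"
  shows "integrable M (\<lambda>\<omega>. (real (N u \<omega>) - real (N s \<omega>)) ^ k)"
    and "expectation (\<lambda>\<omega>. (real (N u \<omega>) - real (N s \<omega>)) ^ k) = touchard k (u - s)"
proof -
  have m: "(\<lambda>\<omega>. real (N u \<omega>) - real (N s \<omega>)) \<in> borel_measurable M"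
    using poisson_process_measurable[OF N] s by auto
  have "has_bochner_integral (distr M borel (\<lambda>\<omega>. real (N u \<omega>) - real (N s \<omega>))) (\<lambda>x. x ^ k) (touchard k (u - s))"
    unfolding poisson_increment_distr[OF N s]
    by (rule has_bochner_integral_distr) (use poisson_moment s in auto)
  then have "has_bochner_integral M (\<lambda>\<omega>. (real (N u \<omega>) - real (N s \<omega>)) ^ k) (touchard k (u - s))"
    using m by (auto simp: has_bochner_integral_iff integrable_distr_eq integral_distr)
  then show "integrable M (\<lambda>\<omega>. (real (N u \<omega>) - real (N s \<omega>)) ^ k)"
    "expectation (\<lambda>\<omega>. (real (N u \<omega>) - real (N s \<omega>)) ^ k) = touchard k (u - s)"
    by (auto simp: has_bochner_integral_iff)
qed

lemma poisson_increments_moment: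
  assumes N: "unit_poisson_process N" and "0 \<le> x 0" "\<And>r. r < p \<Longrightarrow> x r < x (Suc r)"
  shows "integrable M (\<lambda>\<omega>. \<Prod>r<p. (real (N (x (Suc r)) \<omega>) - real (N (x r) \<omega>)) ^ k r)"
    and "expectation (\<lambda>\<omega>. \<Prod>r<p. (real (N (x (Suc r)) \<omega>) - real (N (x r) \<omega>)) ^ k r)
       = (\<Prod>r<p. touchard (k r) (x (Suc r) - x r))"
proof -
  let ?D = "\<lambda>r \<omega>. real (N (x (Suc r)) \<omega>) - real (N (x r) \<omega>)"
  have nn: "r \<le> p \<Longrightarrow> 0 \<le> x r" for r
  proof (induction r)
    case (Suc r)
    then show ?case using assms(3)[of r] by simp
  qed (use assms in simp)
  have "indep_vars (\<lambda>_. borel) ?D {..<p}"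
    using N assms unfolding unit_poisson_process_def levy_process_def by blast
  then have ind: "indep_vars (\<lambda>_. borel) (\<lambda>r \<omega>. ?D r \<omega> ^ k r) {..<p}"
    by (rule indep_vars_compose2) auto
  note mom = poisson_increment_moment[OF N nn assms(3)]
  show "integrable M (\<lambda>\<omega>. \<Prod>r<p. ?D r \<omega> ^ k r)"
    by (rule indep_vars_integrable[OF _ ind]) (auto intro!: mom)
  have "expectation (\<lambda>\<omega>. \<Prod>r<p. ?D r \<omega> ^ k r) = (\<Prod>r<p. expectation (\<lambda>\<omega>. ?D r \<omega> ^ k r))"
    by (rule indep_vars_lebesgue_integral[OF _ ind]) (auto intro!: mom)
  also have "\<dots> = (\<Prod>r<p. touchard (k r) (x (Suc r) - x r))"
    by (rule prod.cong) (auto intro!: mom)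
  finally show "expectation (\<lambda>\<omega>. \<Prod>r<p. ?D r \<omega> ^ k r) = (\<Prod>r<p. touchard (k r) (x (Suc r) - x r))" .
qed

text \<open>An integer-valued function that moves by less than 1 near a point is constant
  there.\<close>

lemma poisson_right_constant:
  assumes N: "unit_poisson_process N"
  shows "AE \<omega> in M. \<forall>s\<ge>0. eventually (\<lambda>u. N u \<omega> = N s \<omega>) (at_right s)"
proof -
  have "AE \<omega> in M. \<forall>s\<ge>0. continuous (at_right s) (\<lambda>u. real (N u \<omega>))"
    using N unfolding unit_poisson_process_def levy_process_def by auto
  then show ?thesis
  proof eventually_elim
    case (elim \<omega>)
    show ?case
    proof (intro allI impI)
      fix s :: real assume "0 \<le> s"
      then have "((\<lambda>u. real (N u \<omega>)) \<longlongrightarrow> real (N s \<omega>)) (at_right s)"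
        using elim by (auto simp: continuous_within)
      then have "eventually (\<lambda>u. dist (real (N u \<omega>)) (real (N s \<omega>)) < 1) (at_right s)"
        by (rule tendstoD) simp
      then show "eventually (\<lambda>u. N u \<omega> = N s \<omega>) (at_right s)"
        by eventually_elim (auto simp: dist_real_def)
    qed
  qed
qed

text \<open>Each increment is almost surely nonnegative because it has a Poisson law. Rational pairs
  need only one common null set, and right constancy carries the inequality to all real
  times.\<close>

lemma poisson_mono:
  assumes N: "unit_poisson_process N"
  shows "AE \<omega> in M. \<forall>s u. 0 \<le> s \<longrightarrow> s \<le> u \<longrightarrow> N s \<omega> \<le> N u \<omega>"
proof -
  have "AE \<omega> in M. N s \<omega> \<le> N u \<omega>" if s: "0 \<le> s" "s \<le> u" for s u
  proof (cases "s = u")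
    case False
    then have su: "s < u" using s by simp
    have m: "(\<lambda>\<omega>. real (N u \<omega>) - real (N s \<omega>)) \<in> borel_measurable M"
      using poisson_process_measurable[OF N] s by auto
    have "AE x in distr M borel (\<lambda>\<omega>. real (N u \<omega>) - real (N s \<omega>)). 0 \<le> x"
      unfolding poisson_increment_distr[OF N s(1) su] by (subst AE_distr_iff) auto
    then have "AE \<omega> in M. 0 \<le> real (N u \<omega>) - real (N s \<omega>)"
      using m by (subst (asm) AE_distr_iff) auto
    then show ?thesis by eventually_elim simp
  qed simp
  then have "AE \<omega> in M. \<forall>s\<in>\<rat>. \<forall>u\<in>\<rat>. 0 \<le> s \<longrightarrow> s \<le> u \<longrightarrow> N s \<omega> \<le> N u \<omega>"
    using countable_rat by (auto intro!: AE_ball_countable[THEN iffD2])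
  then show ?thesis using poisson_right_constant[OF N]
  proof eventually_elim
    case (elim \<omega>)
    have rat: "\<exists>q\<in>\<rat>. s < q \<and> q < b \<and> N q \<omega> = N s \<omega>" if s: "0 \<le> s" "s < b" for s b
    proof -
      obtain c where c: "s < c" "\<forall>y>s. y < c \<longrightarrow> N y \<omega> = N s \<omega>"
        using elim(2)[rule_format, OF s(1)] unfolding eventually_at_right_field by blast
      obtain q where "q \<in> \<rat>" "s < q" "q < min b c"
        using Rats_dense_in_real[of s "min b c"] s c by auto
      then show ?thesis using c by auto
    qed
    show ?case
    proof (intro allI impI)
      fix s u :: real assume su: "0 \<le> s" "s \<le> u"
      show "N s \<omega> \<le> N u \<omega>"
      proof (cases "s = u")
        case False
        then obtain q where q: "q \<in> \<rat>" "s < q" "q < u" "N q \<omega> = N s \<omega>"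
          using rat[of s u] su by auto
        obtain q' where q': "q' \<in> \<rat>" "u < q'" "N q' \<omega> = N u \<omega>"
          using rat[of u "u + 1"] su by auto
        have "N q \<omega> \<le> N q' \<omega>"
          using elim(1)[rule_format, of q q'] q q' su by simp
        then show ?thesis using q q' by simp
      qed simp
    qed
  qed
qed

end

section \<open>Random time changes of the Poisson process\<close>

text \<open>\<open>touchard k 1\<close> is the sum of the coefficients. Bounding by one power
  reduces integrability to moments of the random times.\<close>

lemma touchard_le_power:
  assumes "0 \<le> x" shows "touchard k x \<le> touchard k 1 * (1 + x) ^ k"
  unfolding touchard_def sum_distrib_right
proof (rule sum_mono)
  fix j assume "j \<in> {..k}"
  have "x ^ j \<le> (1 + x) ^ j" using assms by (intro power_mono) auto
  also have "\<dots> \<le> (1 + x) ^ k" using assms \<open>j \<in> {..k}\<close> by (intro power_increasing) auto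
  finally show "real (Stirling k j) * x ^ j \<le> real (Stirling k j) * 1 ^ j * (1 + x) ^ k"
    by (simp add: mult_left_mono)
qed

lemma prod_touchard_le:
  assumes "\<And>r. r < p \<Longrightarrow> 0 \<le> x r \<and> x r \<le> y"
  shows "(\<Prod>r<p. touchard (k r) (x r)) \<le> (\<Prod>r<p. touchard (k r) 1) * (1 + y) ^ (\<Sum>r<p. k r)"
proof -
  have "(\<Prod>r<p. touchard (k r) (x r)) \<le> (\<Prod>r<p. touchard (k r) 1 * (1 + y) ^ k r)"
  proof (intro prod_mono conjI)
    fix r assume "r \<in> {..<p}"
    then have x: "0 \<le> x r" "x r \<le> y" using assms by auto
    show "0 \<le> touchard (k r) (x r)" by (rule touchard_nonneg[OF x(1)])
    have "touchard (k r) (x r) \<le> touchard (k r) 1 * (1 + x r) ^ k r"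
      by (rule touchard_le_power[OF x(1)])
    also have "\<dots> \<le> touchard (k r) 1 * (1 + y) ^ k r"
      using x by (intro mult_left_mono power_mono touchard_nonneg) auto
    finally show "touchard (k r) (x r) \<le> touchard (k r) 1 * (1 + y) ^ k r" .
  qed
  then show ?thesis by (simp add: prod.distrib power_sum)
qed

lemma tendsto_prod_touchard:
  assumes "\<And>r. r < p \<Longrightarrow> ((\<lambda>i. x i r) \<longlongrightarrow> y r) F"
  shows "((\<lambda>i. \<Prod>r<p. touchard (k r) (x i r)) \<longlongrightarrow> (\<Prod>r<p. touchard (k r) (y r))) F"
  unfolding touchard_def using assms by (intro tendsto_intros) auto

text \<open>The lattice point lies strictly to the right of \<open>x\<close>, at distance at most
  \<open>(1 + r) / Suc i\<close>. The offset \<open>r\<close> will keep the approximations of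
  different times apart.\<close>

lemma filterlim_lattice_ceiling:
  "filterlim (\<lambda>i. (of_int \<lfloor>real (Suc i) * x\<rfloor> + 1 + real r) / real (Suc i)) (at_right x) sequentially"
proof (rule tendsto_imp_filterlim_at_right)
  show "(\<lambda>i. (of_int \<lfloor>real (Suc i) * x\<rfloor> + 1 + real r) / real (Suc i)) \<longlonglongrightarrow> x"
  proof (rule tendsto_sandwich)
    show "(\<lambda>i. x) \<longlonglongrightarrow> x" by simp
    have "(\<lambda>i. (1 + real r) * inverse (real (Suc i))) \<longlonglongrightarrow> (1 + real r) * 0"
      by (intro tendsto_intros LIMSEQ_inverse_real_of_nat)
    then show "(\<lambda>i. x + (1 + real r) * inverse (real (Suc i))) \<longlonglongrightarrow> x"
      using tendsto_add[OF tendsto_const[of x]] by fastforce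
    show "\<forall>\<^sub>F i in sequentially. x \<le> (of_int \<lfloor>real (Suc i) * x\<rfloor> + 1 + real r) / real (Suc i)"
    proof (intro always_eventually allI)
      fix i
      have "real (Suc i) * x \<le> of_int \<lfloor>real (Suc i) * x\<rfloor> + 1 + real r" by linarith
      then show "x \<le> (of_int \<lfloor>real (Suc i) * x\<rfloor> + 1 + real r) / real (Suc i)"
        by (simp only: pos_le_divide_eq of_nat_0_less_iff zero_less_Suc mult.commute)
    qed
    show "\<forall>\<^sub>F i in sequentially. (of_int \<lfloor>real (Suc i) * x\<rfloor> + 1 + real r) / real (Suc i)
        \<le> x + (1 + real r) * inverse (real (Suc i))"
    proof (intro always_eventually allI)
      fix i
      have "of_int \<lfloor>real (Suc i) * x\<rfloor> + 1 + real r \<le> real (Suc i) * x + (1 + real r)" by linarith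
      then have "(of_int \<lfloor>real (Suc i) * x\<rfloor> + 1 + real r) / real (Suc i)
          \<le> (real (Suc i) * x + (1 + real r)) / real (Suc i)" by (intro divide_right_mono) auto
      also have "\<dots> = x + (1 + real r) * inverse (real (Suc i))"
        by (simp add: add_divide_distrib inverse_eq_divide del: of_nat_Suc)
      finally show "(of_int \<lfloor>real (Suc i) * x\<rfloor> + 1 + real r) / real (Suc i)
        \<le> x + (1 + real r) * inverse (real (Suc i))" .
    qed
  qed
  show "\<forall>\<^sub>F i in sequentially. x < (of_int \<lfloor>real (Suc i) * x\<rfloor> + 1 + real r) / real (Suc i)"
  proof (intro always_eventually allI)
    fix i
    have "real (Suc i) * x < of_int \<lfloor>real (Suc i) * x\<rfloor> + 1 + real r" by linarith
    then show "x < (of_int \<lfloor>real (Suc i) * x\<rfloor> + 1 + real r) / real (Suc i)"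
      by (simp only: pos_less_divide_eq of_nat_0_less_iff zero_less_Suc mult.commute)
  qed
qed

lemma (in prob_space) integrable_shifted_power:
  fixes f :: "'a \<Rightarrow> real"
  assumes "\<And>k. integrable M (\<lambda>\<omega>. f \<omega> ^ k)" shows "integrable M (\<lambda>\<omega>. (f \<omega> + a) ^ k)"
  unfolding binomial_ring by (intro Bochner_Integration.integrable_sum integrable_mult_left
      integrable_mult_right assms)

lemma (in prob_space) indep_set_commute:
  "indep_set A B \<Longrightarrow> indep_set B A"
  unfolding indep_sets2_eq by (metis Int_commute mult.commute)

context prob_space
begin

text \<open>
  Measurability of \<open>\<omega> \<mapsto> N (\<tau> r \<omega>) \<omega>\<close> has to be assumed: the paths of \<open>N\<close> are right continuous only almost
  surely, and \<open>M\<close> need not be complete.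
\<close>

context
  fixes N :: "real \<Rightarrow> 'a \<Rightarrow> nat" and G :: "'a measure" and \<tau> :: "nat \<Rightarrow> 'a \<Rightarrow> real" and p :: nat
    and k :: "nat \<Rightarrow> nat"
  assumes N: "unit_poisson_process N"
    and ind: "indep_set (sets G) (gen_events {0..} (\<lambda>s \<omega>. real (N s \<omega>)))" and sp: "space G = space M"
    and \<tau>: "\<And>r. r \<le> p \<Longrightarrow> \<tau> r \<in> borel_measurable G"
    and \<tau>_nn: "AE \<omega> in M. 0 \<le> \<tau> 0 \<omega>" and \<tau>_mono: "AE \<omega> in M. \<forall>r<p. \<tau> r \<omega> \<le> \<tau> (Suc r) \<omega>"
    and mom: "\<And>k. integrable M (\<lambda>\<omega>. \<tau> p \<omega> ^ k)"
    and meas: "\<And>r. r \<le> p \<Longrightarrow> (\<lambda>\<omega>. real (N (\<tau> r \<omega>) \<omega>)) \<in> borel_measurable M"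
begin

private abbreviation (input) "GN \<equiv> gen_measure {0..} (\<lambda>s \<omega>. real (N s \<omega>))"

private lemma ind': "indep_set (sets GN) (sets G)"
  using indep_set_commute[OF ind] by (simp add: sets_gen_measure)

private lemma \<tau>_all: "AE \<omega> in M. (\<forall>r\<le>p. 0 \<le> \<tau> r \<omega> \<and> \<tau> r \<omega> \<le> \<tau> p \<omega>) \<and> (\<forall>r<p. \<tau> r \<omega> \<le> \<tau> (Suc r) \<omega>)"
  using \<tau>_nn \<tau>_mono
proof eventually_elim
  case (elim \<omega>)
  have "r \<le> p \<Longrightarrow> 0 \<le> \<tau> r \<omega>" for r
    using elim by (induction r) (auto intro: order_trans)
  moreover have "\<tau> r \<omega> \<le> \<tau> p \<omega>" if "r \<le> p" for r
    using that
  proof (induction rule: inc_induct)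
    case (step n)
    then show ?case using elim(2)[rule_format, of n] by simp
  qed simp
  ultimately show ?case using elim by auto
qed

text \<open>Every lattice approximation used below stays under
  \<lfloor>\<open>\<tau> p\<close>\<rfloor> + p + 2, so each approximate increment of
  \<open>N\<close> is at most the increment from 0 to that time. This time depends on \<tau> only
  through an integer, so freezing shows that the power is integrable.\<close>

private lemma dominating_power:
  obtains R where "integrable M R"
    "AE \<omega> in M. R \<omega> = (real (N (of_int \<lfloor>\<tau> p \<omega>\<rfloor> + real p + 2) \<omega>) - real (N 0 \<omega>)) ^ K"
proof -
  \<comment> \<open>Set to 0 for negative \<open>z\<close>, where the time may be negative and
    nothing is known about \<open>N\<close>.\<close>
  define Y where "Y = (\<lambda>z \<omega>. if 0 \<le> z then (real (N (of_int z + real p + 2) \<omega>) - real (N 0 \<omega>)) ^ K else 0)"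
  have T: "(\<lambda>\<omega>. \<lfloor>\<tau> p \<omega>\<rfloor>) \<in> measurable G (count_space UNIV)"
    using \<tau>[of p] by measurable
  have Y: "Y z \<in> borel_measurable GN" for z
  proof (cases "0 \<le> z")
    case True
    have "(\<lambda>\<omega>. real (N (of_int z + real p + 2) \<omega>)) \<in> borel_measurable GN"
      "(\<lambda>\<omega>. real (N 0 \<omega>)) \<in> borel_measurable GN"
      using True by (auto intro!: measurable_gen_measure[of _ "{0..}" "\<lambda>s \<omega>. real (N s \<omega>)"])
    then show ?thesis using True by (simp add: Y_def)
  qed (simp add: Y_def)
  have iY: "integrable M (Y z)" for z
    using poisson_increment_moment(1)[OF N, of 0 "of_int z + real p + 2" K]
    by (cases "0 \<le> z") (auto simp: Y_def)
  have abs: "AE \<omega> in M. \<forall>z. \<bar>Y z \<omega>\<bar> = Y z \<omega>"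
    using poisson_mono[OF N] by eventually_elim (auto simp: Y_def)
  have EY: "expectation (\<lambda>\<omega>'. \<bar>Y z \<omega>'\<bar>) = (if 0 \<le> z then touchard K (of_int z + real p + 2) else 0)" for z
  proof -
    have "expectation (\<lambda>\<omega>'. \<bar>Y z \<omega>'\<bar>) = expectation (Y z)"
      by (rule integral_cong_AE) (use abs iY in auto)
    then show ?thesis
      using poisson_increment_moment(2)[OF N, of 0 "of_int z + real p + 2" K] by (auto simp: Y_def)
  qed
  have mp: "(\<lambda>\<omega>. \<lfloor>\<tau> p \<omega>\<rfloor>) \<in> measurable M (count_space UNIV)"
    by (rule indep_set_measurable(2)[OF ind' _ sp T]) simp
  have "integrable M (\<lambda>\<omega>. Y \<lfloor>\<tau> p \<omega>\<rfloor> \<omega>)"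
  proof (rule freeze_expectation(1)[OF ind' _ sp Y iY T])
    show "integrable M (\<lambda>\<omega>. expectation (\<lambda>\<omega>'. \<bar>Y \<lfloor>\<tau> p \<omega>\<rfloor> \<omega>'\<bar>))"
    proof (rule Bochner_Integration.integrable_bound[OF integrable_mult_right[OF
            integrable_shifted_power[OF mom, of "real p + 3" K], of "touchard K 1"]])
      show "(\<lambda>\<omega>. expectation (\<lambda>\<omega>'. \<bar>Y \<lfloor>\<tau> p \<omega>\<rfloor> \<omega>'\<bar>)) \<in> borel_measurable M"
        by (rule measurable_compose[OF mp]) simp
      show "AE \<omega> in M. norm (expectation (\<lambda>\<omega>'. \<bar>Y \<lfloor>\<tau> p \<omega>\<rfloor> \<omega>'\<bar>))
          \<le> norm (touchard K 1 * (\<tau> p \<omega> + (real p + 3)) ^ K)"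
        using \<tau>_all
      proof eventually_elim
        case (elim \<omega>)
        then have nn: "0 \<le> \<tau> p \<omega>" by auto
        have "touchard K (of_int \<lfloor>\<tau> p \<omega>\<rfloor> + real p + 2) \<le> touchard K (\<tau> p \<omega> + real p + 2)"
          using nn by (intro touchard_mono) auto
        also have "\<dots> \<le> touchard K 1 * (1 + (\<tau> p \<omega> + real p + 2)) ^ K"
          using nn by (intro touchard_le_power) auto
        finally show ?case
          using nn touchard_nonneg[of "of_int \<lfloor>\<tau> p \<omega>\<rfloor> + real p + 2" K] touchard_nonneg[of 1 K]
          by (simp add: EY abs_mult add_ac)
      qed
    qed
  qed simp
  then show thesis
    by (rule that) (use \<tau>_all in \<open>eventually_elim, auto simp: Y_def\<close>)
qed

text \<open>
  The random times are approximated from the right by strictly increasing lattice-valued ones, to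
  which freezing applies; right continuity of \<open>N\<close> makes the approximation eventually exact.
\<close>

lemma poisson_time_change:
  shows "integrable M (\<lambda>\<omega>. \<Prod>r<p. (real (N (\<tau> (Suc r) \<omega>) \<omega>) - real (N (\<tau> r \<omega>) \<omega>)) ^ k r)"
    and "expectation (\<lambda>\<omega>. \<Prod>r<p. (real (N (\<tau> (Suc r) \<omega>) \<omega>) - real (N (\<tau> r \<omega>) \<omega>)) ^ k r)
      = expectation (\<lambda>\<omega>. \<Prod>r<p. touchard (k r) (\<tau> (Suc r) \<omega> - \<tau> r \<omega>))"
proof -
  define W where "W = (\<lambda>\<omega>. \<Prod>r<p. (real (N (\<tau> (Suc r) \<omega>) \<omega>) - real (N (\<tau> r \<omega>) \<omega>)) ^ k r)"
  \<comment> \<open>The summand 1 puts the time strictly to the right of \<open>\<tau> r\<close>;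
    the summand \<open>r\<close> makes successive times strictly increasing even where the rounded
    values agree, as the independence of increments requires.\<close>
  define d where "d = (\<lambda>i r z. (of_int z + 1 + real r) / real (Suc i))"
  \<comment> \<open>The lists that occur almost surely. \<open>Y\<close> and \<open>e\<close> are 0
    on all others, so that measurability and moments hold for every list, as freezing
    demands.\<close>
  define good where "good v \<longleftrightarrow> 0 \<le> v ! 0 \<and> (\<forall>r<p. v ! r \<le> v ! Suc r)" for v :: "int list"
  define Y where "Y = (\<lambda>i v \<omega>. if good v then
      (\<Prod>r<p. (real (N (d i (Suc r) (v ! Suc r)) \<omega>) - real (N (d i r (v ! r)) \<omega>)) ^ k r) else 0)"
  define e where "e = (\<lambda>i v. if good v then
      (\<Prod>r<p. touchard (k r) (d i (Suc r) (v ! Suc r) - d i r (v ! r))) else 0)"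
  define T where "T = (\<lambda>i \<omega>. map (\<lambda>r. \<lfloor>real (Suc i) * \<tau> r \<omega>\<rfloor>) [0..<Suc p])"
  define x where "x = (\<lambda>i r \<omega>. d i r \<lfloor>real (Suc i) * \<tau> r \<omega>\<rfloor>)"
  have Tn: "T i \<omega> ! r = \<lfloor>real (Suc i) * \<tau> r \<omega>\<rfloor>" if "r \<le> p" for i r \<omega>
    using that unfolding T_def by (subst nth_map) (auto simp del: upt_Suc)
  have good_nn: "0 \<le> v ! r" if "good v" "r \<le> p" for v r
    using that(2)
  proof (induction r)
    case (Suc r)
    then show ?case using that(1) unfolding good_def by (meson Suc_le_lessD order_trans Suc_leD)
  qed (use that in \<open>auto simp: good_def\<close>)
  have d_nn: "0 \<le> d i r (v ! r)" if "good v" "r \<le> p" for i v r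
    using good_nn[OF that] by (simp add: d_def)
  have d_less: "d i r (v ! r) < d i (Suc r) (v ! Suc r)" if "good v" "r < p" for i v r
  proof -
    have "v ! r \<le> v ! Suc r" using that by (auto simp: good_def)
    then have "real_of_int (v ! r) \<le> real_of_int (v ! Suc r)" by simp
    then show ?thesis unfolding d_def by (intro divide_strict_right_mono) auto
  qed
  have mG: "(\<lambda>\<omega>. real (N s \<omega>)) \<in> borel_measurable GN" if "0 \<le> s" for s
    using that by (auto intro!: measurable_gen_measure[of _ "{0..}" "\<lambda>s \<omega>. real (N s \<omega>)"])
  have YG: "Y i v \<in> borel_measurable GN" for i v
    by (cases "good v") (auto simp: Y_def d_nn intro!: borel_measurable_prod borel_measurable_power
        borel_measurable_diff mG)
  have mom_v: "integrable M (Y i v)" "expectation (Y i v) = e i v" for i v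
    using poisson_increments_moment[OF N, of "\<lambda>r. d i r (v ! r)" p k] d_nn[of v 0 i] d_less[of v _ i]
    by (cases "good v"; simp add: Y_def e_def)+
  have Y_abs: "AE \<omega> in M. \<forall>i v. \<bar>Y i v \<omega>\<bar> = Y i v \<omega>"
    using poisson_mono[OF N]
  proof eventually_elim
    case (elim \<omega>)
    have "0 \<le> Y i v \<omega>" for i v
      using elim d_nn d_less[of v _ i] unfolding Y_def
      by (auto intro!: prod_nonneg zero_le_power simp: less_imp_le)
    then show ?case by auto
  qed
  \<comment> \<open>The paths of \<open>N\<close> are almost surely nondecreasing, so absolute
    values may be dropped; hence the integrability that freezing asks for is that of
    \<open>e\<close>, which has an explicit bound.\<close>
  have EY: "expectation (\<lambda>\<omega>'. \<bar>Y i v \<omega>'\<bar>) = e i v" for i v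
    unfolding mom_v(2)[symmetric]
    by (rule integral_cong_AE) (use Y_abs mom_v(1)[of i v] in \<open>auto dest: borel_measurable_integrable\<close>)
  have TG: "T i \<in> measurable G (count_space UNIV)" for i
    unfolding T_def
  proof (rule measurable_list_count_space)
    fix r assume "r < Suc p"
    then have [measurable]: "\<tau> r \<in> borel_measurable G" using \<tau> by simp
    show "(\<lambda>\<omega>. \<lfloor>real (Suc i) * \<tau> r \<omega>\<rfloor>) \<in> measurable G (count_space UNIV)" by measurable
  qed
  have TM: "T i \<in> measurable M (count_space UNIV)" for i
    by (rule indep_set_measurable(2)[OF ind' _ sp TG]) simp
  have \<tau>M: "r \<le> p \<Longrightarrow> \<tau> r \<in> borel_measurable M" for r
    by (rule indep_set_measurable(2)[OF ind' _ sp \<tau>]) simp_all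
  have x_bounds: "\<tau> r \<omega> < x i r \<omega>" "x i r \<omega> \<le> \<tau> r \<omega> + 1 + real r" for i r \<omega>
  proof -
    have "real (Suc i) * \<tau> r \<omega> < of_int \<lfloor>real (Suc i) * \<tau> r \<omega>\<rfloor> + 1 + real r" by linarith
    then show "\<tau> r \<omega> < x i r \<omega>"
      by (simp only: x_def d_def pos_less_divide_eq of_nat_0_less_iff zero_less_Suc mult.commute)
    have "of_int \<lfloor>real (Suc i) * \<tau> r \<omega>\<rfloor> + 1 + real r \<le> real (Suc i) * \<tau> r \<omega> + 1 * (1 + real r)"
      unfolding mult_1 by linarith
    also have "\<dots> \<le> real (Suc i) * \<tau> r \<omega> + real (Suc i) * (1 + real r)"
      by (intro add_left_mono mult_right_mono) auto
    also have "\<dots> = (\<tau> r \<omega> + 1 + real r) * real (Suc i)" by (simp add: algebra_simps)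
    finally show "x i r \<omega> \<le> \<tau> r \<omega> + 1 + real r"
      by (simp only: x_def d_def pos_divide_le_eq of_nat_0_less_iff zero_less_Suc)
  qed
  have good_T: "good (T i \<omega>)" if "\<forall>r\<le>p. 0 \<le> \<tau> r \<omega> \<and> \<tau> r \<omega> \<le> \<tau> p \<omega>" "\<forall>r<p. \<tau> r \<omega> \<le> \<tau> (Suc r) \<omega>" for i \<omega>
    unfolding good_def using that by (auto simp: Tn intro!: floor_mono mult_left_mono)
  have e_T: "e i (T i \<omega>) = (\<Prod>r<p. touchard (k r) (x i (Suc r) \<omega> - x i r \<omega>))" if "good (T i \<omega>)" for i \<omega>
    using that by (auto simp: e_def Tn x_def intro!: prod.cong)
  have Y_T: "Y i (T i \<omega>) \<omega> = (\<Prod>r<p. (real (N (x i (Suc r) \<omega>) \<omega>) - real (N (x i r \<omega>) \<omega>)) ^ k r)"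
    if "good (T i \<omega>)" for i \<omega>
    using that by (auto simp: Y_def Tn x_def intro!: prod.cong)
  have x_mono: "x i r \<omega> \<le> x i (Suc r) \<omega>" if "good (T i \<omega>)" "r < p" for i r \<omega>
    using d_less[OF that, of i] that(2) by (simp add: Tn x_def)
  let ?K = "\<Sum>r<p. k r"
  define C where "C = (\<Prod>r<p. touchard (k r) 1)"
  have C: "0 \<le> C" by (auto simp: C_def intro!: prod_nonneg touchard_nonneg)
  have dom: "integrable M (\<lambda>\<omega>. C * (\<tau> p \<omega> + (real p + 2)) ^ ?K)"
    by (intro integrable_mult_right integrable_shifted_power mom)
  have e_dom: "AE \<omega> in M. norm (e i (T i \<omega>)) \<le> C * (\<tau> p \<omega> + (real p + 2)) ^ ?K" for i
    using \<tau>_all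
  proof eventually_elim
    case (elim \<omega>)
    then have g: "good (T i \<omega>)" by (intro good_T) auto
    have "0 \<le> x i (Suc r) \<omega> - x i r \<omega> \<and> x i (Suc r) \<omega> - x i r \<omega> \<le> \<tau> p \<omega> + real p + 1" if r: "r < p" for r
    proof -
      have "x i (Suc r) \<omega> \<le> \<tau> (Suc r) \<omega> + 1 + real (Suc r)" by (rule x_bounds)
      also have "\<dots> \<le> \<tau> p \<omega> + 1 + real p" using elim r by (intro add_mono) auto
      finally have "x i (Suc r) \<omega> \<le> \<tau> p \<omega> + 1 + real p" .
      moreover have "0 \<le> \<tau> r \<omega>" using elim r by auto
      ultimately show ?thesis using x_bounds(1)[of r \<omega> i] x_mono[OF g r] by auto
    qed
    then have "(\<Prod>r<p. touchard (k r) (x i (Suc r) \<omega> - x i r \<omega>)) \<le> C * (1 + (\<tau> p \<omega> + real p + 1)) ^ ?K"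
      unfolding C_def by (intro prod_touchard_le) auto
    moreover have "0 \<le> (\<Prod>r<p. touchard (k r) (x i (Suc r) \<omega> - x i r \<omega>))"
      using x_mono[OF g] by (auto intro!: prod_nonneg touchard_nonneg)
    ultimately show ?case by (simp add: e_T[OF g] add_ac)
  qed
  have e_meas: "(\<lambda>\<omega>. e i (T i \<omega>)) \<in> borel_measurable M" for i
    by (rule measurable_compose[OF TM]) simp
  have int_e: "integrable M (\<lambda>\<omega>. e i (T i \<omega>))" for i
    by (rule Bochner_Integration.integrable_bound[OF dom e_meas])
      (use e_dom[of i] in \<open>eventually_elim, auto\<close>)
  have fr: "integrable M (\<lambda>\<omega>. Y i (T i \<omega>) \<omega>)"
    "expectation (\<lambda>\<omega>. Y i (T i \<omega>) \<omega>) = expectation (\<lambda>\<omega>. e i (T i \<omega>))" for i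
    using freeze_expectation[of GN G "Y i" "T i", OF ind' _ sp YG mom_v(1) TG] int_e
    by (simp_all add: EY mom_v(2))
  \<comment> \<open>Convergence is strictly from the right, so right constancy of \<open>N\<close>
    makes its values at the approximations eventually equal to its value at the limit.\<close>
  have lim_x: "filterlim (\<lambda>i. x i r \<omega>) (at_right (\<tau> r \<omega>)) sequentially" for r \<omega>
    unfolding x_def d_def by (rule filterlim_lattice_ceiling)
  have lim_e: "(\<lambda>i. expectation (\<lambda>\<omega>. e i (T i \<omega>)))
      \<longlonglongrightarrow> expectation (\<lambda>\<omega>. \<Prod>r<p. touchard (k r) (\<tau> (Suc r) \<omega> - \<tau> r \<omega>))"
  proof (rule integral_dominated_convergence[OF _ e_meas dom _ e_dom])
    show "(\<lambda>\<omega>. \<Prod>r<p. touchard (k r) (\<tau> (Suc r) \<omega> - \<tau> r \<omega>)) \<in> borel_measurable M"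
      using \<tau>M by (intro borel_measurable_prod measurable_compose[OF _ borel_measurable_touchard]
          borel_measurable_diff) auto
    show "AE \<omega> in M. (\<lambda>i. e i (T i \<omega>)) \<longlonglongrightarrow> (\<Prod>r<p. touchard (k r) (\<tau> (Suc r) \<omega> - \<tau> r \<omega>))"
      using \<tau>_all
    proof eventually_elim
      case (elim \<omega>)
      then have "good (T i \<omega>)" for i by (intro good_T) auto
      then have "(\<lambda>i. e i (T i \<omega>)) = (\<lambda>i. \<Prod>r<p. touchard (k r) (x i (Suc r) \<omega> - x i r \<omega>))"
        by (simp add: e_T)
      moreover have lim: "(\<lambda>i. x i r \<omega>) \<longlonglongrightarrow> \<tau> r \<omega>" for r
        using lim_x[of r \<omega>] by (auto simp: filterlim_at)
      have "(\<lambda>i. \<Prod>r<p. touchard (k r) (x i (Suc r) \<omega> - x i r \<omega>))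
          \<longlonglongrightarrow> (\<Prod>r<p. touchard (k r) (\<tau> (Suc r) \<omega> - \<tau> r \<omega>))"
        by (rule tendsto_prod_touchard) (intro tendsto_diff lim)
      ultimately show ?case by simp
    qed
  qed
  have mW: "W \<in> borel_measurable M"
    unfolding W_def by (intro borel_measurable_prod borel_measurable_power borel_measurable_diff meas) auto
  obtain R where R: "integrable M R"
    "AE \<omega> in M. R \<omega> = (real (N (of_int \<lfloor>\<tau> p \<omega>\<rfloor> + real p + 2) \<omega>) - real (N 0 \<omega>)) ^ ?K"
    by (rule dominating_power)
  have Y_dom: "AE \<omega> in M. norm (Y i (T i \<omega>) \<omega>) \<le> R \<omega>" for i
    using R(2) \<tau>_all poisson_mono[OF N]
  proof eventually_elim
    case (elim \<omega>)
    then have g: "good (T i \<omega>)" by (intro good_T) auto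
    let ?b = "real (N (of_int \<lfloor>\<tau> p \<omega>\<rfloor> + real p + 2) \<omega>) - real (N 0 \<omega>)"
    have x_nn: "0 \<le> x i r \<omega>" if "r \<le> p" for r
      using d_nn[OF g that, of i] that by (simp add: x_def Tn)
    have x_le: "x i r \<omega> \<le> of_int \<lfloor>\<tau> p \<omega>\<rfloor> + real p + 2" if r: "r \<le> p" for r
    proof -
      have "x i r \<omega> \<le> \<tau> r \<omega> + 1 + real r" by (rule x_bounds)
      also have "\<dots> \<le> \<tau> p \<omega> + 1 + real p" using elim r by (intro add_mono) auto
      finally show ?thesis by linarith
    qed
    have "\<bar>Y i (T i \<omega>) \<omega>\<bar> \<le> (\<Prod>r<p. ?b ^ k r)"
      unfolding Y_T[OF g] abs_prod
    proof (rule prod_mono)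
      fix r assume "r \<in> {..<p}"
      then have r: "r < p" by simp
      have "N (x i r \<omega>) \<omega> \<le> N (x i (Suc r) \<omega>) \<omega>" "N 0 \<omega> \<le> N (x i r \<omega>) \<omega>"
        "N (x i (Suc r) \<omega>) \<omega> \<le> N (of_int \<lfloor>\<tau> p \<omega>\<rfloor> + real p + 2) \<omega>"
        using elim(3) x_nn[of r] x_nn[of "Suc r"] x_le[of "Suc r"] x_mono[OF g r] r by auto
      then show "0 \<le> \<bar>(real (N (x i (Suc r) \<omega>) \<omega>) - real (N (x i r \<omega>) \<omega>)) ^ k r\<bar> \<and>
        \<bar>(real (N (x i (Suc r) \<omega>) \<omega>) - real (N (x i r \<omega>) \<omega>)) ^ k r\<bar> \<le> ?b ^ k r"
        by (auto simp: power_abs intro!: power_mono)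
    qed
    then show ?case by (simp add: elim(1) power_sum)
  qed
  have Y_lim: "AE \<omega> in M. (\<lambda>i. Y i (T i \<omega>) \<omega>) \<longlonglongrightarrow> W \<omega>"
    using \<tau>_all poisson_right_constant[OF N]
  proof eventually_elim
    case (elim \<omega>)
    have g: "good (T i \<omega>)" for i using elim(1) by (intro good_T) auto
    have "eventually (\<lambda>i. N (x i r \<omega>) \<omega> = N (\<tau> r \<omega>) \<omega>) sequentially" if "r \<le> p" for r
      using elim that by (intro eventually_compose_filterlim[OF _ lim_x]) auto
    then have "(\<lambda>i. real (N (x i r \<omega>) \<omega>)) \<longlonglongrightarrow> real (N (\<tau> r \<omega>) \<omega>)" if "r \<le> p" for r
      using that by (intro tendsto_eventually) simp
    then show ?case
      unfolding Y_T[OF g] W_def by (intro tendsto_intros) auto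
  qed
  note dc = borel_measurable_integrable[OF fr(1)] R(1) Y_lim Y_dom
  have "integrable M W"
    by (rule integrable_dominated_convergence[OF mW dc])
  then show "integrable M (\<lambda>\<omega>. \<Prod>r<p. (real (N (\<tau> (Suc r) \<omega>) \<omega>) - real (N (\<tau> r \<omega>) \<omega>)) ^ k r)"
    unfolding W_def .
  have "(\<lambda>i. expectation (\<lambda>\<omega>. Y i (T i \<omega>) \<omega>)) \<longlonglongrightarrow> expectation W"
    by (rule integral_dominated_convergence[OF mW dc])
  then show "expectation (\<lambda>\<omega>. \<Prod>r<p. (real (N (\<tau> (Suc r) \<omega>) \<omega>) - real (N (\<tau> r \<omega>) \<omega>)) ^ k r)
      = expectation (\<lambda>\<omega>. \<Prod>r<p. touchard (k r) (\<tau> (Suc r) \<omega> - \<tau> r \<omega>))"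
    using lim_e unfolding fr(2) W_def by (rule LIMSEQ_unique)
qed

end
end

section \<open>Self-similarity of the stable subordinator\<close>

context prob_space
begin

text \<open>Equal moments mean equal expectations of polynomials. Uniform approximation on [0,1]
  within \<open>e / 2\<close> costs \<open>e / 2\<close> for each of the two variables.\<close>

lemma expectation_poly_eq_imp_continuous_eq:
  fixes U V :: "'a \<Rightarrow> real" and f :: "real \<Rightarrow> real"
  assumes [measurable]: "U \<in> borel_measurable M" "V \<in> borel_measurable M"
    and U: "AE \<omega> in M. U \<omega> \<in> {0..1}" and V: "AE \<omega> in M. V \<omega> \<in> {0..1}"
    and mom: "\<And>n::nat. expectation (\<lambda>\<omega>. U \<omega> ^ n) = expectation (\<lambda>\<omega>. V \<omega> ^ n)"
    and f: "continuous_on UNIV f"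
  shows "expectation (\<lambda>\<omega>. f (U \<omega>)) = expectation (\<lambda>\<omega>. f (V \<omega>))"
proof -
  have int: "integrable M (\<lambda>\<omega>. g (W \<omega>))"
    if g: "continuous_on UNIV g" and [measurable]: "W \<in> borel_measurable M" and W: "AE \<omega> in M. W \<omega> \<in> {0..1}"
    for g :: "real \<Rightarrow> real" and W :: "'a \<Rightarrow> real"
  proof -
    have "bounded (g ` {0..1})"
      by (intro compact_imp_bounded compact_continuous_image continuous_on_subset[OF g]) auto
    then obtain B where B: "\<And>x. x \<in> {0..1} \<Longrightarrow> norm (g x) \<le> B" unfolding bounded_iff by blast
    have [measurable]: "g \<in> borel_measurable borel" by (rule borel_measurable_continuous_onI[OF g])
    show ?thesis
      by (rule integrable_const_bound[where B=B, OF eventually_mono[OF W B]]) measurable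
  qed
  have "\<bar>expectation (\<lambda>\<omega>. f (U \<omega>)) - expectation (\<lambda>\<omega>. f (V \<omega>))\<bar> \<le> e" if e: "0 < e" for e
  proof -
    obtain g where g: "real_polynomial_function g" "\<And>x. x \<in> {0..1} \<Longrightarrow> \<bar>f x - g x\<bar> < e / 2"
      using Stone_Weierstrass_real_polynomial_function[of "{0..1::real}" f "e / 2",
          OF compact_Icc continuous_on_subset[OF f]] e by (metis half_gt_zero subset_UNIV)
    then obtain a n where ga: "g = (\<lambda>x. \<Sum>i\<le>n. a i * x ^ i)"
      using real_polynomial_function_iff_sum by metis
    have cg: "continuous_on UNIV g" unfolding ga by (intro continuous_intros)
    have pow: "integrable M (\<lambda>\<omega>. U \<omega> ^ i)" "integrable M (\<lambda>\<omega>. V \<omega> ^ i)" for i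
      using int[of "\<lambda>x. x ^ i" U, OF _ _ U] int[of "\<lambda>x. x ^ i" V, OF _ _ V] assms(1,2)
      by (simp_all add: continuous_intros)
    have eq: "expectation (\<lambda>\<omega>. g (U \<omega>)) = expectation (\<lambda>\<omega>. g (V \<omega>))"
      unfolding ga by (simp add: pow mom)
    have close: "\<bar>expectation (\<lambda>\<omega>. f (W \<omega>)) - expectation (\<lambda>\<omega>. g (W \<omega>))\<bar> \<le> e / 2"
      if [measurable]: "W \<in> borel_measurable M" and W: "AE \<omega> in M. W \<omega> \<in> {0..1}" for W :: "'a \<Rightarrow> real"
    proof -
      note i = int[OF f that] int[OF cg that]
      have "\<bar>expectation (\<lambda>\<omega>. f (W \<omega>) - g (W \<omega>))\<bar> \<le> expectation (\<lambda>\<omega>. \<bar>f (W \<omega>) - g (W \<omega>)\<bar>)"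
        by (rule integral_abs_bound)
      also have "\<dots> \<le> expectation (\<lambda>\<omega>. e / 2)"
        by (rule integral_mono_AE) (use i eventually_mono[OF W less_imp_le[OF g(2)]] in simp_all)
      finally show ?thesis using i by (simp add: prob_space)
    qed
    show ?thesis using close[OF assms(1) U] close[OF assms(2) V] eq by linarith
  qed
  then have "\<bar>expectation (\<lambda>\<omega>. f (U \<omega>)) - expectation (\<lambda>\<omega>. f (V \<omega>))\<bar> \<le> 0"
    by (rule field_le_epsilon) simp
  then show ?thesis by simp
qed

text \<open>Cosine and sine are continuous test functions, so the characteristic functions
  agree.\<close>

lemma distr_eq_if_moments_eq:
  fixes U V :: "'a \<Rightarrow> real"
  assumes [measurable]: "U \<in> borel_measurable M" "V \<in> borel_measurable M"
    and U: "AE \<omega> in M. U \<omega> \<in> {0..1}" and V: "AE \<omega> in M. V \<omega> \<in> {0..1}"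
    and mom: "\<And>n::nat. expectation (\<lambda>\<omega>. U \<omega> ^ n) = expectation (\<lambda>\<omega>. V \<omega> ^ n)"
  shows "distr M borel U = distr M borel V"
proof (rule Levy_uniqueness)
  show "real_distribution (distr M borel U)" "real_distribution (distr M borel V)"
    by (auto intro!: real_distribution_distr)
  show "char (distr M borel U) = char (distr M borel V)"
  proof
    fix t
    have eq: "expectation (\<lambda>\<omega>. f (U \<omega>)) = expectation (\<lambda>\<omega>. f (V \<omega>))"
      if "continuous_on UNIV f" for f :: "real \<Rightarrow> real"
      using expectation_poly_eq_imp_continuous_eq[OF assms that] .
    have i: "integrable M (\<lambda>\<omega>. iexp (t * W \<omega>))" if "W \<in> borel_measurable M" for W :: "'a \<Rightarrow> real"
      by (rule integrable_const_bound[where B=1]) (use that in auto)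
    have "(CLINT \<omega>|M. iexp (t * U \<omega>)) = (CLINT \<omega>|M. iexp (t * V \<omega>))"
    proof (rule complex_eqI)
      show "Re (CLINT \<omega>|M. iexp (t * U \<omega>)) = Re (CLINT \<omega>|M. iexp (t * V \<omega>))"
        using eq[of "\<lambda>x. cos (t * x)"] i[of U] i[of V]
        by (simp add: integral_Re[symmetric] Re_exp continuous_intros)
      show "Im (CLINT \<omega>|M. iexp (t * U \<omega>)) = Im (CLINT \<omega>|M. iexp (t * V \<omega>))"
        using eq[of "\<lambda>x. sin (t * x)"] i[of U] i[of V]
        by (simp add: integral_Im[symmetric] Im_exp continuous_intros)
    qed
    then show "char (distr M borel U) t = char (distr M borel V) t"
      by (simp add: char_def integral_distr)
  qed
qed

text \<open>The Laplace transform of \<open>Y\<close> at the integer \<open>n\<close> is the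
  \<open>n\<close>-th moment of exp(-Y), a variable with values in [0,1]; the logarithm then
  recovers \<open>Y\<close>.\<close>

lemma distr_eq_if_laplace_eq:
  fixes Y Z :: "'a \<Rightarrow> real"
  assumes [measurable]: "Y \<in> borel_measurable M" "Z \<in> borel_measurable M"
    and "AE \<omega> in M. 0 \<le> Y \<omega>" "AE \<omega> in M. 0 \<le> Z \<omega>"
    and "\<And>n::nat. 0 < n \<Longrightarrow> expectation (\<lambda>\<omega>. exp (- real n * Y \<omega>)) = expectation (\<lambda>\<omega>. exp (- real n * Z \<omega>))"
  shows "distr M borel Y = distr M borel Z"
proof -
  have "distr M borel (\<lambda>\<omega>. exp (- Y \<omega>)) = distr M borel (\<lambda>\<omega>. exp (- Z \<omega>))"
  proof (rule distr_eq_if_moments_eq)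
    fix n :: nat
    show "expectation (\<lambda>\<omega>. exp (- Y \<omega>) ^ n) = expectation (\<lambda>\<omega>. exp (- Z \<omega>) ^ n)"
      using assms(5)[of n] by (cases "n = 0") (auto simp: exp_of_nat_mult[symmetric])
  qed (use assms in \<open>auto elim!: eventually_mono\<close>)
  then have "distr (distr M borel (\<lambda>\<omega>. exp (- Y \<omega>))) borel (\<lambda>x. - ln x)
      = distr (distr M borel (\<lambda>\<omega>. exp (- Z \<omega>))) borel (\<lambda>x. - ln x)" by simp
  then show ?thesis by (simp add: distr_distr comp_def)
qed


section \<open>Scaling of the laws of the stable subordinator\<close>

lemma stable_subordinator_measurable:
  "stable_subordinator \<alpha> H \<Longrightarrow> 0 \<le> s \<Longrightarrow> H s \<in> borel_measurable M"
  by (auto simp: stable_subordinator_def levy_process_def)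

lemma stable_subordinator_nonneg:
  assumes "stable_subordinator \<alpha> H"
  shows "AE \<omega> in M. H 0 \<omega> = 0 \<and> (\<forall>s\<ge>0. 0 \<le> H s \<omega>)"
proof -
  have "AE \<omega> in M. H 0 \<omega> = 0" "AE \<omega> in M. mono_on {0..} (\<lambda>t. H t \<omega>)"
    using assms by (auto simp: stable_subordinator_def levy_process_def)
  then show ?thesis
  proof eventually_elim
    case (elim \<omega>)
    then show ?case using mono_onD[OF elim(2), of 0] by auto
  qed
qed

text \<open>At \<open>u\<close> both sides have Laplace transform exp(-c s u^\<alpha>), because (u
  c^(1/\<alpha>))^\<alpha> = c u^\<alpha>.\<close>

lemma stable_subordinator_distr_scale:
  assumes H: "stable_subordinator \<alpha> H" and \<alpha>: "0 < \<alpha>" and c: "0 < c" and s: "0 \<le> s"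
  shows "distr M borel (H (c * s)) = distr M borel (\<lambda>\<omega>. c powr (1 / \<alpha>) * H s \<omega>)"
proof (rule distr_eq_if_laplace_eq)
  show "H (c * s) \<in> borel_measurable M" "(\<lambda>\<omega>. c powr (1 / \<alpha>) * H s \<omega>) \<in> borel_measurable M"
    using stable_subordinator_measurable[OF H] c s by auto
  show "AE \<omega> in M. 0 \<le> H (c * s) \<omega>" "AE \<omega> in M. 0 \<le> c powr (1 / \<alpha>) * H s \<omega>"
    by (rule eventually_mono[OF stable_subordinator_nonneg[OF H]]; use c s in simp)+
  fix n :: nat assume n: "0 < n"
  have E: "expectation (\<lambda>\<omega>. exp (- u * H t \<omega>)) = exp (- t * u powr \<alpha>)" if "0 \<le> t" "0 < u" for t u
    using H that by (auto simp: stable_subordinator_def)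
  have "expectation (\<lambda>\<omega>. exp (- (real n * c powr (1 / \<alpha>)) * H s \<omega>)) = exp (- s * (real n * c powr (1 / \<alpha>)) powr \<alpha>)"
    using s n c by (intro E) auto
  also have "(real n * c powr (1 / \<alpha>)) powr \<alpha> = real n powr \<alpha> * c"
    using c \<alpha> by (simp add: powr_mult powr_powr)
  also have "exp (- s * (real n powr \<alpha> * c)) = expectation (\<lambda>\<omega>. exp (- real n * H (c * s) \<omega>))"
    using s n c by (subst E) (auto simp: mult_ac)
  finally show "expectation (\<lambda>\<omega>. exp (- real n * H (c * s) \<omega>))
      = expectation (\<lambda>\<omega>. exp (- real n * (c powr (1 / \<alpha>) * H s \<omega>)))"
    by (simp add: mult.assoc)
qed

text \<open>Independence makes the law of an increment vector the product of its marginals, and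
  stationarity reduces each marginal to the scaling at a single time. The product description is
  stated for nonempty index sets, whence \<open>0 < n\<close>.\<close>

lemma stable_subordinator_increments_scale:
  assumes H: "stable_subordinator \<alpha> H" and \<alpha>: "0 < \<alpha>" and c: "0 < c"
    and s: "0 \<le> s 0" "\<And>i. i < n \<Longrightarrow> s i < s (Suc i)" and n: "0 < (n::nat)"
  shows "distr M (PiM {..<n} (\<lambda>_. borel)) (\<lambda>\<omega>. \<lambda>i\<in>{..<n}. H (c * s (Suc i)) \<omega> - H (c * s i) \<omega>)
    = distr M (PiM {..<n} (\<lambda>_. borel)) (\<lambda>\<omega>. \<lambda>i\<in>{..<n}. c powr (1 / \<alpha>) * (H (s (Suc i)) \<omega> - H (s i) \<omega>))"
proof -
  have nn: "i \<le> n \<Longrightarrow> 0 \<le> s i" for i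
  proof (induction i)
    case (Suc i)
    then show ?case using s(2)[of i] by simp
  qed (use s in simp)
  note Hm = stable_subordinator_measurable[OF H]
  have lev: "levy_process H" using H by (simp add: stable_subordinator_def)
  have ind: "indep_vars (\<lambda>_. borel) (\<lambda>i \<omega>. H (v (Suc i)) \<omega> - H (v i) \<omega>) {..<n}"
    if "0 \<le> v 0" "\<And>i. i < n \<Longrightarrow> v i < v (Suc i)" for v :: "nat \<Rightarrow> real"
    using lev that unfolding levy_process_def by blast
  have ind1: "indep_vars (\<lambda>_. borel) (\<lambda>i \<omega>. H (c * s (Suc i)) \<omega> - H (c * s i) \<omega>) {..<n}"
    using ind[of "\<lambda>i. c * s i"] c s by simp
  have ind2: "indep_vars (\<lambda>_. borel) (\<lambda>i \<omega>. c powr (1 / \<alpha>) * (H (s (Suc i)) \<omega> - H (s i) \<omega>)) {..<n}"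
    by (rule indep_vars_compose2[OF ind[of s]]) (use s in auto)
  have stat: "distr M borel (\<lambda>\<omega>. H (u + h) \<omega> - H u \<omega>) = distr M borel (H h)" if "0 \<le> u" "0 \<le> h" for u h
    using lev that unfolding levy_process_def by blast
  have marg: "distr M borel (\<lambda>\<omega>. H (c * s (Suc i)) \<omega> - H (c * s i) \<omega>)
      = distr M borel (\<lambda>\<omega>. c powr (1 / \<alpha>) * (H (s (Suc i)) \<omega> - H (s i) \<omega>))" if i: "i < n" for i
  proof -
    define h where "h = s (Suc i) - s i"
    have h: "0 \<le> h" "0 \<le> s i" "s (Suc i) = s i + h" using s(2)[OF i] nn[of i] i by (auto simp: h_def)
    have "distr M borel (\<lambda>\<omega>. H (c * s (Suc i)) \<omega> - H (c * s i) \<omega>) = distr M borel (H (c * h))"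
      using stat[of "c * s i" "c * h"] c h by (simp add: distrib_left)
    also have "\<dots> = distr M borel (\<lambda>\<omega>. c powr (1 / \<alpha>) * H h \<omega>)"
      by (rule stable_subordinator_distr_scale[OF H \<alpha> c h(1)])
    also have "\<dots> = distr (distr M borel (H h)) borel (\<lambda>x. c powr (1 / \<alpha>) * x)"
      using Hm[OF h(1)] by (simp add: distr_distr comp_def)
    also have "distr M borel (H h) = distr M borel (\<lambda>\<omega>. H (s (Suc i)) \<omega> - H (s i) \<omega>)"
      using stat[of "s i" h] h by simp
    also have "distr \<dots> borel (\<lambda>x. c powr (1 / \<alpha>) * x)
        = distr M borel (\<lambda>\<omega>. c powr (1 / \<alpha>) * (H (s (Suc i)) \<omega> - H (s i) \<omega>))"
      using Hm h by (subst distr_distr) (auto simp: comp_def)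
    finally show ?thesis .
  qed
  have rv: "i \<in> {..<n} \<Longrightarrow> random_variable borel (\<lambda>\<omega>. H (c * s (Suc i)) \<omega> - H (c * s i) \<omega>)"
    "i \<in> {..<n} \<Longrightarrow> random_variable borel (\<lambda>\<omega>. c powr (1 / \<alpha>) * (H (s (Suc i)) \<omega> - H (s i) \<omega>))" for i
    using Hm nn c by auto
  have "{..<n} \<noteq> {}" using n by auto
  note iff = indep_vars_iff_distr_eq_PiM'[OF this]
  have "distr M (PiM {..<n} (\<lambda>_. borel)) (\<lambda>\<omega>. \<lambda>i\<in>{..<n}. H (c * s (Suc i)) \<omega> - H (c * s i) \<omega>)
      = (\<Pi>\<^sub>M i\<in>{..<n}. distr M borel (\<lambda>\<omega>. H (c * s (Suc i)) \<omega> - H (c * s i) \<omega>))"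
    using iff[where M'="\<lambda>_. borel" and X="\<lambda>i \<omega>. H (c * s (Suc i)) \<omega> - H (c * s i) \<omega>"] rv(1) ind1 by blast
  also have "\<dots> = (\<Pi>\<^sub>M i\<in>{..<n}. distr M borel (\<lambda>\<omega>. c powr (1 / \<alpha>) * (H (s (Suc i)) \<omega> - H (s i) \<omega>)))"
    by (rule PiM_cong) (auto simp: marg)
  also have "\<dots> = distr M (PiM {..<n} (\<lambda>_. borel))
      (\<lambda>\<omega>. \<lambda>i\<in>{..<n}. c powr (1 / \<alpha>) * (H (s (Suc i)) \<omega> - H (s i) \<omega>))"
    using iff[where M'="\<lambda>_. borel" and X="\<lambda>i \<omega>. c powr (1 / \<alpha>) * (H (s (Suc i)) \<omega> - H (s i) \<omega>)"]
      rv(2) ind2 by (intro sym[of "distr _ _ _"]) blast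
  finally show ?thesis .
qed

text \<open>The times \<open>x r\<close> come in any order and may repeat. They are sorted into a
  strictly increasing list, and the values of \<open>H\<close> are recovered as partial sums of its
  increments.\<close>

lemma stable_subordinator_fdd_scale:
  assumes H: "stable_subordinator \<alpha> H" and \<alpha>: "0 < \<alpha>" and c: "0 < c"
    and x: "\<And>r. r \<le> p \<Longrightarrow> 0 \<le> x r"
  shows "distr M (PiM {0..p::nat} (\<lambda>_. borel)) (\<lambda>\<omega>. \<lambda>r\<in>{0..p}. H (c * x r) \<omega>)
    = distr M (PiM {0..p} (\<lambda>_. borel)) (\<lambda>\<omega>. \<lambda>r\<in>{0..p}. c powr (1 / \<alpha>) * H (x r) \<omega>)"
proof -
  \<comment> \<open>The point 0 lets the partial sums start from \<open>H 0 = 0\<close>. The point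
    beyond the maximum ensures that there is at least one increment, even if all \<open>x r\<close>
    are 0.\<close>
  define S where "S = insert 0 (insert (1 + Max (x ` {0..p})) (x ` {0..p}))"
  have fS: "finite S" by (simp add: S_def)
  define l where "l = sorted_list_of_set S"
  have l: "set l = S" "sorted_wrt (<) l" using fS by (auto simp: l_def)
  define n where "n = length l - 1"
  have "x 0 \<le> Max (x ` {0..p})" by (intro Max_ge) auto
  then have "1 + Max (x ` {0..p}) \<noteq> 0" using x[of 0, OF le0] by linarith
  then have "card {0, 1 + Max (x ` {0..p})} \<le> card S" using fS by (intro card_mono) (auto simp: S_def)
  then have "2 \<le> length l" using \<open>1 + Max (x ` {0..p}) \<noteq> 0\<close> by (auto simp: l_def)
  then have n: "0 < n" "length l = Suc n" by (auto simp: n_def)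
  have Snn: "0 \<le> y" if "y \<in> S" for y
  proof -
    have "0 \<le> Max (x ` {0..p})"
      using \<open>x 0 \<le> Max (x ` {0..p})\<close> x[of 0, OF le0] by linarith
    then show ?thesis using that x unfolding S_def by (elim insertE) auto
  qed
  have step: "l ! i < l ! Suc i" if "i < n" for i
    using l(2) that n by (auto simp: sorted_wrt_iff_nth_less)
  have l0: "l ! 0 = 0"
  proof -
    have "0 \<in> set l" using l by (simp add: S_def)
    then obtain i where i: "i < length l" "l ! i = 0" by (auto simp: in_set_conv_nth)
    have "l ! 0 \<in> S" using l n by (metis nth_mem zero_less_Suc)
    then have "0 \<le> l ! 0" by (rule Snn)
    moreover have "l ! 0 \<le> l ! i"
      using sorted_wrt_nth_less[OF l(2), of 0 i] i(1) by (cases "i = 0") auto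
    ultimately show ?thesis using i(2) by simp
  qed
  have "\<forall>r\<in>{0..p}. \<exists>j. j \<le> n \<and> l ! j = x r"
  proof
    fix r assume "r \<in> {0..p}"
    then have "x r \<in> set l" using l by (auto simp: S_def)
    then show "\<exists>j. j \<le> n \<and> l ! j = x r" using n by (auto simp: in_set_conv_nth less_Suc_eq_le)
  qed
  from bchoice[OF this] obtain idx where idx: "\<And>r. r \<in> {0..p} \<Longrightarrow> idx r \<le> n \<and> l ! idx r = x r"
    by blast
  note Hm = stable_subordinator_measurable[OF H]
  have lnn: "0 \<le> l ! i" if "i \<le> n" for i using that l n Snn by (metis le_imp_less_Suc nth_mem)
  \<comment> \<open>The value at \<open>x r\<close> is the sum of the increments before its position
    \<open>idx r\<close>. The map is measurable and common to both sides, so equality of the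
    increment laws passes through it.\<close>
  define \<Phi> where "\<Phi> = (\<lambda>y. \<lambda>r\<in>{0..p}. \<Sum>i<idx r. y i :: real)"
  have \<Phi>: "\<Phi> \<in> measurable (PiM {..<n} (\<lambda>_. borel)) (PiM {0..p} (\<lambda>_. borel))"
    unfolding \<Phi>_def
  proof (intro measurable_restrict borel_measurable_sum measurable_component_singleton)
    fix r i assume "r \<in> {0..p}" "i \<in> {..<idx r}"
    then show "i \<in> {..<n}" using idx[of r] by auto
  qed
  let ?P = "PiM {0..p} (\<lambda>_. borel) :: (nat \<Rightarrow> real) measure"
  have m1: "(\<lambda>\<omega>. \<lambda>i\<in>{..<n}. H (c * l ! Suc i) \<omega> - H (c * l ! i) \<omega>) \<in> measurable M (PiM {..<n} (\<lambda>_. borel))"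
    by (intro measurable_restrict borel_measurable_diff Hm mult_nonneg_nonneg lnn) (use c in auto)
  have m2: "(\<lambda>\<omega>. \<lambda>i\<in>{..<n}. c powr (1 / \<alpha>) * (H (l ! Suc i) \<omega> - H (l ! i) \<omega>)) \<in> measurable M (PiM {..<n} (\<lambda>_. borel))"
    by (intro measurable_restrict borel_measurable_times borel_measurable_diff Hm lnn) auto
  have mx: "(\<lambda>\<omega>. \<lambda>r\<in>{0..p}. H (c * x r) \<omega>) \<in> measurable M ?P"
    "(\<lambda>\<omega>. \<lambda>r\<in>{0..p}. c powr (1 / \<alpha>) * H (x r) \<omega>) \<in> measurable M ?P"
    by (intro measurable_restrict borel_measurable_times Hm mult_nonneg_nonneg x; use c in simp)+
  have "distr M ?P (\<lambda>\<omega>. \<lambda>r\<in>{0..p}. H (c * x r) \<omega>)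
      = distr M ?P (\<lambda>\<omega>. \<Phi> (\<lambda>i\<in>{..<n}. H (c * l ! Suc i) \<omega> - H (c * l ! i) \<omega>))"
  proof (rule distr_cong_AE[OF refl refl _ mx(1) measurable_compose[OF m1 \<Phi>]])
    show "AE \<omega> in M. (\<lambda>r\<in>{0..p}. H (c * x r) \<omega>) = \<Phi> (\<lambda>i\<in>{..<n}. H (c * l ! Suc i) \<omega> - H (c * l ! i) \<omega>)"
      using stable_subordinator_nonneg[OF H]
    proof eventually_elim
      case (elim \<omega>)
      show ?case unfolding \<Phi>_def
      proof (rule restrict_ext)
        fix r assume r: "r \<in> {0..p}"
        have "(\<Sum>i<idx r. (\<lambda>i\<in>{..<n}. H (c * l ! Suc i) \<omega> - H (c * l ! i) \<omega>) i)
            = (\<Sum>i<idx r. H (c * l ! Suc i) \<omega> - H (c * l ! i) \<omega>)"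
          using idx[OF r] by (intro sum.cong) auto
        also have "\<dots> = H (c * l ! idx r) \<omega> - H (c * l ! 0) \<omega>"
          by (rule sum_lessThan_telescope[of "\<lambda>i. H (c * l ! i) \<omega>"])
        finally show "H (c * x r) \<omega> = (\<Sum>i<idx r. (\<lambda>i\<in>{..<n}. H (c * l ! Suc i) \<omega> - H (c * l ! i) \<omega>) i)"
          using idx[OF r] elim l0 by simp
      qed
    qed
  qed
  also have "\<dots> = distr (distr M (PiM {..<n} (\<lambda>_. borel)) (\<lambda>\<omega>. \<lambda>i\<in>{..<n}. H (c * l ! Suc i) \<omega> - H (c * l ! i) \<omega>)) ?P \<Phi>"
    by (simp add: distr_distr[OF \<Phi> m1] comp_def)
  finally have lhs: "distr M ?P (\<lambda>\<omega>. \<lambda>r\<in>{0..p}. H (c * x r) \<omega>) = \<dots>" .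
  have law: "distr M (PiM {..<n} (\<lambda>_. borel)) (\<lambda>\<omega>. \<lambda>i\<in>{..<n}. H (c * l ! Suc i) \<omega> - H (c * l ! i) \<omega>)
      = distr M (PiM {..<n} (\<lambda>_. borel)) (\<lambda>\<omega>. \<lambda>i\<in>{..<n}. c powr (1 / \<alpha>) * (H (l ! Suc i) \<omega> - H (l ! i) \<omega>))"
    using stable_subordinator_increments_scale[where s="(!) l", OF H \<alpha> c _ step n(1)] l0 by simp
  have "distr (distr M (PiM {..<n} (\<lambda>_. borel)) (\<lambda>\<omega>. \<lambda>i\<in>{..<n}. c powr (1 / \<alpha>) * (H (l ! Suc i) \<omega> - H (l ! i) \<omega>))) ?P \<Phi>
      = distr M ?P (\<lambda>\<omega>. \<Phi> (\<lambda>i\<in>{..<n}. c powr (1 / \<alpha>) * (H (l ! Suc i) \<omega> - H (l ! i) \<omega>)))"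
    by (simp add: distr_distr[OF \<Phi> m2] comp_def)
  also have "\<dots> = distr M ?P (\<lambda>\<omega>. \<lambda>r\<in>{0..p}. c powr (1 / \<alpha>) * H (x r) \<omega>)"
  proof (rule distr_cong_AE[OF refl refl _ measurable_compose[OF m2 \<Phi>] mx(2)])
    show "AE \<omega> in M. \<Phi> (\<lambda>i\<in>{..<n}. c powr (1 / \<alpha>) * (H (l ! Suc i) \<omega> - H (l ! i) \<omega>))
        = (\<lambda>r\<in>{0..p}. c powr (1 / \<alpha>) * H (x r) \<omega>)"
      using stable_subordinator_nonneg[OF H]
    proof eventually_elim
      case (elim \<omega>)
      show ?case unfolding \<Phi>_def
      proof (rule restrict_ext)
        fix r assume r: "r \<in> {0..p}"
        have "(\<Sum>i<idx r. (\<lambda>i\<in>{..<n}. c powr (1 / \<alpha>) * (H (l ! Suc i) \<omega> - H (l ! i) \<omega>)) i)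
            = (\<Sum>i<idx r. c powr (1 / \<alpha>) * H (l ! Suc i) \<omega> - c powr (1 / \<alpha>) * H (l ! i) \<omega>)"
          using idx[OF r] by (intro sum.cong) (auto simp: right_diff_distrib)
        also have "\<dots> = c powr (1 / \<alpha>) * H (l ! idx r) \<omega> - c powr (1 / \<alpha>) * H (l ! 0) \<omega>"
          by (rule sum_lessThan_telescope[of "\<lambda>i. c powr (1 / \<alpha>) * H (l ! i) \<omega>"])
        finally show "(\<Sum>i<idx r. (\<lambda>i\<in>{..<n}. c powr (1 / \<alpha>) * (H (l ! Suc i) \<omega> - H (l ! i) \<omega>)) i)
            = c powr (1 / \<alpha>) * H (x r) \<omega>"
          using idx[OF r] elim l0 by simp
      qed
    qed
  qed
  finally show ?thesis
    unfolding lhs law .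
qed

end

section \<open>The inverse subordinator\<close>

text \<open>Right continuity makes the infimum attained: if \<open>h x < t\<close>, then
  \<open>h\<close> stays below \<open>t\<close> on some interval to the right of \<open>x\<close>,
  and by monotonicity also before \<open>x\<close>, so the infimum exceeds \<open>x\<close>.\<close>

lemma Inf_hitting_le_iff:
  fixes h :: "real \<Rightarrow> real"
  assumes mono: "mono_on {0..} h" and cont: "\<And>s. 0 \<le> s \<Longrightarrow> continuous (at_right s) h"
    and ex: "\<exists>s\<ge>0. t \<le> h s" and x: "0 \<le> x"
  shows "Inf {s. 0 \<le> s \<and> t \<le> h s} \<le> x \<longleftrightarrow> t \<le> h x"
proof
  assume "t \<le> h x"
  then show "Inf {s. 0 \<le> s \<and> t \<le> h s} \<le> x"
    using x by (intro cInf_lower) (auto intro!: bdd_belowI[of _ 0])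
next
  assume le: "Inf {s. 0 \<le> s \<and> t \<le> h s} \<le> x"
  show "t \<le> h x"
  proof (rule ccontr)
    assume "\<not> t \<le> h x"
    then have "h x < t" by simp
    moreover have "(h \<longlongrightarrow> h x) (at_right x)"
      using cont[OF x] by (simp add: continuous_within)
    ultimately have "eventually (\<lambda>y. h y < t) (at_right x)" by (rule order_tendstoD(2)[rotated])
    then obtain c where c: "x < c" "\<And>y. x < y \<Longrightarrow> y < c \<Longrightarrow> h y < t"
      unfolding eventually_at_right_field by blast
    have "c \<le> Inf {s. 0 \<le> s \<and> t \<le> h s}"
    proof (rule cInf_greatest)
      show "{s. 0 \<le> s \<and> t \<le> h s} \<noteq> {}" using ex by auto
      fix s assume s: "s \<in> {s. 0 \<le> s \<and> t \<le> h s}"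
      show "c \<le> s"
      proof (rule ccontr)
        assume "\<not> c \<le> s"
        then consider "s \<le> x" | "x < s" "s < c" by linarith
        then show False
        proof cases
          case 1
          then have "h s \<le> h x" using s x by (intro mono_onD[OF mono]) auto
          then show False using s \<open>h x < t\<close> by auto
        next
          case 2
          then show False using c(2)[of s] s by auto
        qed
      qed
    qed
    then show False using le c by simp
  qed
qed

context prob_space
begin

text \<open>Chernoff bound at u = 1: the indicator of \<open>H s < t\<close> is at most exp(t - H
  s), and the Laplace transform at 1 is exp(-s).\<close>

lemma stable_subordinator_tail:
  assumes H: "stable_subordinator \<alpha> H" and s: "0 \<le> s"
  shows "prob {\<omega> \<in> space M. H s \<omega> < t} \<le> exp (t - s)"
proof -
  have [measurable]: "H s \<in> borel_measurable M" by (rule stable_subordinator_measurable[OF H s])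
  have E: "expectation (\<lambda>\<omega>. exp (- 1 * H s \<omega>)) = exp (- s)"
  proof -
    have "\<forall>t\<ge>0. \<forall>u>0. expectation (\<lambda>\<omega>. exp (- u * H t \<omega>)) = exp (- t * u powr \<alpha>)"
      using H by (simp add: stable_subordinator_def)
    from this[rule_format, OF s, of 1] show ?thesis by simp
  qed
  have int: "integrable M (\<lambda>\<omega>. exp (- 1 * H s \<omega>))"
    by (rule integrable_const_bound[where B=1], rule eventually_mono[OF stable_subordinator_nonneg[OF H]])
      (use s in auto)
  have "prob {\<omega> \<in> space M. H s \<omega> < t} = expectation (indicator {\<omega> \<in> space M. H s \<omega> < t})"
    by simp
  also have "\<dots> \<le> expectation (\<lambda>\<omega>. exp t * exp (- 1 * H s \<omega>))"
  proof (rule integral_mono)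
    show "integrable M (indicator {\<omega> \<in> space M. H s \<omega> < t} :: 'a \<Rightarrow> real)"
      by (rule integrable_real_indicator) (auto simp: less_top[symmetric])
    show "integrable M (\<lambda>\<omega>. exp t * exp (- 1 * H s \<omega>))" by (rule integrable_mult_right[OF int])
  qed (auto simp: indicator_def exp_add[symmetric])
  also have "\<dots> = exp (t - s)" 
    unfolding integral_mult_right_zero E by (simp add: exp_diff exp_minus divide_inverse)
  finally show ?thesis .
qed

text \<open>The event that \<open>H\<close> stays below \<open>K\<close> at all integers has
  probability at most exp(K - j) for every \<open>j\<close>. This makes the set in the definition of
  \<open>L\<close> nonempty almost surely.\<close>

lemma stable_subordinator_unbounded:
  assumes H: "stable_subordinator \<alpha> H"
  shows "AE \<omega> in M. \<forall>t. \<exists>s\<ge>0. t \<le> H s \<omega>"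
proof -
  have "AE \<omega> in M. \<exists>j::nat. real K \<le> H (real j) \<omega>" for K :: nat
  proof -
    have [measurable]: "\<And>j::nat. H (real j) \<in> borel_measurable M"
      by (rule stable_subordinator_measurable[OF H]) simp
    let ?A = "{\<omega> \<in> space M. \<forall>j::nat. H (real j) \<omega> < real K}"
    have "prob ?A \<le> exp (real K - real j)" for j :: nat
    proof -
      have "prob ?A \<le> prob {\<omega> \<in> space M. H (real j) \<omega> < real K}"
        by (rule finite_measure_mono) auto
      also have "\<dots> \<le> exp (real K - real j)" by (rule stable_subordinator_tail[OF H]) simp
      finally show ?thesis .
    qed
    moreover have "(\<lambda>j. exp (real K - real j)) \<longlonglongrightarrow> 0" by real_asymp
    ultimately have "prob ?A \<le> 0" by (intro LIMSEQ_le_const) auto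
    then have "prob ?A = 0" by (simp add: measure_le_0_iff)
    then have "AE \<omega> in M. \<not> (\<forall>j::nat. H (real j) \<omega> < real K)"
      by (subst (asm) prob_Collect_eq_0) auto
    then show ?thesis by eventually_elim (auto simp: not_less)
  qed
  then have "AE \<omega> in M. \<forall>K::nat. \<exists>j::nat. real K \<le> H (real j) \<omega>"
    by (simp add: AE_all_countable)
  then show ?thesis
  proof eventually_elim
    case (elim \<omega>)
    show ?case
    proof
      fix t :: real
      obtain K :: nat where "t \<le> real K" using real_arch_simple by blast
      moreover obtain j :: nat where "real K \<le> H (real j) \<omega>" using elim by blast
      ultimately show "\<exists>s\<ge>0. t \<le> H s \<omega>" by (intro exI[of _ "real j"]) auto
    qed
  qed
qed

text \<open>Interface to the inverse process. Off one null set the duality between \<open>L\<close>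
  and \<open>H\<close> holds for all times and levels at once, because the exceptional sets come
  from the paths of \<open>H\<close>.\<close>

lemma inverse_subordinator_cases:
  assumes L: "inverse_stable_subordinator \<alpha> L"
  obtains "\<alpha> = 1" "\<And>\<omega> t. \<omega> \<in> space M \<Longrightarrow> 0 \<le> t \<Longrightarrow> L t \<omega> = t"
  | H where "stable_subordinator \<alpha> H"
      "AE \<omega> in M. \<forall>t\<ge>0. 0 \<le> L t \<omega> \<and> (\<forall>x\<ge>0. L t \<omega> \<le> x \<longleftrightarrow> t \<le> H x \<omega>)"
      "AE \<omega> in M. \<forall>s t. 0 \<le> s \<longrightarrow> s \<le> t \<longrightarrow> L s \<omega> \<le> L t \<omega>"
proof (cases "\<alpha> = 1")
  case True
  then show thesis using that(1) L by (auto simp: inverse_stable_subordinator_def)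
next
  case False
  then obtain H where H: "stable_subordinator \<alpha> H"
      "\<And>\<omega> t. \<omega> \<in> space M \<Longrightarrow> 0 \<le> t \<Longrightarrow> L t \<omega> = Inf {s. 0 \<le> s \<and> t \<le> H s \<omega>}"
    using L by (auto simp: inverse_stable_subordinator_def)
  have mono: "AE \<omega> in M. mono_on {0..} (\<lambda>t. H t \<omega>)"
    using H(1) by (auto simp: stable_subordinator_def)
  have cont: "AE \<omega> in M. \<forall>t\<ge>0. continuous (at_right t) (\<lambda>s. H s \<omega>)"
    using H(1) by (auto simp: stable_subordinator_def levy_process_def)
  show thesis
  proof (rule that(2)[OF H(1)])
    show "AE \<omega> in M. \<forall>t\<ge>0. 0 \<le> L t \<omega> \<and> (\<forall>x\<ge>0. L t \<omega> \<le> x \<longleftrightarrow> t \<le> H x \<omega>)"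
      using mono cont stable_subordinator_unbounded[OF H(1)] AE_space
    proof eventually_elim
      case (elim \<omega>)
      show ?case
      proof (intro allI impI conjI)
        fix t :: real assume t: "0 \<le> t"
        show "0 \<le> L t \<omega>"
          unfolding H(2)[OF elim(4) t] using elim(3) by (intro cInf_greatest) auto
        fix x :: real assume "0 \<le> x"
        then show "L t \<omega> \<le> x \<longleftrightarrow> t \<le> H x \<omega>"
          unfolding H(2)[OF elim(4) t] using elim by (intro Inf_hitting_le_iff) auto
      qed
    qed
    show "AE \<omega> in M. \<forall>s t. 0 \<le> s \<longrightarrow> s \<le> t \<longrightarrow> L s \<omega> \<le> L t \<omega>"
      using stable_subordinator_unbounded[OF H(1)] AE_space
    proof eventually_elim
      case (elim \<omega>)
      show ?case
      proof (intro allI impI)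
        fix s t :: real assume st: "0 \<le> s" "s \<le> t"
        have "Inf {u. 0 \<le> u \<and> s \<le> H u \<omega>} \<le> Inf {u. 0 \<le> u \<and> t \<le> H u \<omega>}"
          by (rule cInf_superset_mono) (use elim(1) st in \<open>auto intro!: bdd_belowI[of _ 0]\<close>)
        then show "L s \<omega> \<le> L t \<omega>" using H(2)[OF elim(2)] st by auto
      qed
    qed
  qed
qed

lemma inverse_subordinator_mono:
  assumes "inverse_stable_subordinator \<alpha> L"
  shows "AE \<omega> in M. \<forall>s t. 0 \<le> s \<longrightarrow> s \<le> t \<longrightarrow> 0 \<le> L s \<omega> \<and> L s \<omega> \<le> L t \<omega>"
  using assms
proof (cases rule: inverse_subordinator_cases)
  case 1
  show ?thesis by (rule AE_I2) (auto simp: 1)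
next
  case (2 H)
  show ?thesis using 2(2,3) by eventually_elim auto
qed

text \<open>By duality \<open>L t > j\<close> means \<open>H j < t\<close>, so the tail of
  \<open>L t\<close> decays exponentially and all moments are finite.\<close>

lemma inverse_subordinator_moment:
  assumes L: "inverse_stable_subordinator \<alpha> L" and t: "0 \<le> t" and [measurable]: "L t \<in> borel_measurable M"
  shows "integrable M (\<lambda>\<omega>. L t \<omega> ^ k)"
  using L
proof (cases rule: inverse_subordinator_cases)
  case 1
  show ?thesis
    by (rule Bochner_Integration.integrable_cong[THEN iffD1, OF refl _ integrable_const[of "t ^ k"]])
      (use 1 t in auto)
next
  case (2 H)
  have tail: "prob {\<omega> \<in> space M. real j < L t \<omega>} \<le> exp (t - real j)" for j :: nat
  proof -
    have [measurable]: "H (real j) \<in> borel_measurable M"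
      by (rule stable_subordinator_measurable[OF 2(1)]) simp
    have "prob {\<omega> \<in> space M. real j < L t \<omega>} = prob {\<omega> \<in> space M. H (real j) \<omega> < t}"
    proof (rule measure_eq_AE)
      show "AE \<omega> in M. \<omega> \<in> {\<omega> \<in> space M. real j < L t \<omega>} \<longleftrightarrow> \<omega> \<in> {\<omega> \<in> space M. H (real j) \<omega> < t}"
        using 2(2)
      proof eventually_elim
        case (elim \<omega>)
        then have "L t \<omega> \<le> real j \<longleftrightarrow> t \<le> H (real j) \<omega>" using t by simp
        then show ?case by (auto simp flip: not_le)
      qed
    qed auto
    then show ?thesis using stable_subordinator_tail[OF 2(1), of "real j" t] by simp
  qed
  have summable: "summable (\<lambda>j. (real j + 1) ^ k * exp (t - real j))"
  proof (rule summable_comparison_test_bigo)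
    show "summable (\<lambda>j. norm (exp (- 1 / 2 :: real) ^ j))" by (simp add: summable_geometric)
    show "(\<lambda>j. (real j + 1) ^ k * exp (t - real j)) \<in> O(\<lambda>j. exp (- 1 / 2) ^ j)" by real_asymp
  qed
  \<comment> \<open>Layers for a crude tail-sum bound: on \<open>j < L t \<le> j + 1\<close> the
    power is at most (j + 1)^k. The extra 1 in \<open>bound\<close> takes care of
    \<open>L t \<le> 1\<close>, where there may be no layer.\<close>
  define F where "F = (\<lambda>j \<omega>. ennreal ((real j + 1) ^ k) * indicator {\<omega> \<in> space M. real j < L t \<omega>} \<omega>)"
  have Fm [measurable]: "F j \<in> borel_measurable M" for j unfolding F_def by measurable
  have bound: "AE \<omega> in M. ennreal (norm (L t \<omega> ^ k)) \<le> 1 + (\<Sum>j. F j \<omega>)"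
    using 2(2) AE_space
  proof eventually_elim
    case (elim \<omega>)
    have nn: "0 \<le> L t \<omega>" using elim t by auto
    show ?case
    proof (cases "L t \<omega> \<le> 1")
      case True
      then have "ennreal (norm (L t \<omega> ^ k)) \<le> 1" using nn by (simp add: power_le_one)
      then show ?thesis by (rule order_trans) simp
    next
      case False
      \<comment> \<open>The ceiling minus 1 gives the strict inequality \<open>j < L t\<close> also
        when \<open>L t\<close> is an integer.\<close>
      define j where "j = nat (\<lceil>L t \<omega>\<rceil> - 1)"
      have j: "real j < L t \<omega>" "L t \<omega> \<le> real j + 1" using False by (auto simp: j_def) linarith+
      have "ennreal (norm (L t \<omega> ^ k)) \<le> ennreal ((real j + 1) ^ k)"
        using nn j by (intro ennreal_leI) (auto intro: power_mono)
      also have "\<dots> = F j \<omega>" using j elim by (simp add: F_def)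
      also have "F j \<omega> \<le> (\<Sum>j. F j \<omega>)"
        using sum_le_suminf[of "\<lambda>j. F j \<omega>" "{j}"] by simp
      also have "\<dots> \<le> 1 + (\<Sum>j. F j \<omega>)" by simp
      finally show ?thesis .
    qed
  qed
  have "(\<integral>\<^sup>+\<omega>. ennreal (norm (L t \<omega> ^ k)) \<partial>M) \<le> (\<integral>\<^sup>+\<omega>. 1 + (\<Sum>j. F j \<omega>) \<partial>M)"
    by (rule nn_integral_mono_AE[OF bound])
  also have "\<dots> = 1 + (\<Sum>j. ennreal ((real j + 1) ^ k) * emeasure M {\<omega> \<in> space M. real j < L t \<omega>})"
  proof -
    have "(\<integral>\<^sup>+\<omega>. F j \<omega> \<partial>M) = ennreal ((real j + 1) ^ k) * emeasure M {\<omega> \<in> space M. real j < L t \<omega>}" for j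
      unfolding F_def by (rule nn_integral_cmult_indicator) simp
    then show ?thesis
      by (simp add: nn_integral_add nn_integral_suminf emeasure_space_1)
  qed
  also have "\<dots> \<le> 1 + (\<Sum>j. ennreal ((real j + 1) ^ k * exp (t - real j)))"
  proof (intro add_left_mono suminf_le allI)
    show "ennreal ((real j + 1) ^ k) * emeasure M {\<omega> \<in> space M. real j < L t \<omega>}
        \<le> ennreal ((real j + 1) ^ k * exp (t - real j))" for j :: nat
      using tail[of j] by (simp add: emeasure_eq_measure ennreal_mult[symmetric] mult_left_mono)
  qed auto
  also have "\<dots> < \<infinity>"
    using summable by (simp add: ennreal_suminf_neq_top suminf_ennreal2 ennreal_add_eq_top less_top[symmetric])
  finally show ?thesis by (intro integrableI_bounded) auto
qed

text \<open>With c = a^\<alpha>, duality turns \<open>L (a * t) / c \<le> x\<close> into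
  \<open>a * t \<le> H (c * x)\<close>. Jointly, \<open>H (c * x)\<close> has the law of
  \<open>a * H x\<close>, and cancelling \<open>a\<close> gives \<open>t \<le> H x\<close>, that is
  \<open>L t \<le> x\<close>. Equality of the distribution functions then gives equality of the
  measures.\<close>

lemma inverse_subordinator_fdd_scale:
  assumes L: "inverse_stable_subordinator \<alpha> L" and \<alpha>: "0 < \<alpha>" and t: "\<And>r. r \<le> p \<Longrightarrow> 0 \<le> t r"
    and Lm: "\<And>s. 0 \<le> s \<Longrightarrow> L s \<in> borel_measurable M" and a: "0 < a"
  shows "fdd_measure M (\<lambda>s \<omega>. L (a * s) \<omega> / a powr \<alpha>) t p = fdd_measure M L t p"
  using L
proof (cases rule: inverse_subordinator_cases)
  case 1
  then show ?thesis using a t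
    by (auto simp: fdd_measure_def intro!: distr_cong restrict_ext)
next
  case (2 H)
  define c where "c = a powr \<alpha>"
  have c: "0 < c" "c powr (1 / \<alpha>) = a" using a \<alpha> by (auto simp: c_def powr_powr)
  have Lt [measurable]: "r \<le> p \<Longrightarrow> L (t r) \<in> borel_measurable M"
    "r \<le> p \<Longrightarrow> L (a * t r) \<in> borel_measurable M" for r
    using t a by (auto intro!: Lm)
  have Lt': "r \<le> p \<Longrightarrow> (\<lambda>\<omega>. L (a * t r) \<omega> / c) \<in> borel_measurable M" for r
    using Lt by auto
  let ?L = "\<lambda>s \<omega>. L (a * s) \<omega> / c"
  have sets_le: "{\<omega> \<in> space M. \<forall>r\<le>p. f r \<omega> \<le> g r \<omega>} \<in> sets M"
    if "\<And>r. r \<le> p \<Longrightarrow> f r \<in> borel_measurable M" "\<And>r. r \<le> p \<Longrightarrow> g r \<in> borel_measurable M"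
    for f g :: "nat \<Rightarrow> 'a \<Rightarrow> real"
  proof -
    have "{\<omega> \<in> space M. \<forall>r\<in>{..p}. f r \<omega> \<le> g r \<omega>} \<in> sets M"
      by (intro sets.sets_Collect_finite_All borel_measurable_le that) simp_all
    then show ?thesis unfolding Ball_def atMost_iff .
  qed
  have eq: "fdd M ?L t p x = fdd M L t p x" for x
  proof (cases "\<forall>r\<le>p. 0 \<le> x r")
    \<comment> \<open>Duality covers only nonnegative levels. At a negative level both distribution
      functions are 0, since \<open>L\<close> is almost surely nonnegative.\<close>
    case False
    then obtain r where r: "r \<le> p" "x r < 0" by (auto simp: not_le)
    have "fdd M W t p x = 0"
      if W: "AE \<omega> in M. 0 \<le> W (t r) \<omega>" and m: "\<And>r. r \<le> p \<Longrightarrow> W (t r) \<in> borel_measurable M" for W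
    proof -
      have "fdd M W t p x = prob {}"
        unfolding fdd_def
      proof (rule measure_eq_AE)
        show "AE \<omega> in M. \<omega> \<in> {\<omega> \<in> space M. \<forall>r\<le>p. W (t r) \<omega> \<le> x r} \<longleftrightarrow> \<omega> \<in> {}"
          using W
        proof eventually_elim
          case (elim \<omega>)
          then have "\<not> W (t r) \<omega> \<le> x r" using r(2) by simp
          then show ?case using r(1) by blast
        qed
        show "{\<omega> \<in> space M. \<forall>r\<le>p. W (t r) \<omega> \<le> x r} \<in> events" by (rule sets_le[OF m]) auto
      qed simp
      then show ?thesis by simp
    qed
    note z = this
    have "AE \<omega> in M. 0 \<le> L (t r) \<omega>" using 2(2) by eventually_elim (use t r in auto)
    moreover have "AE \<omega> in M. 0 \<le> ?L (t r) \<omega>" using 2(2) by eventually_elim (use t r a c in auto)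
    ultimately show ?thesis using z[of L] z[of ?L] Lt Lt' by simp
  next
    case True
    have Hm: "r \<le> p \<Longrightarrow> H (x r) \<in> borel_measurable M" "r \<le> p \<Longrightarrow> H (c * x r) \<in> borel_measurable M" for r
      using True c by (auto intro!: stable_subordinator_measurable[OF 2(1)])
    have "fdd M ?L t p x = prob {\<omega> \<in> space M. \<forall>r\<le>p. a * t r \<le> H (c * x r) \<omega>}"
      unfolding fdd_def
    proof (rule measure_eq_AE)
      show "AE \<omega> in M. \<omega> \<in> {\<omega> \<in> space M. \<forall>r\<le>p. ?L (t r) \<omega> \<le> x r}
          \<longleftrightarrow> \<omega> \<in> {\<omega> \<in> space M. \<forall>r\<le>p. a * t r \<le> H (c * x r) \<omega>}"
        using 2(2)
      proof eventually_elim
        case (elim \<omega>)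
        have "?L (t r) \<omega> \<le> x r \<longleftrightarrow> a * t r \<le> H (c * x r) \<omega>" if "r \<le> p" for r
        proof -
          have "?L (t r) \<omega> \<le> x r \<longleftrightarrow> L (a * t r) \<omega> \<le> c * x r"
            using c by (simp add: pos_divide_le_eq mult.commute)
          then show ?thesis using elim t[OF that] True that a c by simp
        qed
        then show ?case by auto
      qed
      show "{\<omega> \<in> space M. \<forall>r\<le>p. ?L (t r) \<omega> \<le> x r} \<in> events" by (rule sets_le[OF Lt']) auto
      show "{\<omega> \<in> space M. \<forall>r\<le>p. a * t r \<le> H (c * x r) \<omega>} \<in> events" by (rule sets_le[OF _ Hm(2)]) auto
    qed
    moreover have "fdd M L t p x = prob {\<omega> \<in> space M. \<forall>r\<le>p. a * t r \<le> a * H (x r) \<omega>}"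
      unfolding fdd_def
    proof (rule measure_eq_AE)
      show "AE \<omega> in M. \<omega> \<in> {\<omega> \<in> space M. \<forall>r\<le>p. L (t r) \<omega> \<le> x r}
          \<longleftrightarrow> \<omega> \<in> {\<omega> \<in> space M. \<forall>r\<le>p. a * t r \<le> a * H (x r) \<omega>}"
        using 2(2) by eventually_elim (use t True a in auto)
      show "{\<omega> \<in> space M. \<forall>r\<le>p. L (t r) \<omega> \<le> x r} \<in> events" by (rule sets_le[OF Lt(1)]) auto
      show "{\<omega> \<in> space M. \<forall>r\<le>p. a * t r \<le> a * H (x r) \<omega>} \<in> events"
        by (rule sets_le) (use Hm(1) in auto)
    qed
    moreover have "prob {\<omega> \<in> space M. \<forall>r\<le>p. a * t r \<le> H (c * x r) \<omega>}
        = prob {\<omega> \<in> space M. \<forall>r\<le>p. a * t r \<le> a * H (x r) \<omega>}"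
    proof -
      let ?P = "PiM {0..p} (\<lambda>_. borel) :: (nat \<Rightarrow> real) measure"
      let ?A = "{y \<in> space ?P. \<forall>r\<in>{0..p}. a * t r \<le> y r}"
      have A: "?A \<in> sets ?P"
        by (intro sets.sets_Collect_finite_All borel_measurable_le measurable_component_singleton) auto
      have pr: "prob {\<omega> \<in> space M. \<forall>r\<le>p. a * t r \<le> f r \<omega>}
          = measure (distr M ?P (\<lambda>\<omega>. \<lambda>r\<in>{0..p}. f r \<omega>)) ?A"
        if "\<And>r. r \<le> p \<Longrightarrow> f r \<in> borel_measurable M" for f
      proof -
        have "(\<lambda>\<omega>. \<lambda>r\<in>{0..p}. f r \<omega>) \<in> measurable M ?P"
          by (intro measurable_restrict that) auto
        then show ?thesis
          by (subst measure_distr[OF _ A]) (auto intro!: arg_cong[where f=prob] simp: space_PiM PiE_iff)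
      qed
      have *: "distr M ?P (\<lambda>\<omega>. \<lambda>r\<in>{0..p}. H (c * x r) \<omega>) = distr M ?P (\<lambda>\<omega>. \<lambda>r\<in>{0..p}. a * H (x r) \<omega>)"
        using stable_subordinator_fdd_scale[OF 2(1) \<alpha> c(1), of p x] True by (simp add: c(2))
      show ?thesis using pr[of "\<lambda>r. H (c * x r)"] pr[of "\<lambda>r \<omega>. a * H (x r) \<omega>"] Hm * by simp
    qed
    ultimately show ?thesis by simp
  qed
  show ?thesis
    unfolding c_def[symmetric]
  proof (rule fdd_measure_unique)
    show "prob_space M" by unfold_locales
    show "sets (fdd_measure M ?L t p) = sets (PiM {0..p} (\<lambda>_. borel :: real measure))"
      by (simp add: fdd_measure_def)
    show "emeasure (fdd_measure M ?L t p) (\<Pi>\<^sub>E r\<in>{0..p}. {..x r}) = ennreal (fdd M L t p x)" for x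
      using emeasure_fdd_measure_orthant[of M p ?L t x] Lt' prob_space_axioms by (simp add: eq)
  qed (use Lt in auto)
qed

end

section \<open>Moments of the fractional Poisson process\<close>

context prob_space
begin

context
  fixes N :: "real \<Rightarrow> 'a \<Rightarrow> nat" and L :: "real \<Rightarrow> 'a \<Rightarrow> real" and \<alpha> :: real
  assumes \<alpha>: "0 < \<alpha>" and L: "inverse_stable_subordinator \<alpha> L" and N: "unit_poisson_process N"
    and ind: "indep_families {0..} L {0..} (\<lambda>s \<omega>. real (N s \<omega>))"
    and meas: "\<And>s. 0 \<le> s \<Longrightarrow> (\<lambda>\<omega>. real (fractional_poisson N L s \<omega>)) \<in> borel_measurable M"
begin

private lemma ind_gen: "indep_set (sets (gen_measure {0..} L)) (gen_events {0..} (\<lambda>s \<omega>. real (N s \<omega>)))"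
  using ind by (simp add: indep_families_def sets_gen_measure)

private lemma L_gen: "0 \<le> s \<Longrightarrow> L s \<in> borel_measurable (gen_measure {0..} L)"
  by (rule measurable_gen_measure) simp

lemma inverse_subordinator_measurable: "0 \<le> s \<Longrightarrow> L s \<in> borel_measurable M"
  using indep_set_measurable(1)[of "gen_measure {0..} L" "gen_measure {0..} (\<lambda>s \<omega>. real (N s \<omega>))", OF _ _ _ L_gen]
    ind_gen by (simp add: sets_gen_measure)

lemma fractional_poisson_mono:
  "AE \<omega> in M. \<forall>s t. 0 \<le> s \<longrightarrow> s \<le> t \<longrightarrow> fractional_poisson N L s \<omega> \<le> fractional_poisson N L t \<omega>"
  using inverse_subordinator_mono[OF L] poisson_mono[OF N]
  by eventually_elim (auto simp: fractional_poisson_def)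

text \<open>\<open>fdd_measure\<close> lives on extensional functions; \<open>restr\<close> says
  that \<open>h\<close> looks only at the coordinates up to \<open>p\<close>, so the two points of
  view agree.\<close>

private lemma expectation_scale:
  fixes h :: "(nat \<Rightarrow> real) \<Rightarrow> real"
  assumes t: "\<And>r. r \<le> p \<Longrightarrow> 0 \<le> t r" and a: "0 < a"
    and h: "h \<in> borel_measurable (PiM {0..p} (\<lambda>_. borel))"
    and restr: "\<And>y. h (restrict y {0..p}) = h y"
  shows "expectation (\<lambda>\<omega>. h (\<lambda>r. L (a * t r) \<omega> / a powr \<alpha>)) = expectation (\<lambda>\<omega>. h (\<lambda>r. L (t r) \<omega>))"
proof -
  note Lm = inverse_subordinator_measurable
  have "expectation (\<lambda>\<omega>. h (\<lambda>r. W (t r) \<omega>)) = integral\<^sup>L (fdd_measure M W t p) h"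
    if "\<And>r. r \<le> p \<Longrightarrow> W (t r) \<in> borel_measurable M" for W
  proof -
    have m: "(\<lambda>\<omega>. \<lambda>r\<in>{0..p}. W (t r) \<omega>) \<in> measurable M (PiM {0..p} (\<lambda>_. borel))"
      using that by (intro measurable_restrict) auto
    show ?thesis unfolding fdd_measure_def integral_distr[OF m h] restr ..
  qed
  note * = this
  have "r \<le> p \<Longrightarrow> (\<lambda>\<omega>. L (a * t r) \<omega> / a powr \<alpha>) \<in> borel_measurable M" for r
    using Lm[of "a * t r"] t a by auto
  then show ?thesis
    using *[of "\<lambda>s \<omega>. L (a * s) \<omega> / a powr \<alpha>"] *[of L] Lm t
      inverse_subordinator_fdd_scale[where p=p and t=t, OF L \<alpha> t Lm a] by simp
qed

context
  fixes t :: "nat \<Rightarrow> real" and p :: nat and k :: "nat \<Rightarrow> nat"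
  assumes t0: "0 \<le> t 0" and t: "\<And>r. r < p \<Longrightarrow> t r \<le> t (Suc r)"
begin

private lemma t_nn: "r \<le> p \<Longrightarrow> 0 \<le> t r"
proof (induction r)
  case (Suc r)
  then show ?case using t[of r] by simp
qed (use t0 in simp)

text \<open>The time change gives Touchard polynomials of the increments of \<open>L\<close> at the
  times \<open>a * t r\<close>; self-similarity then moves the scale out of the time
  argument.\<close>

lemma fractional_poisson_increments_moment:
  assumes a: "0 < a"
  shows "integrable M (\<lambda>\<omega>. \<Prod>r<p. (real (fractional_poisson N L (a * t (Suc r)) \<omega>)
            - real (fractional_poisson N L (a * t r) \<omega>)) ^ k r)"
    and "expectation (\<lambda>\<omega>. \<Prod>r<p. (real (fractional_poisson N L (a * t (Suc r)) \<omega>)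
            - real (fractional_poisson N L (a * t r) \<omega>)) ^ k r)
       = expectation (\<lambda>\<omega>. \<Prod>r<p. touchard (k r) (a powr \<alpha> * (L (t (Suc r)) \<omega> - L (t r) \<omega>)))"
proof -
  have at: "0 \<le> a * t r" if "r \<le> p" for r using t_nn[OF that] a by simp
  have a1: "r \<le> p \<Longrightarrow> L (a * t r) \<in> borel_measurable (gen_measure {0..} L)" for r
    using at by (intro L_gen)
  have a2: "AE \<omega> in M. 0 \<le> L (a * t 0) \<omega>"
    using inverse_subordinator_mono[OF L] by eventually_elim (use at in auto)
  have a3: "AE \<omega> in M. \<forall>r<p. L (a * t r) \<omega> \<le> L (a * t (Suc r)) \<omega>"
    using inverse_subordinator_mono[OF L]
  proof eventually_elim
    case (elim \<omega>)
    show ?case using elim at t a by (auto intro!: mult_left_mono)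
  qed
  have a4: "integrable M (\<lambda>\<omega>. L (a * t p) \<omega> ^ k)" for k
    using at[of p] by (intro inverse_subordinator_moment[OF L] inverse_subordinator_measurable) auto
  have a5: "r \<le> p \<Longrightarrow> (\<lambda>\<omega>. real (N (L (a * t r) \<omega>) \<omega>)) \<in> borel_measurable M" for r
    using meas[OF at] by (simp add: fractional_poisson_def)
  note tc = poisson_time_change[where \<tau>="\<lambda>r. L (a * t r)" and k=k, OF N ind_gen _ a1 a2 a3 a4 a5]
  show "integrable M (\<lambda>\<omega>. \<Prod>r<p. (real (fractional_poisson N L (a * t (Suc r)) \<omega>)
            - real (fractional_poisson N L (a * t r) \<omega>)) ^ k r)"
    using tc(1) by (simp add: fractional_poisson_def)
  define h where "h = (\<lambda>y. \<Prod>r<p. touchard (k r) (a powr \<alpha> * (y (Suc r) - y r)))"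
  have hm: "h \<in> borel_measurable (PiM {0..p} (\<lambda>_. borel))"
    unfolding h_def
    by (intro borel_measurable_prod measurable_compose[OF _ borel_measurable_touchard] borel_measurable_times
        borel_measurable_diff measurable_component_singleton) auto
  have hr: "h (restrict y {0..p}) = h y" for y
    unfolding h_def by (intro prod.cong) auto
  \<comment> \<open>\<open>h\<close> carries the factor \<open>a powr \<alpha>\<close> that the
    rescaled vector has lost, so the left side is the expectation delivered by the time
    change.\<close>
  have "expectation (\<lambda>\<omega>. h (\<lambda>r. L (a * t r) \<omega> / a powr \<alpha>)) = expectation (\<lambda>\<omega>. h (\<lambda>r. L (t r) \<omega>))"
    by (rule expectation_scale[OF t_nn a hm hr])
  moreover have "a powr \<alpha> * (x / a powr \<alpha> - y / a powr \<alpha>) = x - y" for x y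
    using a by (simp add: right_diff_distrib)
  ultimately show "expectation (\<lambda>\<omega>. \<Prod>r<p. (real (fractional_poisson N L (a * t (Suc r)) \<omega>)
            - real (fractional_poisson N L (a * t r) \<omega>)) ^ k r)
       = expectation (\<lambda>\<omega>. \<Prod>r<p. touchard (k r) (a powr \<alpha> * (L (t (Suc r)) \<omega> - L (t r) \<omega>)))"
    using tc(2) by (simp add: h_def fractional_poisson_def)
qed

lemma inverse_subordinator_increments_integrable:
  "integrable M (\<lambda>\<omega>. \<Prod>r<p. touchard (k r) (L (t (Suc r)) \<omega> - L (t r) \<omega>))" (is "integrable M ?T")
  "integrable M (\<lambda>\<omega>. \<Prod>r<p. (L (t (Suc r)) \<omega> - L (t r) \<omega>) ^ k r)" (is "integrable M ?P")
proof -
  note Lm = inverse_subordinator_measurable[OF t_nn]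
  have d: "r < p \<Longrightarrow> (\<lambda>\<omega>. L (t (Suc r)) \<omega> - L (t r) \<omega>) \<in> borel_measurable M" for r
    using Lm by auto
  have ae: "AE \<omega> in M. \<forall>r<p. 0 \<le> L (t (Suc r)) \<omega> - L (t r) \<omega> \<and> L (t (Suc r)) \<omega> - L (t r) \<omega> \<le> L (t p) \<omega>"
    using inverse_subordinator_mono[OF L]
  proof eventually_elim
    case (elim \<omega>)
    have tp: "t r \<le> t p" if "r \<le> p" for r
      using that
    proof (induction rule: inc_induct)
      case (step n)
      then show ?case using t[of n] by simp
    qed simp
    show ?case
    proof (intro allI impI conjI)
      fix r assume r: "r < p"
      show "0 \<le> L (t (Suc r)) \<omega> - L (t r) \<omega>" using elim t[OF r] t_nn[of r] r by auto
      have "L (t (Suc r)) \<omega> \<le> L (t p) \<omega>" "0 \<le> L (t r) \<omega>"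
        using elim tp[of "Suc r"] t_nn[of "Suc r"] t_nn[of r] t[OF r] r by auto
      then show "L (t (Suc r)) \<omega> - L (t r) \<omega> \<le> L (t p) \<omega>" by simp
    qed
  qed
  let ?K = "\<Sum>r<p. k r"
  have pw: "integrable M (\<lambda>\<omega>. (L (t p) \<omega> + 1) ^ ?K)"
    by (intro integrable_shifted_power inverse_subordinator_moment[OF L] t_nn Lm) auto
  show "integrable M ?T"
  proof (rule Bochner_Integration.integrable_bound[OF integrable_mult_right[OF pw, of "\<Prod>r<p. touchard (k r) 1"]])
    show "?T \<in> borel_measurable M"
      by (intro borel_measurable_prod measurable_compose[OF _ borel_measurable_touchard] d) auto
    show "AE \<omega> in M. norm (?T \<omega>) \<le> norm ((\<Prod>r<p. touchard (k r) 1) * (L (t p) \<omega> + 1) ^ ?K)"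
      using ae inverse_subordinator_mono[OF L]
    proof eventually_elim
      case (elim \<omega>)
      have "?T \<omega> \<le> (\<Prod>r<p. touchard (k r) 1) * (1 + L (t p) \<omega>) ^ ?K"
        by (rule prod_touchard_le) (use elim in auto)
      moreover have "0 \<le> ?T \<omega>" using elim by (auto intro!: prod_nonneg touchard_nonneg)
      ultimately show ?case by (simp add: add.commute)
    qed
  qed
  show "integrable M ?P"
  proof (rule Bochner_Integration.integrable_bound[OF pw])
    show "?P \<in> borel_measurable M" by (intro borel_measurable_prod borel_measurable_power d) auto
    show "AE \<omega> in M. norm (?P \<omega>) \<le> norm ((L (t p) \<omega> + 1) ^ ?K)"
      using ae
    proof eventually_elim
      case (elim \<omega>)
      have "\<bar>?P \<omega>\<bar> \<le> (\<Prod>r<p. (L (t p) \<omega> + 1) ^ k r)"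
        unfolding abs_prod
      proof (rule prod_mono)
        fix r assume "r \<in> {..<p}"
        then have "0 \<le> L (t (Suc r)) \<omega> - L (t r) \<omega>" "L (t (Suc r)) \<omega> - L (t r) \<omega> \<le> L (t p) \<omega>"
          using elim by auto
        then show "0 \<le> \<bar>(L (t (Suc r)) \<omega> - L (t r) \<omega>) ^ k r\<bar> \<and>
            \<bar>(L (t (Suc r)) \<omega> - L (t r) \<omega>) ^ k r\<bar> \<le> (L (t p) \<omega> + 1) ^ k r"
          by (auto simp: power_abs intro!: power_mono)
      qed
      then show ?case by (simp add: power_sum)
    qed
  qed
qed

text \<open>Dominated convergence under the Touchard polynomials at scale 1, a majorant free of
  \<open>n\<close> by \<open>touchard_scale_le\<close>.\<close>

lemma fractional_poisson_increments_moment_tendsto: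
  "(\<lambda>n. expectation (\<lambda>\<omega>. \<Prod>r<p. (real (fractional_poisson N L (real n * t (Suc r)) \<omega>)
            - real (fractional_poisson N L (real n * t r) \<omega>)) ^ k r) / (real n powr \<alpha>) ^ (\<Sum>r<p. k r))
    \<longlonglongrightarrow> expectation (\<lambda>\<omega>. \<Prod>r<p. (L (t (Suc r)) \<omega> - L (t r) \<omega>) ^ k r)" (is "?l \<longlonglongrightarrow> ?r")
proof -
  note Lm = inverse_subordinator_measurable[OF t_nn]
  have d: "r < p \<Longrightarrow> (\<lambda>\<omega>. L (t (Suc r)) \<omega> - L (t r) \<omega>) \<in> borel_measurable M" for r
    using Lm by auto
  define S where "S = (\<lambda>n \<omega>. \<Prod>r<p. touchard (k r) (real n powr \<alpha> * (L (t (Suc r)) \<omega> - L (t r) \<omega>)) / (real n powr \<alpha>) ^ k r)"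
  \<comment> \<open>The index is shifted because the majorant needs
    \<open>1 \<le> n powr \<alpha>\<close>, which fails at \<open>n = 0\<close>.\<close>
  have "(\<lambda>i. expectation (S (Suc i))) \<longlonglongrightarrow> ?r"
  proof (rule integral_dominated_convergence[OF _ _ inverse_subordinator_increments_integrable(1)])
    show "(\<lambda>\<omega>. \<Prod>r<p. (L (t (Suc r)) \<omega> - L (t r) \<omega>) ^ k r) \<in> borel_measurable M"
      by (intro borel_measurable_prod borel_measurable_power d) auto
    show "S (Suc i) \<in> borel_measurable M" for i
      unfolding S_def by (intro borel_measurable_prod borel_measurable_divide borel_measurable_const
          measurable_compose[OF _ borel_measurable_touchard] borel_measurable_times d) auto
    have "filterlim (\<lambda>i. real (Suc i) powr \<alpha>) at_top sequentially"
      using \<alpha> by real_asymp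
    then show "AE \<omega> in M. (\<lambda>i. S (Suc i) \<omega>) \<longlonglongrightarrow> (\<Prod>r<p. (L (t (Suc r)) \<omega> - L (t r) \<omega>) ^ k r)"
      unfolding S_def by (intro AE_I2 tendsto_prod touchard_scale_tendsto)
    show "AE \<omega> in M. norm (S (Suc i) \<omega>) \<le> (\<Prod>r<p. touchard (k r) (L (t (Suc r)) \<omega> - L (t r) \<omega>))" for i
      using inverse_subordinator_mono[OF L]
    proof eventually_elim
      case (elim \<omega>)
      have c: "1 \<le> real (Suc i) powr \<alpha>" using \<alpha> by (intro ge_one_powr_ge_zero) auto
      show ?case unfolding S_def real_norm_def abs_prod
      proof (rule prod_mono)
        fix r assume "r \<in> {..<p}"
        then have x: "0 \<le> L (t (Suc r)) \<omega> - L (t r) \<omega>" using elim t t_nn[of r] by auto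
        have "0 \<le> touchard (k r) (real (Suc i) powr \<alpha> * (L (t (Suc r)) \<omega> - L (t r) \<omega>))"
          using x by (intro touchard_nonneg mult_nonneg_nonneg) auto
        then show "0 \<le> \<bar>touchard (k r) (real (Suc i) powr \<alpha> * (L (t (Suc r)) \<omega> - L (t r) \<omega>)) / (real (Suc i) powr \<alpha>) ^ k r\<bar>
          \<and> \<bar>touchard (k r) (real (Suc i) powr \<alpha> * (L (t (Suc r)) \<omega> - L (t r) \<omega>)) / (real (Suc i) powr \<alpha>) ^ k r\<bar>
            \<le> touchard (k r) (L (t (Suc r)) \<omega> - L (t r) \<omega>)"
          using touchard_scale_le[OF c x, of "k r"] by (simp add: abs_of_nonneg del: of_nat_Suc)
      qed
    qed
  qed
  moreover have "expectation (S (Suc i)) = ?l (Suc i)" for i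
  proof -
    have "S (Suc i) = (\<lambda>\<omega>. (\<Prod>r<p. touchard (k r) (real (Suc i) powr \<alpha> * (L (t (Suc r)) \<omega> - L (t r) \<omega>)))
        / (real (Suc i) powr \<alpha>) ^ (\<Sum>r<p. k r))"
      by (simp add: S_def prod_dividef power_sum)
    then show ?thesis
      by (simp add: fractional_poisson_increments_moment(2) del: of_nat_Suc)
  qed
  ultimately have "(\<lambda>i. ?l (Suc i)) \<longlonglongrightarrow> ?r" by simp
  then show ?thesis by (subst (asm) filterlim_sequentially_Suc)
qed

end

text \<open>Growth rate for the error terms; the constant is the expectation of
  \<open>touchard q (L s)\<close>.\<close>

lemma fractional_poisson_moment_bound:
  assumes s: "0 \<le> s"
  obtains C where "\<And>n. 1 \<le> n \<Longrightarrow> integrable M (\<lambda>\<omega>. real (fractional_poisson N L (real n * s) \<omega>) ^ q) \<and>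
      expectation (\<lambda>\<omega>. real (fractional_poisson N L (real n * s) \<omega>) ^ q) \<le> C * (real n powr \<alpha>) ^ q"
proof (rule that)
  let ?C = "expectation (\<lambda>\<omega>. touchard q (L s \<omega>))"
  fix n :: nat assume n: "1 \<le> n"
  then have ns: "0 \<le> real n * s" using s by simp
  \<comment> \<open>A single increment, from the deterministic time 0: it equals the value of the
    fractional Poisson process because \<open>N 0\<close> is almost surely 0.\<close>
  let ?\<tau> = "\<lambda>r::nat. if r = 0 then (\<lambda>_. 0) else L (real n * s)"
  have a1: "r \<le> 1 \<Longrightarrow> ?\<tau> r \<in> borel_measurable (gen_measure {0..} L)" for r
    using L_gen[OF ns] by simp
  have a3: "AE \<omega> in M. \<forall>r<1. ?\<tau> r \<omega> \<le> ?\<tau> (Suc r) \<omega>"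
    using inverse_subordinator_mono[OF L] by eventually_elim (use ns in auto)
  have a4: "integrable M (\<lambda>\<omega>. ?\<tau> 1 \<omega> ^ k)" for k
    using inverse_subordinator_moment[OF L ns inverse_subordinator_measurable[OF ns]] by simp
  have a5: "r \<le> 1 \<Longrightarrow> (\<lambda>\<omega>. real (N (?\<tau> r \<omega>) \<omega>)) \<in> borel_measurable M" for r
    using meas[OF ns] poisson_process_measurable(1)[OF N] by (simp add: fractional_poisson_def)
  note tc = poisson_time_change[where p=1 and \<tau>="?\<tau>" and k="\<lambda>_. q", OF N ind_gen _ a1 _ a3 a4 a5]
  have eq: "AE \<omega> in M. (real (N (L (real n * s) \<omega>) \<omega>) - real (N 0 \<omega>)) ^ q
      = real (fractional_poisson N L (real n * s) \<omega>) ^ q"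
    using poisson_process_0[OF N] by eventually_elim (simp add: fractional_poisson_def)
  have m: "(\<lambda>\<omega>. real (fractional_poisson N L (real n * s) \<omega>) ^ q) \<in> borel_measurable M"
    using meas[OF ns] by simp
  have i: "integrable M (\<lambda>\<omega>. (real (N (L (real n * s) \<omega>) \<omega>) - real (N 0 \<omega>)) ^ q)"
    and e: "expectation (\<lambda>\<omega>. (real (N (L (real n * s) \<omega>) \<omega>) - real (N 0 \<omega>)) ^ q) = expectation (\<lambda>\<omega>. touchard q (L (real n * s) \<omega>))"
    using tc by simp_all
  have int: "integrable M (\<lambda>\<omega>. real (fractional_poisson N L (real n * s) \<omega>) ^ q)"
    by (rule integrable_cong_AE_imp[OF i m]) (use eq in \<open>eventually_elim, simp\<close>)
  have E: "expectation (\<lambda>\<omega>. real (fractional_poisson N L (real n * s) \<omega>) ^ q) = expectation (\<lambda>\<omega>. touchard q (L (real n * s) \<omega>))"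
    unfolding e[symmetric] by (rule integral_cong_AE) (use i m eq in auto)
  let ?h = "\<lambda>y::nat \<Rightarrow> real. touchard q (real n powr \<alpha> * y 0)"
  have "expectation (\<lambda>\<omega>. ?h (\<lambda>r. L (real n * s) \<omega> / real n powr \<alpha>)) = expectation (\<lambda>\<omega>. ?h (\<lambda>r. L s \<omega>))"
    by (rule expectation_scale[where p=0 and t="\<lambda>_. s"])
      (use s n in \<open>auto intro!: measurable_compose[OF _ borel_measurable_touchard] borel_measurable_times\<close>)
  then have sc: "expectation (\<lambda>\<omega>. touchard q (L (real n * s) \<omega>)) = expectation (\<lambda>\<omega>. touchard q (real n powr \<alpha> * L s \<omega>))"
    using n by simp
  have c: "1 \<le> real n powr \<alpha>" using \<alpha> n by (intro ge_one_powr_ge_zero) auto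
  note Ls = inverse_subordinator_measurable[OF s]
  have tint: "integrable M (\<lambda>\<omega>. touchard q (x * L s \<omega>))" for x
    unfolding touchard_def power_mult_distrib
    by (intro Bochner_Integration.integrable_sum integrable_mult_right inverse_subordinator_moment[OF L s Ls])
  have "expectation (\<lambda>\<omega>. touchard q (real n powr \<alpha> * L s \<omega>)) \<le> expectation (\<lambda>\<omega>. touchard q (1 * L s \<omega>) * (real n powr \<alpha>) ^ q)"
  proof (rule integral_mono_AE)
    show "AE \<omega> in M. touchard q (real n powr \<alpha> * L s \<omega>) \<le> touchard q (1 * L s \<omega>) * (real n powr \<alpha>) ^ q"
      using inverse_subordinator_mono[OF L]
    proof eventually_elim
      case (elim \<omega>)
      have "0 < (real n powr \<alpha>) ^ q" using n by simp
      moreover have "0 \<le> L s \<omega>" using elim s by blast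
      ultimately show ?case using touchard_scale_le[OF c, of "L s \<omega>" q] by (simp add: pos_divide_le_eq)
    qed
  qed (intro tint integrable_mult_left)+
  then have "expectation (\<lambda>\<omega>. touchard q (real n powr \<alpha> * L s \<omega>)) \<le> ?C * (real n powr \<alpha>) ^ q" by simp
  then show "integrable M (\<lambda>\<omega>. real (fractional_poisson N L (real n * s) \<omega>) ^ q) \<and>
      expectation (\<lambda>\<omega>. real (fractional_poisson N L (real n * s) \<omega>) ^ q) \<le> ?C * (real n powr \<alpha>) ^ q"
    using int E sc by simp
qed

end
end

section \<open>Traces, circuits and link labels\<close>

lemma sum_PiE_insert:
  assumes "x \<notin> I"
  shows "(\<Sum>\<pi>\<in>PiE (insert x I) S. h \<pi>) = (\<Sum>\<pi>\<in>PiE I S. \<Sum>y\<in>S x. h (\<pi>(x := y)))"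
proof -
  have "(\<Sum>\<pi>\<in>PiE (insert x I) S. h \<pi>) = (\<Sum>(y, \<pi>)\<in>S x \<times> PiE I S. h (\<pi>(x := y)))"
    unfolding PiE_insert_eq
    by (subst sum.reindex[OF inj_combinator[OF assms(1)]]) (simp add: case_prod_unfold comp_def)
  also have "\<dots> = (\<Sum>\<pi>\<in>PiE I S. \<Sum>y\<in>S x. h (\<pi>(x := y)))"
    unfolding sum.cartesian_product[symmetric] by (rule sum.swap)
  finally show ?thesis .
qed

lemma foldr_mult_mat:
  fixes A :: "nat \<Rightarrow> real mat"
  assumes "\<And>r. r \<in> set rs \<Longrightarrow> A r \<in> carrier_mat n n" "B \<in> carrier_mat n n"
  shows "monomial_mat n A rs \<in> carrier_mat n n"
    and "foldr (\<lambda>r B. A r * B) rs B = monomial_mat n A rs * B"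
proof -
  have "monomial_mat n A rs \<in> carrier_mat n n \<and>
      foldr (\<lambda>r B. A r * B) rs B = monomial_mat n A rs * B"
    using assms(1)
  proof (induction rs)
    case (Cons r rs)
    then have r: "A r \<in> carrier_mat n n" and IH: "monomial_mat n A rs \<in> carrier_mat n n"
      "foldr (\<lambda>r B. A r * B) rs B = monomial_mat n A rs * B" by auto
    have m: "monomial_mat n A (r # rs) = A r * monomial_mat n A rs"
      by (simp add: monomial_mat_def)
    show ?case
      unfolding m using r IH assms(2) by simp
  qed (use assms in \<open>simp add: monomial_mat_def\<close>)
  then show "monomial_mat n A rs \<in> carrier_mat n n"
    "foldr (\<lambda>r B. A r * B) rs B = monomial_mat n A rs * B" by auto
qed

text \<open>
  Arbitrary end weights \<open>g\<close> make the induction over the last factor go through.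
\<close>

lemma sum_monomial_mat_eq_sum_paths:
  assumes "\<And>r. r \<in> set rs \<Longrightarrow> A r \<in> carrier_mat n n"
  shows "(\<Sum>i\<in>{1..n}. \<Sum>j\<in>{1..n}. monomial_mat n A rs $$ (i - 1, j - 1) * g i j)
    = (\<Sum>\<pi>\<in>{0..length rs} \<rightarrow>\<^sub>E {1..n}. g (\<pi> 0) (\<pi> (length rs)) *
        (\<Prod>j<length rs. A (rs ! j) $$ (\<pi> j - 1, \<pi> (Suc j) - 1)))"
  using assms
proof (induction rs arbitrary: g rule: rev_induct)
  case Nil
  have "(\<Sum>i\<in>{1..n}. \<Sum>j\<in>{1..n}. monomial_mat n A [] $$ (i - 1, j - 1) * g i j)
     = (\<Sum>i\<in>{1..n}. \<Sum>j\<in>{1..n}. if i = j then g i i else 0)"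
    by (intro sum.cong refl) (auto simp: monomial_mat_def)
  also have "\<dots> = (\<Sum>i\<in>{1..n}. g i i)" by (intro sum.cong refl) simp
  also have "\<dots> = (\<Sum>\<pi>\<in>PiE (insert 0 {}) (\<lambda>_. {1..n}). g (\<pi> 0) (\<pi> 0))"
    by (subst sum_PiE_insert) auto
  finally show ?case by simp
next
  case (snoc r rs)
  let ?l = "length rs"
  have r: "A r \<in> carrier_mat n n" and rs: "\<And>r. r \<in> set rs \<Longrightarrow> A r \<in> carrier_mat n n"
    using snoc.prems by auto
  have M: "monomial_mat n A rs \<in> carrier_mat n n" by (rule foldr_mult_mat(1)[OF rs r])
  have app: "monomial_mat n A (rs @ [r]) = monomial_mat n A rs * A r"
    using foldr_mult_mat(2)[OF rs r] r by (simp add: monomial_mat_def)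
  have entry: "(monomial_mat n A rs * A r) $$ (i - 1, j - 1)
      = (\<Sum>k\<in>{1..n}. monomial_mat n A rs $$ (i - 1, k - 1) * A r $$ (k - 1, j - 1))"
    if "i \<in> {1..n}" "j \<in> {1..n}" for i j
  proof -
    have "(monomial_mat n A rs * A r) $$ (i - 1, j - 1)
      = (\<Sum>k\<in>{0..<n}. monomial_mat n A rs $$ (i - 1, k) * A r $$ (k, j - 1))"
      using that M r by (auto simp: scalar_prod_def intro!: sum.cong)
    also have "\<dots> = (\<Sum>k\<in>{1..n}. monomial_mat n A rs $$ (i - 1, k - 1) * A r $$ (k - 1, j - 1))"
      by (rule sum.reindex_bij_witness[of _ "\<lambda>k. k - 1" Suc]) auto
    finally show ?thesis .
  qed
  have "(\<Sum>i\<in>{1..n}. \<Sum>j\<in>{1..n}. monomial_mat n A (rs @ [r]) $$ (i - 1, j - 1) * g i j)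
      = (\<Sum>i\<in>{1..n}. \<Sum>j\<in>{1..n}. \<Sum>k\<in>{1..n}.
          monomial_mat n A rs $$ (i - 1, k - 1) * A r $$ (k - 1, j - 1) * g i j)"
    unfolding app by (intro sum.cong refl) (simp only: entry sum_distrib_right)
  also have "\<dots> = (\<Sum>i\<in>{1..n}. \<Sum>k\<in>{1..n}. \<Sum>j\<in>{1..n}.
          monomial_mat n A rs $$ (i - 1, k - 1) * A r $$ (k - 1, j - 1) * g i j)"
    by (intro sum.cong refl sum.swap)
  also have "\<dots> = (\<Sum>i\<in>{1..n}. \<Sum>k\<in>{1..n}. monomial_mat n A rs $$ (i - 1, k - 1) *
          (\<Sum>j\<in>{1..n}. A r $$ (k - 1, j - 1) * g i j))"
    by (simp only: sum_distrib_left mult.assoc)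
  \<comment> \<open>The induction hypothesis is used with an end weight that has absorbed the last
    factor: at \<open>i\<close> and \<open>k\<close> it is the sum over \<open>j\<close> of the
    entry of \<open>A r\<close> at \<open>k\<close> and \<open>j\<close> times
    \<open>g i j\<close>.\<close>
  also have "\<dots> = (\<Sum>\<pi>\<in>{0..?l} \<rightarrow>\<^sub>E {1..n}. (\<Sum>j\<in>{1..n}. A r $$ (\<pi> ?l - 1, j - 1) * g (\<pi> 0) j) *
        (\<Prod>j<?l. A (rs ! j) $$ (\<pi> j - 1, \<pi> (Suc j) - 1)))"
    by (rule snoc.IH[OF rs])
  also have "\<dots> = (\<Sum>\<pi>\<in>{0..?l} \<rightarrow>\<^sub>E {1..n}. \<Sum>y\<in>{1..n}. g ((\<pi>(Suc ?l := y)) 0) ((\<pi>(Suc ?l := y)) (Suc ?l)) *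
        (\<Prod>j<Suc ?l. A ((rs @ [r]) ! j) $$ ((\<pi>(Suc ?l := y)) j - 1, (\<pi>(Suc ?l := y)) (Suc j) - 1)))"
    by (intro sum.cong refl) (simp add: sum_distrib_left sum_distrib_right nth_append mult_ac)
  also have "\<dots> = (\<Sum>\<pi>\<in>PiE (insert (Suc ?l) {0..?l}) (\<lambda>_. {1..n}). g (\<pi> 0) (\<pi> (Suc ?l)) *
        (\<Prod>j<Suc ?l. A ((rs @ [r]) ! j) $$ (\<pi> j - 1, \<pi> (Suc j) - 1)))"
    by (rule sum_PiE_insert[symmetric]) auto
  finally show ?case by (simp add: atLeast0_atMost_Suc)
qed

definition circuits :: "nat \<Rightarrow> nat \<Rightarrow> (nat \<Rightarrow> nat) set" where
  "circuits n l = {\<pi> \<in> {0..l} \<rightarrow>\<^sub>E {1..n}. \<pi> 0 = \<pi> l}"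

lemma finite_circuits [simp]: "finite (circuits n l)"
  unfolding circuits_def
  by (rule finite_subset[of _ "{0..l} \<rightarrow>\<^sub>E {1..n}"]) (auto intro!: finite_PiE)

lemma mat_trace_monomial_mat:
  assumes "\<And>r. r \<in> set rs \<Longrightarrow> A r \<in> carrier_mat n n"
  shows "mat_trace (monomial_mat n A rs)
    = (\<Sum>\<pi>\<in>circuits n (length rs). \<Prod>j<length rs. A (rs ! j) $$ (\<pi> j - 1, \<pi> (Suc j) - 1))"
proof -
  have M: "monomial_mat n A rs \<in> carrier_mat n n"
    by (rule foldr_mult_mat(1)[OF assms one_carrier_mat])
  have "mat_trace (monomial_mat n A rs) = (\<Sum>i\<in>{0..<n}. monomial_mat n A rs $$ (i, i))"
    using M by (simp add: mat_trace_def diag_mat_def sum_list_sum_nth)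
  also have "\<dots> = (\<Sum>i\<in>{1..n}. monomial_mat n A rs $$ (i - 1, i - 1))"
    by (rule sum.reindex_bij_witness[of _ "\<lambda>k. k - 1" Suc]) auto
  \<comment> \<open>The Kronecker delta is the end weight that closes the paths to circuits.\<close>
  also have "\<dots> = (\<Sum>i\<in>{1..n}. \<Sum>j\<in>{1..n}. monomial_mat n A rs $$ (i - 1, j - 1) * (if i = j then 1 else 0))"
    by (intro sum.cong refl) (simp add: if_distrib[of "(*) _"] cong: if_cong)
  also have "\<dots> = (\<Sum>\<pi>\<in>{0..length rs} \<rightarrow>\<^sub>E {1..n}. (if \<pi> 0 = \<pi> (length rs) then 1 else 0) *
        (\<Prod>j<length rs. A (rs ! j) $$ (\<pi> j - 1, \<pi> (Suc j) - 1)))"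
    by (rule sum_monomial_mat_eq_sum_paths[OF assms])
  also have "\<dots> = (\<Sum>\<pi>\<in>circuits n (length rs). \<Prod>j<length rs. A (rs ! j) $$ (\<pi> j - 1, \<pi> (Suc j) - 1))"
    unfolding circuits_def by (rule sum.mono_neutral_cong_right) (auto intro!: finite_PiE)
  finally show ?thesis .
qed

section \<open>Counting paths and index functions with few values\<close>

definition link_label :: "(nat \<Rightarrow> nat \<Rightarrow> nat \<Rightarrow> int list) \<Rightarrow> nat \<Rightarrow> (nat \<Rightarrow> nat) \<Rightarrow> nat \<Rightarrow> int list" where
  "link_label Ld n \<pi> j = Ld n (\<pi> j) (\<pi> (Suc j))"

lemma property_BE:
  assumes "property_B d Ld"
  obtains B where "\<And>n r i. r \<in> Zplus d \<Longrightarrow> i \<in> {1..n} \<Longrightarrow> card {j \<in> {1..n}. Ld n i j = r} \<le> B"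
  using assms unfolding property_B_def bdd_above_def by blast

lemma link_label_in_Zplus:
  assumes "link_function d Ld" "\<pi> \<in> {0..l} \<rightarrow>\<^sub>E {1..n}" "j < l"
  shows "link_label Ld n \<pi> j \<in> Zplus d"
proof -
  have "\<pi> j \<in> {1..n}" "\<pi> (Suc j) \<in> {1..n}" 
    using PiE_mem[OF assms(2), of j] PiE_mem[OF assms(2), of "Suc j"] assms(3) by simp_all
  then show ?thesis using assms(1) by (auto simp: link_function_def link_label_def)
qed

text \<open>Closedness is dropped and a path is built step by step. The start has \<open>n\<close>
  choices; a step with a new label has at most \<open>n\<close>, and this happens at most
  \<open>u\<close> times; a step that repeats one of at most \<open>i\<close> earlier labels has at
  most \<open>i * B\<close> by Property B.\<close>

lemma card_paths_few_labels:
  assumes lf: "link_function d Ld"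
    and B: "\<And>r i. r \<in> Zplus d \<Longrightarrow> i \<in> {1..n} \<Longrightarrow> card {j \<in> {1..n}. Ld n i j = r} \<le> B"
  shows "card {\<pi> \<in> {0..l} \<rightarrow>\<^sub>E {1..n}. card (link_label Ld n \<pi> ` {..<l}) \<le> u}
    \<le> (\<Prod>i<l. 1 + i * B) * n ^ (1 + u)"
proof (induction l arbitrary: u)
  case 0
  have "card {\<pi> \<in> {0..0} \<rightarrow>\<^sub>E {1..n}. card (link_label Ld n \<pi> ` {..<0}) \<le> u} = n"
    by (simp add: card_PiE)
  also have "n \<le> n ^ (1 + u)" using self_le_power[of n "1 + u"] by (cases "n = 0") auto
  finally show ?case by simp
next
  case (Suc l)
  let ?P = "\<lambda>l u. {\<pi> \<in> {0..l} \<rightarrow>\<^sub>E {1..n}. card (link_label Ld n \<pi> ` {..<l}) \<le> u}"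
  let ?C = "\<Prod>i<l. 1 + i * B"
  have fin: "finite (?P l u)" for l u
    by (rule finite_subset[of _ "{0..l} \<rightarrow>\<^sub>E {1..n}"]) (auto intro!: finite_PiE)
  let ?ext = "\<lambda>(\<pi>, y). \<pi>(Suc l := y)"
  let ?old = "\<lambda>\<pi>. \<Union>a\<in>link_label Ld n \<pi> ` {..<l}. {y \<in> {1..n}. Ld n (\<pi> l) y = a}"
  have label_upd: "link_label Ld n (\<pi>(Suc l := y)) ` {..<l} = link_label Ld n \<pi> ` {..<l}" for \<pi> y
    by (intro image_cong) (auto simp: link_label_def)
  \<comment> \<open>The last step either carries a new label, leaving at most \<open>u - 1\<close>
    labels for the shorter path, or ends at one of the points in \<open>?old\<close>. For
    \<open>u = 0\<close> the first kind is impossible.\<close>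
  have decomp: "?P (Suc l) u \<subseteq> ?ext ` ((if u = 0 then {} else ?P l (u - 1)) \<times> {1..n}) \<union> ?ext ` (SIGMA \<pi>:?P l u. ?old \<pi>)"
  proof
    fix \<pi> assume p: "\<pi> \<in> ?P (Suc l) u"
    define \<rho> where "\<rho> = restrict \<pi> {0..l}"
    have pP: "\<pi> \<in> {0..Suc l} \<rightarrow>\<^sub>E {1..n}" using p by simp
    have \<rho>: "\<rho> \<in> {0..l} \<rightarrow>\<^sub>E {1..n}"
      unfolding \<rho>_def restrict_PiE_iff using PiE_mem[OF pP] by simp
    have y: "\<pi> (Suc l) \<in> {1..n}" by (rule PiE_mem[OF pP]) simp
    have ext: "\<pi> = \<rho>(Suc l := \<pi> (Suc l))"
    proof
      fix x
      consider "x = Suc l" | "x \<le> l" | "Suc l < x" by linarith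
      then show "\<pi> x = (\<rho>(Suc l := \<pi> (Suc l))) x"
        by cases (use PiE_arb[OF pP, of x] in \<open>simp_all add: \<rho>_def\<close>)
    qed
    have ext': "?ext (\<rho>, \<pi> (Suc l)) = \<pi>" using ext[symmetric] by simp
    have lab: "link_label Ld n \<pi> ` {..<l} = link_label Ld n \<rho> ` {..<l}"
      by (subst ext) (rule label_upd)
    have last: "link_label Ld n \<pi> l = Ld n (\<rho> l) (\<pi> (Suc l))"
      by (simp add: link_label_def \<rho>_def)
    have all: "link_label Ld n \<pi> ` {..<Suc l} = insert (link_label Ld n \<pi> l) (link_label Ld n \<rho> ` {..<l})"
      by (simp add: lessThan_Suc lab)
    show "\<pi> \<in> ?ext ` ((if u = 0 then {} else ?P l (u - 1)) \<times> {1..n}) \<union> ?ext ` (SIGMA \<pi>:?P l u. ?old \<pi>)"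
    proof (cases "link_label Ld n \<pi> l \<in> link_label Ld n \<rho> ` {..<l}")
      case True
      then have "\<rho> \<in> ?P l u" using p \<rho> by (simp add: all insert_absorb)
      moreover have "\<pi> (Suc l) \<in> ?old \<rho>" using True y by (auto simp: last)
      ultimately have "(\<rho>, \<pi> (Suc l)) \<in> (SIGMA \<pi>:?P l u. ?old \<pi>)" by blast
      then show ?thesis by (intro UnI2 image_eqI[where f="?ext" and x="(\<rho>, \<pi> (Suc l))", OF ext'[symmetric]])
    next
      case False
      then have "card (link_label Ld n \<rho> ` {..<l}) + 1 \<le> u" using p by (simp add: all)
      then have "\<rho> \<in> ?P l (u - 1)" "u \<noteq> 0" using \<rho> by auto
      then have "(\<rho>, \<pi> (Suc l)) \<in> (if u = 0 then {} else ?P l (u - 1)) \<times> {1..n}" using y by simp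
      then show ?thesis by (intro UnI1 image_eqI[where f="?ext" and x="(\<rho>, \<pi> (Suc l))", OF ext'[symmetric]])
    qed
  qed
  have old: "card (?old \<pi>) \<le> l * B" if "\<pi> \<in> ?P l u" for \<pi>
  proof -
    have "card (?old \<pi>) \<le> (\<Sum>a\<in>link_label Ld n \<pi> ` {..<l}. card {y \<in> {1..n}. Ld n (\<pi> l) y = a})"
      by (rule card_UN_le) simp
    also have "\<dots> \<le> (\<Sum>a\<in>link_label Ld n \<pi> ` {..<l}. B)"
    proof (rule sum_mono)
      fix a assume "a \<in> link_label Ld n \<pi> ` {..<l}"
      then have "a \<in> Zplus d" using link_label_in_Zplus[OF lf] that by auto
      moreover have "\<pi> l \<in> {1..n}" using that by auto
      ultimately show "card {y \<in> {1..n}. Ld n (\<pi> l) y = a} \<le> B" by (rule B)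
    qed
    also have "\<dots> \<le> l * B" using card_image_le[of "{..<l}" "link_label Ld n \<pi>"] by simp
    finally show ?thesis .
  qed
  have "card (?P (Suc l) u) \<le> card (?ext ` ((if u = 0 then {} else ?P l (u - 1)) \<times> {1..n}))
      + card (?ext ` (SIGMA \<pi>:?P l u. ?old \<pi>))"
    by (rule order_trans[OF card_mono[OF _ decomp] card_Un_le]) (use fin in \<open>auto intro!: finite_imageI finite_SigmaI\<close>)
  also have "card (?ext ` ((if u = 0 then {} else ?P l (u - 1)) \<times> {1..n})) \<le> ?C * n ^ (1 + u)"
  proof (cases "u = 0")
    case False
    have "card (?ext ` (?P l (u - 1) \<times> {1..n})) \<le> card (?P l (u - 1) \<times> {1..n})"
      by (rule card_image_le) (use fin in auto)
    also have "\<dots> \<le> (?C * n ^ (1 + (u - 1))) * n"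
      unfolding card_cartesian_product using Suc.IH[of "u - 1"] by (intro mult_mono) auto
    also have "\<dots> = ?C * n ^ (1 + u)" using False by (cases u) (auto simp: mult_ac)
    finally show ?thesis using False by simp
  qed simp
  also have "card (?ext ` (SIGMA \<pi>:?P l u. ?old \<pi>)) \<le> card (SIGMA \<pi>:?P l u. ?old \<pi>)"
    by (rule card_image_le) (use fin in auto)
  also have "card (SIGMA \<pi>:?P l u. ?old \<pi>) = (\<Sum>\<pi>\<in>?P l u. card (?old \<pi>))"
    by (rule card_SigmaI) (use fin in auto)
  also have "\<dots> \<le> (\<Sum>\<pi>\<in>?P l u. l * B)" by (rule sum_mono) (rule old)
  also have "\<dots> = card (?P l u) * (l * B)" by simp
  also have "\<dots> \<le> (?C * n ^ (1 + u)) * (l * B)" by (rule mult_right_mono[OF Suc.IH]) simp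
  finally show ?case by (simp add: algebra_simps)
qed

text \<open>A function with at most \<open>q\<close> values factors through \<open>{..<q}\<close>:
  there are \<open>q ^ l\<close> choices for the first map and \<open>card A ^ q\<close> for the
  second.\<close>

lemma card_PiE_small_image:
  assumes "finite A" "0 < l"
  shows "card {\<kappa> \<in> {..<l} \<rightarrow>\<^sub>E A. card (\<kappa> ` {..<l}) \<le> q} \<le> q ^ l * card A ^ q"
proof -
  let ?c = "\<lambda>(f, g). restrict (g \<circ> f) {..<l}"
  let ?D = "({..<l} \<rightarrow>\<^sub>E {..<q}) \<times> ({..<q} \<rightarrow>\<^sub>E A)"
  have "{\<kappa> \<in> {..<l} \<rightarrow>\<^sub>E A. card (\<kappa> ` {..<l}) \<le> q} \<subseteq> ?c ` ?D"
  proof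
    fix \<kappa> assume k: "\<kappa> \<in> {\<kappa> \<in> {..<l} \<rightarrow>\<^sub>E A. card (\<kappa> ` {..<l}) \<le> q}"
    then have "card (\<kappa> ` {..<l}) \<le> card {..<q}" by simp
    then obtain h where h: "inj_on h (\<kappa> ` {..<l})" "h ` (\<kappa> ` {..<l}) \<subseteq> {..<q}"
      using card_le_inj[of "\<kappa> ` {..<l}" "{..<q}"] by auto
    have sub: "\<kappa> ` {..<l} \<subseteq> A" using k by auto
    have a: "\<kappa> 0 \<in> A" using sub assms by auto
    define f where "f = restrict (h \<circ> \<kappa>) {..<l}"
    define g where "g = (\<lambda>i\<in>{..<q}. if i \<in> h ` (\<kappa> ` {..<l}) then inv_into (\<kappa> ` {..<l}) h i else \<kappa> 0)"
    have "f \<in> {..<l} \<rightarrow>\<^sub>E {..<q}" using h(2) unfolding f_def restrict_PiE_iff by fastforce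
    moreover have "g \<in> {..<q} \<rightarrow>\<^sub>E A"
    proof (unfold g_def, rule restrict_PiE_iff[THEN iffD2], intro ballI)
      fix i
      show "(if i \<in> h ` (\<kappa> ` {..<l}) then inv_into (\<kappa> ` {..<l}) h i else \<kappa> 0) \<in> A"
        using a inv_into_into[of i h "\<kappa> ` {..<l}"] sub by (simp add: subset_iff)
    qed
    ultimately have "(f, g) \<in> ?D" by (rule SigmaI)
    moreover have "?c (f, g) = \<kappa>"
    proof
      fix j show "?c (f, g) j = \<kappa> j"
      proof (cases "j < l")
        case True
        then have "\<kappa> j \<in> \<kappa> ` {..<l}" by simp
        moreover have "h (\<kappa> j) < q" using h(2) \<open>\<kappa> j \<in> \<kappa> ` {..<l}\<close> by blast
        ultimately show ?thesis using True inv_into_f_f[OF h(1)] by (simp add: f_def g_def)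
      next
        case False
        have "\<kappa> \<in> {..<l} \<rightarrow>\<^sub>E A" using k by simp
        from PiE_arb[OF this, of j] show ?thesis using False by simp
      qed
    qed
    ultimately show "\<kappa> \<in> ?c ` ?D" by (intro image_eqI[of \<kappa> ?c "(f, g)"]) simp_all
  qed
  then have "card {\<kappa> \<in> {..<l} \<rightarrow>\<^sub>E A. card (\<kappa> ` {..<l}) \<le> q} \<le> card (?c ` ?D)"
    by (intro card_mono finite_imageI finite_cartesian_product finite_PiE) (use assms in auto)
  also have "\<dots> \<le> card ?D"
    by (intro card_image_le finite_cartesian_product finite_PiE) (use assms in auto)
  also have "\<dots> = q ^ l * card A ^ q" by (simp add: card_cartesian_product card_PiE)
  finally show ?thesis .
qed

section \<open>Pairings of positions\<close>

lemma card_lessThan_eq_sum_fibers: "l = (\<Sum>u\<in>v ` {..<l}. card {i. i < l \<and> v i = u})"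
proof -
  have "(\<Sum>i<l. 1::nat) = (\<Sum>u\<in>v ` {..<l}. \<Sum>i\<in>{i \<in> {..<l}. v i = u}. 1)"
    by (rule sum.image_gen) simp
  then show ?thesis by simp
qed

definition paired :: "nat \<Rightarrow> (nat \<Rightarrow> 'b) \<Rightarrow> bool" where
  "paired l v \<longleftrightarrow> (\<forall>j<l. card {i. i < l \<and> v i = v j} = 2)"

lemma paired_card:
  assumes "paired l v" shows "l = 2 * card (v ` {..<l})"
proof -
  have "(\<Sum>u\<in>v ` {..<l}. card {i. i < l \<and> v i = u}) = (\<Sum>u\<in>v ` {..<l}. 2)"
    using assms by (intro sum.cong) (auto simp: paired_def)
  then show ?thesis using card_lessThan_eq_sum_fibers[of l v] by simp
qed

text \<open>Every value occurs at least twice, so twice the number of values is at most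
  \<open>l\<close>. If some value occurs three times or more, this is strict, and
  \<open>2 * u < l\<close> is the same as \<open>u \<le> (l - 1) div 2\<close> for
  \<open>l > 0\<close>.\<close>

lemma card_image_le_half:
  assumes "\<And>j. j < l \<Longrightarrow> card {i. i < l \<and> v i = v j} \<noteq> 1"
  shows "card (v ` {..<l}) \<le> l div 2" "\<not> paired l v \<Longrightarrow> card (v ` {..<l}) \<le> (l - 1) div 2"
proof -
  have ge: "2 \<le> card {i. i < l \<and> v i = v j}" if "j < l" for j
  proof -
    have "card {i. i < l \<and> v i = v j} \<noteq> 0" using that by auto
    then show ?thesis using assms[OF that] by linarith
  qed
  have "(\<Sum>u\<in>v ` {..<l}. 2) \<le> (\<Sum>u\<in>v ` {..<l}. card {i. i < l \<and> v i = u})"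
    by (rule sum_mono) (use ge in auto)
  then have le: "2 * card (v ` {..<l}) \<le> l"
    using card_lessThan_eq_sum_fibers[of l v] by simp
  then show "card (v ` {..<l}) \<le> l div 2" by simp
  assume "\<not> paired l v"
  then obtain j where j: "j < l" "card {i. i < l \<and> v i = v j} \<noteq> 2" by (auto simp: paired_def)
  have "(\<Sum>u\<in>v ` {..<l}. 2) < (\<Sum>u\<in>v ` {..<l}. card {i. i < l \<and> v i = u})"
  proof (rule sum_strict_mono_ex1)
    show "\<forall>u\<in>v ` {..<l}. 2 \<le> card {i. i < l \<and> v i = u}" using ge by blast
    show "\<exists>u\<in>v ` {..<l}. 2 < card {i. i < l \<and> v i = u}"
    proof (rule bexI)
      show "2 < card {i. i < l \<and> v i = v j}" using j(2) ge[OF j(1)] by linarith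
      show "v j \<in> v ` {..<l}" using j(1) by simp
    qed
  qed simp
  then have "2 * card (v ` {..<l}) < l"
    using card_lessThan_eq_sum_fibers[of l v] by simp
  then show "card (v ` {..<l}) \<le> (l - 1) div 2" by linarith
qed

lemma count_list_eq_card: "count_list rs r = card {j. j < length rs \<and> rs ! j = r}"
  by (simp add: count_list_eq_length_filter length_filter_conv_card conj_commute eq_commute)

text \<open>
  A position weighting \<open>\<kappa>\<close> that is constant on the classes of a pairing is the same as a weighting
  of the classes.
\<close>

lemma card_class_functions:
  fixes lab :: "nat \<Rightarrow> 'b" and I :: "nat \<Rightarrow> nat set"
  assumes pr: "paired (length rs) lab"
    and comp: "\<And>i j. i < length rs \<Longrightarrow> j < length rs \<Longrightarrow> lab i = lab j \<Longrightarrow> rs ! i = rs ! j"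
    and fin: "\<And>r. finite (I r)" and rs: "set rs \<subseteq> R" and R: "finite R"
  shows "card {\<kappa> \<in> (\<Pi>\<^sub>E j\<in>{..<length rs}. I (rs ! j)). \<forall>i<length rs. \<forall>j<length rs. lab i = lab j \<longrightarrow> \<kappa> i = \<kappa> j}
    = (\<Prod>r\<in>R. card (I r) ^ half_count rs r)"
proof -
  let ?l = "length rs"
  let ?U = "lab ` {..<?l}"
  have inv_lab: "inv_into {..<?l} lab u < ?l \<and> lab (inv_into {..<?l} lab u) = u" if "u \<in> ?U" for u
    using inv_into_into[OF that] f_inv_into_f[OF that] by simp
  \<comment> \<open>The index shared by the positions with label \<open>u\<close>; by
    \<open>comp\<close> it does not depend on the representative.\<close>
  define \<rho> where "\<rho> u = rs ! (inv_into {..<?l} lab u)" for u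
  have \<rho>: "\<rho> (lab j) = rs ! j" if "j < ?l" for j
    unfolding \<rho>_def using that inv_lab[of "lab j"] by (intro comp) simp_all
  let ?S = "{\<kappa> \<in> (\<Pi>\<^sub>E j\<in>{..<?l}. I (rs ! j)). \<forall>i<?l. \<forall>j<?l. lab i = lab j \<longrightarrow> \<kappa> i = \<kappa> j}"
  have "bij_betw (\<lambda>g. \<lambda>j\<in>{..<?l}. g (lab j)) (\<Pi>\<^sub>E u\<in>?U. I (\<rho> u)) ?S"
  proof (rule bij_betw_byWitness[where f' = "\<lambda>\<kappa>. \<lambda>u\<in>?U. \<kappa> (inv_into {..<?l} lab u)"])
    show "\<forall>g\<in>\<Pi>\<^sub>E u\<in>?U. I (\<rho> u). (\<lambda>u\<in>?U. (\<lambda>j\<in>{..<?l}. g (lab j)) (inv_into {..<?l} lab u)) = g"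
    proof (intro ballI ext)
      fix g u assume g: "g \<in> (\<Pi>\<^sub>E u\<in>?U. I (\<rho> u))"
      show "(\<lambda>u\<in>?U. (\<lambda>j\<in>{..<?l}. g (lab j)) (inv_into {..<?l} lab u)) u = g u"
        using inv_lab[of u] PiE_arb[OF g, of u] by (cases "u \<in> ?U") simp_all
    qed
    show "\<forall>\<kappa>\<in>?S. (\<lambda>j\<in>{..<?l}. (\<lambda>u\<in>?U. \<kappa> (inv_into {..<?l} lab u)) (lab j)) = \<kappa>"
    proof (intro ballI ext)
      fix \<kappa> j assume k: "\<kappa> \<in> ?S"
      show "(\<lambda>j\<in>{..<?l}. (\<lambda>u\<in>?U. \<kappa> (inv_into {..<?l} lab u)) (lab j)) j = \<kappa> j"
      proof (cases "j < ?l")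
        case True
        then have a: "inv_into {..<?l} lab (lab j) < ?l" "lab (inv_into {..<?l} lab (lab j)) = lab j"
          using inv_lab[of "lab j"] by simp_all
        have "\<forall>i<?l. \<forall>j<?l. lab i = lab j \<longrightarrow> \<kappa> i = \<kappa> j" using k unfolding mem_Collect_eq by (rule conjunct2)
        from this[rule_format, OF a(1) True a(2)]
        show ?thesis using True by simp
      next
        case False
        have "\<kappa> \<in> (\<Pi>\<^sub>E j\<in>{..<?l}. I (rs ! j))" using k by simp
        then show ?thesis using False PiE_arb[of \<kappa> "{..<?l}" _ j] by simp
      qed
    qed
    show "(\<lambda>g. \<lambda>j\<in>{..<?l}. g (lab j)) ` (\<Pi>\<^sub>E u\<in>?U. I (\<rho> u)) \<subseteq> ?S"
    proof
      fix \<kappa> assume "\<kappa> \<in> (\<lambda>g. \<lambda>j\<in>{..<?l}. g (lab j)) ` (\<Pi>\<^sub>E u\<in>?U. I (\<rho> u))"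
      then obtain g where g: "g \<in> (\<Pi>\<^sub>E u\<in>?U. I (\<rho> u))" "\<kappa> = (\<lambda>j\<in>{..<?l}. g (lab j))" by blast
      have "g (lab j) \<in> I (rs ! j)" if "j < ?l" for j
        using PiE_mem[OF g(1), of "lab j"] that \<rho>[OF that] by simp
      then show "\<kappa> \<in> ?S" using g(2) by auto
    qed
    show "(\<lambda>\<kappa>. \<lambda>u\<in>?U. \<kappa> (inv_into {..<?l} lab u)) ` ?S \<subseteq> (\<Pi>\<^sub>E u\<in>?U. I (\<rho> u))"
    proof (intro image_subsetI restrict_PiE_iff[THEN iffD2] ballI)
      fix \<kappa> u assume "\<kappa> \<in> ?S" "u \<in> ?U"
      then show "\<kappa> (inv_into {..<?l} lab u) \<in> I (\<rho> u)"
        using inv_lab[of u] unfolding \<rho>_def by (auto simp: PiE_iff)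
    qed
  qed
  then have "card ?S = (\<Prod>u\<in>?U. card (I (\<rho> u)))"
    by (subst bij_betw_same_card[symmetric]) (auto simp: card_PiE)
  \<comment> \<open>Classes are grouped by their index. The positions with index \<open>r\<close>
    split into classes of two, so there are \<open>half_count rs r\<close> of them.\<close>
  also have "\<dots> = (\<Prod>r\<in>R. \<Prod>u\<in>{u \<in> ?U. \<rho> u = r}. card (I (\<rho> u)))"
    by (rule prod.group[symmetric]) (use rs R \<rho> in auto)
  also have "\<dots> = (\<Prod>r\<in>R. card (I r) ^ half_count rs r)"
  proof (rule prod.cong[OF refl])
    fix r
    have "count_list rs r = (\<Sum>i\<in>{i. i < ?l \<and> rs ! i = r}. 1)" by (simp add: count_list_eq_card)
    also have "\<dots> = (\<Sum>u\<in>lab ` {i. i < ?l \<and> rs ! i = r}. \<Sum>i\<in>{i \<in> {i. i < ?l \<and> rs ! i = r}. lab i = u}. 1)"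
      by (rule sum.image_gen) simp
    also have "lab ` {i. i < ?l \<and> rs ! i = r} = {u \<in> ?U. \<rho> u = r}" using \<rho> by auto
    also have "(\<Sum>u\<in>{u \<in> ?U. \<rho> u = r}. \<Sum>i\<in>{i \<in> {i. i < ?l \<and> rs ! i = r}. lab i = u}. 1::nat)
        = (\<Sum>u\<in>{u \<in> ?U. \<rho> u = r}. 2)"
    proof (rule sum.cong[OF refl])
      fix u assume "u \<in> {u \<in> ?U. \<rho> u = r}"
      then obtain j where j: "j < ?l" "u = lab j" "rs ! j = r" using \<rho> by auto
      have c: "rs ! i = r" if "i < ?l" "lab i = lab j" for i
        using comp[OF that(1) j(1) that(2)] j(3) by simp
      have "{i \<in> {i. i < ?l \<and> rs ! i = r}. lab i = u} = {i. i < ?l \<and> lab i = lab j}"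
        using c by (auto simp: j(2))
      then show "(\<Sum>i\<in>{i \<in> {i. i < ?l \<and> rs ! i = r}. lab i = u}. 1::nat) = 2"
        using pr j by (simp add: paired_def)
    qed
    finally have "half_count rs r = card {u \<in> ?U. \<rho> u = r}" by (simp add: half_count_def)
    then show "(\<Prod>u\<in>{u \<in> ?U. \<rho> u = r}. card (I (\<rho> u))) = card (I r) ^ half_count rs r" by simp
  qed
  finally show ?thesis .
qed

section \<open>Words\<close>

lemma is_word_snoc: "is_word (w @ [a]) \<longleftrightarrow> is_word w \<and> (a \<in> set w \<or> a = card (set w))"
proof -
  have "is_word (w @ [a]) \<longleftrightarrow> (\<forall>i<length w. w ! i \<in> set (take i w) \<or> w ! i = card (set (take i w)))
      \<and> (a \<in> set w \<or> a = card (set w))"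
    unfolding is_word_def by (auto simp: nth_append less_Suc_eq)
  then show ?thesis by (simp add: is_word_def)
qed

lemma is_word_set: "is_word w \<Longrightarrow> set w = {..<card (set w)}"
proof (induction w rule: rev_induct)
  case (snoc a w)
  then have w: "set w = {..<card (set w)}" "a \<in> set w \<or> a = card (set w)" by (auto simp: is_word_snoc)
  show ?case
  proof (cases "a \<in> set w")
    case True
    then have "set (w @ [a]) = set w" by auto
    then show ?thesis using w(1) by (simp only:)
  next
    case False
    then have "set (w @ [a]) = insert (card (set w)) {..<card (set w)}" using w by auto
    moreover have "card (set (w @ [a])) = Suc (card (set w))" using False by simp
    ultimately show ?thesis by (simp only: lessThan_Suc)
  qed
qed simp

text \<open>Words encode set partitions: the next letter repeats that of an earlier equal label, or
  else is \<open>card (set w)\<close>, which is new because the letters used so far form an initial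
  segment.\<close>

lemma word_of_pattern_exists:
  "\<exists>w. length w = l \<and> is_word w \<and> (\<forall>i<l. \<forall>j<l. w ! i = w ! j \<longleftrightarrow> lab i = lab j)"
proof (induction l)
  case 0
  show ?case by (intro exI[of _ "[]"]) (simp add: is_word_def)
next
  case (Suc l)
  then obtain w where w: "length w = l" "is_word w" "\<And>i j. i < l \<Longrightarrow> j < l \<Longrightarrow> w ! i = w ! j \<longleftrightarrow> lab i = lab j"
    by auto
  have "\<exists>a. (a \<in> set w \<or> a = card (set w)) \<and> (\<forall>i<l. w ! i = a \<longleftrightarrow> lab i = lab l)"
  proof (cases "\<exists>j<l. lab j = lab l")
    case True
    then obtain j where j: "j < l" "lab j = lab l" by auto
    show ?thesis
      by (rule exI[of _ "w ! j"]) (use j w in auto)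
  next
    case False
    have "card (set w) \<notin> set w" using is_word_set[OF w(2)] by blast
    then have "w ! i \<noteq> card (set w)" if "i < l" for i using nth_mem[of i w] w(1) that by metis
    then show ?thesis using False by blast
  qed
  then obtain a where a: "a \<in> set w \<or> a = card (set w)" "\<And>i. i < l \<Longrightarrow> w ! i = a \<longleftrightarrow> lab i = lab l" by auto
  show ?case
  proof (intro exI[of _ "w @ [a]"] conjI allI impI)
    show "is_word (w @ [a])" using w(2) a(1) by (simp add: is_word_snoc)
    fix i j assume ij: "i < Suc l" "j < Suc l"
    show "(w @ [a]) ! i = (w @ [a]) ! j \<longleftrightarrow> lab i = lab j"
      using ij w(1,3) a(2)[of i] a(2)[of j] by (auto simp: nth_append less_Suc_eq)
  qed (use w in simp)
qed

text \<open>The pattern decides whether the next letter is old, and which one; a new letter is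
  forced by the alphabetical order of first occurrences.\<close>

lemma word_of_pattern_unique:
  assumes "is_word w" "is_word w'" "length w = length w'"
    and "\<And>i j. i < length w \<Longrightarrow> j < length w \<Longrightarrow> w ! i = w ! j \<longleftrightarrow> w' ! i = w' ! j"
  shows "w = w'"
  using assms
proof (induction w arbitrary: w' rule: rev_induct)
  case (snoc a u)
  obtain u' a' where w': "w' = u' @ [a']" using snoc.prems(3) by (cases w' rule: rev_cases) auto
  let ?l = "length u"
  have len: "length u' = ?l" using snoc.prems(3) by (simp add: w')
  have pat: "(u @ [a]) ! i = (u @ [a]) ! j \<longleftrightarrow> (u' @ [a']) ! i = (u' @ [a']) ! j"
    if "i < Suc ?l" "j < Suc ?l" for i j
    using snoc.prems(4)[of i j] that by (simp add: w')
  have patu: "u ! i = u ! j \<longleftrightarrow> u' ! i = u' ! j" if "i < ?l" "j < ?l" for i j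
    using pat[of i j] that by (simp add: nth_append len)
  have "u = u'"
    by (rule snoc.IH) (use snoc.prems(1,2) patu len in \<open>simp_all add: is_word_snoc w'\<close>)
  have last: "u ! i = a \<longleftrightarrow> u ! i = a'" if "i < ?l" for i
    using pat[of i ?l] that \<open>u = u'\<close> by (simp add: nth_append)
  have a: "a \<in> set u \<or> a = card (set u)" "a' \<in> set u \<or> a' = card (set u)"
    using snoc.prems(1,2) \<open>u = u'\<close> by (simp_all add: is_word_snoc w')
  have "a = a'" if "a \<in> set u"
  proof -
    obtain i where "i < ?l" "u ! i = a" using \<open>a \<in> set u\<close> by (auto simp: in_set_conv_nth)
    then show ?thesis using last[of i] by simp
  qed
  moreover have "a = a'" if "a' \<in> set u"
  proof -
    obtain i where "i < ?l" "u ! i = a'" using \<open>a' \<in> set u\<close> by (auto simp: in_set_conv_nth)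
    then show ?thesis using last[of i] by simp
  qed
  ultimately show ?case using a \<open>u = u'\<close> w' by auto
qed simp

text \<open>Passage to positions counted from 0: position \<open>j\<close> is here the step from
  \<open>\<pi> j\<close> to \<open>\<pi> (Suc j)\<close>, which the definition counts as
  \<open>Suc j\<close>.\<close>

lemma word_circuits_alt:
  assumes "length w = l"
  shows "word_circuits Ld n w = {\<pi> \<in> circuits n l.
    \<forall>i<l. \<forall>j<l. w ! i = w ! j \<longleftrightarrow> link_label Ld n \<pi> i = link_label Ld n \<pi> j}"
proof -
  have "(\<forall>i\<in>{1..l}. \<forall>j\<in>{1..l}. w ! (i - 1) = w ! (j - 1) \<longleftrightarrow>
      Ld n (\<pi> (i - 1)) (\<pi> i) = Ld n (\<pi> (j - 1)) (\<pi> j)) \<longleftrightarrow>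
    (\<forall>i<l. \<forall>j<l. w ! i = w ! j \<longleftrightarrow> link_label Ld n \<pi> i = link_label Ld n \<pi> j)" (is "?a \<longleftrightarrow> ?b") for \<pi>
  proof
    assume a: ?a
    show ?b
    proof (intro allI impI)
      fix i j assume "i < l" "j < l"
      then show "w ! i = w ! j \<longleftrightarrow> link_label Ld n \<pi> i = link_label Ld n \<pi> j"
        using bspec[OF bspec[OF a, of "Suc i"], of "Suc j"] by (simp add: link_label_def)
    qed
  next
    assume b: ?b
    show ?a
    proof (intro ballI)
      fix i j assume "i \<in> {1..l}" "j \<in> {1..l}"
      then obtain i' j' where "i = Suc i'" "i' < l" "j = Suc j'" "j' < l" by (cases i; cases j) auto
      then show "w ! (i - 1) = w ! (j - 1) \<longleftrightarrow> Ld n (\<pi> (i - 1)) (\<pi> i) = Ld n (\<pi> (j - 1)) (\<pi> j)"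
        using b by (simp add: link_label_def)
    qed
  qed
  then show ?thesis
    unfolding word_circuits_def circuits_def assms by auto
qed

section \<open>Circuits of pair-matched indexed words\<close>

definition index_compatible :: "nat list \<Rightarrow> (nat \<Rightarrow> 'b) \<Rightarrow> bool" where
  "index_compatible rs lab \<longleftrightarrow> (\<forall>i<length rs. \<forall>j<length rs. lab i = lab j \<longrightarrow> rs ! i = rs ! j)"

lemma pair_indexed_wordsD:
  assumes v: "v \<in> pair_indexed_words rs"
  shows "length v = length rs" "is_word (map fst v)" "map snd v = rs"
    and "\<And>i j. i < length rs \<Longrightarrow> j < length rs \<Longrightarrow> fst (v ! i) = fst (v ! j) \<longleftrightarrow> v ! i = v ! j"
    and "paired (length rs) ((!) v)"
proof -
  show s: "map snd v = rs" and "is_word (map fst v)"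
    using v by (auto simp: pair_indexed_words_def indexed_words_def)
  show l: "length v = length rs" using s by (metis length_map)
  show "fst (v ! i) = fst (v ! j) \<longleftrightarrow> v ! i = v ! j" if "i < length rs" "j < length rs" for i j
  proof -
    have "v ! i \<in> set v" "v ! j \<in> set v" using that l by auto
    then have "snd (v ! i) \<noteq> snd (v ! j) \<Longrightarrow> fst (v ! i) \<noteq> fst (v ! j)"
      using v unfolding pair_indexed_words_def indexed_words_def by blast
    then show ?thesis by (auto simp: prod_eq_iff)
  qed
  show "paired (length rs) ((!) v)"
    unfolding paired_def
  proof (intro allI impI)
    fix j assume "j < length rs"
    then have "count_list v (v ! j) = 2" using v l by (auto simp: pair_indexed_words_def)
    then show "card {i. i < length rs \<and> v ! i = v ! j} = 2" by (simp add: count_list_eq_card l)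
  qed
qed

text \<open>The two positions of a letter carry the same index, so every index occurs an even number
  of times and \<open>half_count\<close> does not round.\<close>

lemma pair_indexed_words_count_even:
  assumes v: "v \<in> pair_indexed_words rs" and R: "set rs \<subseteq> R" "finite R"
  shows "(\<Sum>r\<in>R. half_count rs r) = length rs div 2"
proof -
  let ?l = "length rs"
  note V = pair_indexed_wordsD[OF v]
  have "even (count_list rs r)" for r
  proof -
    let ?S = "{i. i < ?l \<and> rs ! i = r}"
    have snd_v: "rs ! i = snd (v ! i)" if "i < ?l" for i using V(1,3) that by (metis nth_map)
    have "card ?S = (\<Sum>i\<in>?S. 1)" by simp
    also have "\<dots> = (\<Sum>x\<in>(!) v ` ?S. \<Sum>i\<in>{i \<in> ?S. v ! i = x}. 1)" by (rule sum.image_gen) simp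
    also have "\<dots> = (\<Sum>x\<in>(!) v ` ?S. 2)"
    proof (rule sum.cong[OF refl])
      fix x assume "x \<in> (!) v ` ?S"
      then obtain j where j: "j < ?l" "rs ! j = r" "x = v ! j" by auto
      then have "{i \<in> ?S. v ! i = x} = {i. i < ?l \<and> v ! i = v ! j}"
        using snd_v by auto
      then show "(\<Sum>i\<in>{i \<in> ?S. v ! i = x}. 1::nat) = 2"
        using V(5) j by (simp add: paired_def)
    qed
    finally show ?thesis by (simp add: count_list_eq_card)
  qed
  then have "2 * half_count rs r = count_list rs r" for r by (simp add: half_count_def)
  then have "2 * (\<Sum>r\<in>R. half_count rs r) = (\<Sum>r\<in>R. count_list rs r)"
    by (simp add: sum_distrib_left)
  also have "\<dots> = (\<Sum>r\<in>set rs. count_list rs r)"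
    using R by (intro sum.mono_neutral_right) (auto simp: count_list_0_iff)
  also have "\<dots> = length rs" by (rule sum_count_set) auto
  finally show ?thesis by simp
qed

text \<open>The circuits that carry the main term: their labels form a pairing that can be indexed
  by \<open>rs\<close>. All others enter only the error.\<close>

definition good_circuits :: "(nat \<Rightarrow> nat \<Rightarrow> nat \<Rightarrow> int list) \<Rightarrow> nat \<Rightarrow> nat list \<Rightarrow> (nat \<Rightarrow> nat) set" where
  "good_circuits Ld n rs = {\<pi> \<in> circuits n (length rs).
     paired (length rs) (link_label Ld n \<pi>) \<and> index_compatible rs (link_label Ld n \<pi>)}"

text \<open>The word of a circuit is the pattern of its labels. Pairing means that each letter
  occurs twice, and compatibility lets the letters be zipped with \<open>rs\<close>.\<close>

lemma good_circuits_eq_Union: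
  "good_circuits Ld n rs = (\<Union>v\<in>pair_indexed_words rs. word_circuits Ld n (drop_indices v))"
proof (rule equalityI[OF subsetI subsetI])
  let ?l = "length rs"
  fix \<pi>
  let ?lab = "link_label Ld n \<pi>"
  assume "\<pi> \<in> (\<Union>v\<in>pair_indexed_words rs. word_circuits Ld n (drop_indices v))"
  then obtain v where v: "v \<in> pair_indexed_words rs" and \<pi>: "\<pi> \<in> word_circuits Ld n (drop_indices v)" by auto
  note V = pair_indexed_wordsD[OF v]
  have len: "length (drop_indices v) = ?l" by (simp add: drop_indices_def V(1))
  have c: "\<pi> \<in> circuits n ?l" and "\<forall>i<?l. \<forall>j<?l. drop_indices v ! i = drop_indices v ! j \<longleftrightarrow> ?lab i = ?lab j"
    using \<pi> unfolding word_circuits_alt[OF len] by auto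
  then have lab: "?lab i = ?lab j \<longleftrightarrow> v ! i = v ! j" if "i < ?l" "j < ?l" for i j
    using V(1) V(4)[OF that] that by (auto simp: drop_indices_def)
  have "paired ?l ?lab"
    unfolding paired_def
  proof (intro allI impI)
    fix j assume j: "j < ?l"
    have "{i. i < ?l \<and> ?lab i = ?lab j} = {i. i < ?l \<and> v ! i = v ! j}" using lab[OF _ j] by auto
    then show "card {i. i < ?l \<and> ?lab i = ?lab j} = 2" using V(5) j by (simp add: paired_def)
  qed
  moreover have "index_compatible rs ?lab"
    unfolding index_compatible_def
  proof (intro allI impI)
    fix i j assume ij: "i < ?l" "j < ?l" "?lab i = ?lab j"
    then have "snd (v ! i) = snd (v ! j)" using lab by simp
    then show "rs ! i = rs ! j" using ij V(1,3) by (metis nth_map)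
  qed
  ultimately show "\<pi> \<in> good_circuits Ld n rs" using c by (simp add: good_circuits_def)
next
  let ?l = "length rs"
  fix \<pi>
  let ?lab = "link_label Ld n \<pi>"
  assume "\<pi> \<in> good_circuits Ld n rs"
  then have c: "\<pi> \<in> circuits n ?l" and p: "paired ?l ?lab" and ic: "index_compatible rs ?lab"
    by (auto simp: good_circuits_def)
  obtain w where w: "length w = ?l" "is_word w" "\<forall>i<?l. \<forall>j<?l. w ! i = w ! j \<longleftrightarrow> ?lab i = ?lab j"
    using word_of_pattern_exists[of ?l ?lab] by auto
  define v where "v = zip w rs"
  have v: "length v = ?l" "map fst v = w" "map snd v = rs" using w(1) by (simp_all add: v_def)
  have vi: "v ! i = (w ! i, rs ! i)" if "i < ?l" for i using that w(1) by (simp add: v_def)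
  have eq: "v ! i = v ! j \<longleftrightarrow> ?lab i = ?lab j" if ij: "i < ?l" "j < ?l" for i j
  proof -
    have "w ! i = w ! j \<longleftrightarrow> ?lab i = ?lab j" using w(3) ij by blast
    moreover have "?lab i = ?lab j \<longrightarrow> rs ! i = rs ! j"
      using ic ij unfolding index_compatible_def by blast
    ultimately show ?thesis unfolding vi[OF ij(1)] vi[OF ij(2)] prod.inject by blast
  qed
  have "v \<in> indexed_words rs"
    unfolding indexed_words_def mem_Collect_eq
  proof (intro conjI ballI impI)
    fix x y assume "x \<in> set v" "y \<in> set v" and ne: "snd x \<noteq> snd y"
    then obtain i j where ij: "i < ?l" "x = v ! i" "j < ?l" "y = v ! j" using v(1) by (auto simp: in_set_conv_nth)
    show "fst x \<noteq> fst y"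
    proof
      assume "fst x = fst y"
      then have "w ! i = w ! j" using ij by (simp add: vi)
      then have "?lab i = ?lab j" using ij(1,3) w(3) by blast
      then have "rs ! i = rs ! j" using ij(1,3) ic unfolding index_compatible_def by blast
      then show False using ne ij by (simp add: vi)
    qed
  qed (use v w in simp_all)
  moreover have "count_list v x = 2" if "x \<in> set v" for x
  proof -
    obtain j where j: "j < ?l" "x = v ! j" using \<open>x \<in> set v\<close> v(1) by (auto simp: in_set_conv_nth)
    have "count_list v x = card {i. i < ?l \<and> ?lab i = ?lab j}"
      unfolding count_list_eq_card v(1) j(2) using eq[OF _ j(1)] by (intro arg_cong[where f=card]) auto
    then show ?thesis using p j by (simp add: paired_def)
  qed
  ultimately have "v \<in> pair_indexed_words rs" by (simp add: pair_indexed_words_def)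
  moreover have "\<pi> \<in> word_circuits Ld n (drop_indices v)"
    unfolding drop_indices_def v(2) word_circuits_alt[OF w(1)] using c w(3) by simp
  ultimately show "\<pi> \<in> (\<Union>v\<in>pair_indexed_words rs. word_circuits Ld n (drop_indices v))" by blast
qed

text \<open>The union is disjoint: a circuit determines its word, and \<open>rs\<close> determines
  the indices attached to it.\<close>

lemma card_good_circuits:
  "card (good_circuits Ld n rs) = (\<Sum>v\<in>pair_indexed_words rs. card (word_circuits Ld n (drop_indices v)))"
  unfolding good_circuits_eq_Union
proof (rule card_UN_disjoint)
  show "finite (pair_indexed_words rs)" by (rule finite_pair_indexed_words)
  let ?l = "length rs"
  show "\<forall>v\<in>pair_indexed_words rs. finite (word_circuits Ld n (drop_indices v))"
    by (auto simp: word_circuits_alt[OF refl])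
  show "\<forall>v\<in>pair_indexed_words rs. \<forall>v'\<in>pair_indexed_words rs. v \<noteq> v' \<longrightarrow>
      word_circuits Ld n (drop_indices v) \<inter> word_circuits Ld n (drop_indices v') = {}"
  proof (intro ballI impI, rule ccontr)
    fix v v' assume v: "v \<in> pair_indexed_words rs" and v': "v' \<in> pair_indexed_words rs" and ne: "v \<noteq> v'"
      and "word_circuits Ld n (drop_indices v) \<inter> word_circuits Ld n (drop_indices v') \<noteq> {}"
    then obtain \<pi> where "\<pi> \<in> word_circuits Ld n (drop_indices v)" "\<pi> \<in> word_circuits Ld n (drop_indices v')"
      by auto
    note V = pair_indexed_wordsD[OF v] and V' = pair_indexed_wordsD[OF v']
    have len: "length (drop_indices v) = ?l" "length (drop_indices v') = ?l"
      by (simp_all add: drop_indices_def V(1) V'(1))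
    have "drop_indices v = drop_indices v'"
    proof (rule word_of_pattern_unique)
      show "is_word (drop_indices v)" "is_word (drop_indices v')"
        using V(2) V'(2) by (simp_all add: drop_indices_def)
      fix i j assume "i < length (drop_indices v)" "j < length (drop_indices v)"
      then show "drop_indices v ! i = drop_indices v ! j \<longleftrightarrow> drop_indices v' ! i = drop_indices v' ! j"
        using \<open>\<pi> \<in> word_circuits Ld n (drop_indices v)\<close> \<open>\<pi> \<in> word_circuits Ld n (drop_indices v')\<close>
        unfolding word_circuits_alt[OF len(1)] word_circuits_alt[OF len(2)] len by blast
    qed (simp add: len)
    then have "v = v'" using V(3) V'(3) unfolding drop_indices_def by (metis zip_map_fst_snd)
    then show False using ne by simp
  qed
qed

section \<open>Moments of the input variables\<close>

text \<open>The product is at most the \<open>l\<close>-th power of its largest factor, which is one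
  of the summands. Moments of single variables thus control mixed products whatever their
  dependence.\<close>

lemma prod_abs_le_sum_power:
  fixes x :: "nat \<Rightarrow> real"
  assumes "0 < l" shows "\<bar>\<Prod>j<l. x j\<bar> \<le> (\<Sum>j<l. \<bar>x j\<bar> ^ l)"
proof -
  have ne: "(\<lambda>j. \<bar>x j\<bar>) ` {..<l} \<noteq> {}" using assms by auto
  have "Max ((\<lambda>j. \<bar>x j\<bar>) ` {..<l}) \<in> (\<lambda>j. \<bar>x j\<bar>) ` {..<l}" by (rule Max_in[OF _ ne]) simp
  then obtain m where m: "m < l" "\<bar>x m\<bar> = Max ((\<lambda>j. \<bar>x j\<bar>) ` {..<l})" by auto
  have "\<bar>\<Prod>j<l. x j\<bar> \<le> (\<Prod>j<l. \<bar>x m\<bar>)"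
    unfolding abs_prod by (rule prod_mono) (auto simp: m(2))
  also have "\<dots> = \<bar>x m\<bar> ^ l" by simp
  also have "\<dots> \<le> (\<Sum>j<l. \<bar>x j\<bar> ^ l)" using m(1) by (intro member_le_sum) auto
  finally show ?thesis .
qed

context prob_space
begin

context
  fixes X :: "int list \<Rightarrow> nat \<Rightarrow> 'a \<Rightarrow> real"
  assumes X: "assumption_I X"
begin

lemma input_measurable: "(r, k) \<in> input_index \<Longrightarrow> X r k \<in> borel_measurable M"
  using X unfolding assumption_I_def by (auto dest: borel_measurable_integrable)

text \<open>Assumption I bounds moments of order at least 3 only; order \<open>l + 3\<close> always
  qualifies, and |x|^l \<le> 1 + |x|^(l+3).\<close>

lemma input_moment_bound:
  obtains B where "\<forall>r k. (r, k) \<in> input_index \<longrightarrow>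
    integrable M (\<lambda>\<omega>. \<bar>X r k \<omega>\<bar> ^ l) \<and> expectation (\<lambda>\<omega>. \<bar>X r k \<omega>\<bar> ^ l) \<le> B"
proof -
  define S where "S = (SUP i\<in>{0..}. SUP j\<in>{0..}. SUP k\<in>{1..}.
        (\<integral>\<^sup>+ \<omega>. ennreal (\<bar>X [i, j] k \<omega>\<bar> ^ (l + 3) + \<bar>X [i] k \<omega>\<bar> ^ (l + 3)) \<partial>M))"
  have S: "S < \<infinity>"
  proof -
    have "\<forall>l\<ge>3. (SUP i\<in>{0..}. SUP j\<in>{0..}. SUP k\<in>{1..}.
        (\<integral>\<^sup>+ \<omega>. ennreal (\<bar>X [i, j] k \<omega>\<bar> ^ l + \<bar>X [i] k \<omega>\<bar> ^ l) \<partial>M)) < \<infinity>"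
      using X unfolding assumption_I_def by blast
    from this[rule_format, of "l + 3"] show ?thesis by (simp add: S_def)
  qed
  have le: "(\<integral>\<^sup>+ \<omega>. ennreal (\<bar>X [i, j] k \<omega>\<bar> ^ (l + 3) + \<bar>X [i] k \<omega>\<bar> ^ (l + 3)) \<partial>M) \<le> S"
    if "0 \<le> i" "0 \<le> j" "1 \<le> k" for i j k
    unfolding S_def
    by (rule SUP_upper2[of i], use that in simp, rule SUP_upper2[of j], use that in simp,
        rule SUP_upper, use that in simp)
  have nn: "(\<integral>\<^sup>+ \<omega>. ennreal (\<bar>X r k \<omega>\<bar> ^ (l + 3)) \<partial>M) \<le> S" if rk: "(r, k) \<in> input_index" for r k
  proof -
    have k: "1 \<le> k" and r: "r \<in> Zplus 1 \<or> r \<in> Zplus 2" using rk by (auto simp: input_index_def)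
    from r show ?thesis
    proof
      assume "r \<in> Zplus 1"
      then obtain i where i: "r = [i]" "0 \<le> i" by (auto simp: Zplus_def length_Suc_conv)
      \<comment> \<open>The supremum runs over pairs of indices, so a one-dimensional index is
        completed by 0.\<close>
      have "(\<integral>\<^sup>+ \<omega>. ennreal (\<bar>X r k \<omega>\<bar> ^ (l + 3)) \<partial>M)
          \<le> (\<integral>\<^sup>+ \<omega>. ennreal (\<bar>X [i, 0] k \<omega>\<bar> ^ (l + 3) + \<bar>X [i] k \<omega>\<bar> ^ (l + 3)) \<partial>M)"
        unfolding i by (intro nn_integral_mono ennreal_leI) simp
      also have "\<dots> \<le> S" by (rule le) (use i k in auto)
      finally show ?thesis .
    next
      assume "r \<in> Zplus 2"
      then obtain i j where i: "r = [i, j]" "0 \<le> i" "0 \<le> j"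
        by (auto simp: Zplus_def length_Suc_conv numeral_2_eq_2)
      have "(\<integral>\<^sup>+ \<omega>. ennreal (\<bar>X r k \<omega>\<bar> ^ (l + 3)) \<partial>M)
          \<le> (\<integral>\<^sup>+ \<omega>. ennreal (\<bar>X [i, j] k \<omega>\<bar> ^ (l + 3) + \<bar>X [i] k \<omega>\<bar> ^ (l + 3)) \<partial>M)"
        unfolding i by (intro nn_integral_mono ennreal_leI) simp
      also have "\<dots> \<le> S" by (rule le) (use i k in auto)
      finally show ?thesis .
    qed
  qed
  show thesis
  proof (rule that[of "1 + enn2real S"], intro allI impI)
    fix r k assume rk: "(r, k) \<in> input_index"
    note [measurable] = input_measurable[OF rk]
    have int: "integrable M (\<lambda>\<omega>. \<bar>X r k \<omega>\<bar> ^ (l + 3))"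
      by (rule integrableI_bounded) (use nn[OF rk] S in \<open>auto simp: power_abs intro: le_less_trans\<close>)
    have E: "expectation (\<lambda>\<omega>. \<bar>X r k \<omega>\<bar> ^ (l + 3)) \<le> enn2real S"
      by (subst integral_eq_nn_integral) (use nn[OF rk] S in \<open>auto intro!: enn2real_mono\<close>)
    have pw: "\<bar>X r k \<omega>\<bar> ^ l \<le> 1 + \<bar>X r k \<omega>\<bar> ^ (l + 3)" for \<omega>
    proof (cases "\<bar>X r k \<omega>\<bar> \<le> 1")
      case True
      then have "\<bar>X r k \<omega>\<bar> ^ l \<le> 1" by (simp add: power_le_one)
      then show ?thesis by (simp add: add_increasing2)
    next
      case False
      then have "\<bar>X r k \<omega>\<bar> ^ l \<le> \<bar>X r k \<omega>\<bar> ^ (l + 3)" by (intro power_increasing) auto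
      then show ?thesis by simp
    qed
    have int_l: "integrable M (\<lambda>\<omega>. \<bar>X r k \<omega>\<bar> ^ l)"
      by (rule Bochner_Integration.integrable_bound[OF Bochner_Integration.integrable_add[OF integrable_const[of 1] int]])
        (use pw in auto)
    have "expectation (\<lambda>\<omega>. \<bar>X r k \<omega>\<bar> ^ l) \<le> expectation (\<lambda>\<omega>. 1 + \<bar>X r k \<omega>\<bar> ^ (l + 3))"
      by (rule integral_mono) (use int int_l pw in auto)
    also have "\<dots> \<le> 1 + enn2real S" using int E by (simp add: prob_space)
    finally show "integrable M (\<lambda>\<omega>. \<bar>X r k \<omega>\<bar> ^ l) \<and> expectation (\<lambda>\<omega>. \<bar>X r k \<omega>\<bar> ^ l) \<le> 1 + enn2real S"
      using int_l by simp
  qed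
qed

lemma input_product_bound:
  fixes l :: nat
  assumes l: "0 < l"
  obtains C where "0 \<le> C"
    "\<forall>a \<kappa>. (\<forall>j<l. (a j, \<kappa> j) \<in> input_index) \<longrightarrow>
       integrable M (\<lambda>\<omega>. \<Prod>j<l. X (a j) (\<kappa> j) \<omega>) \<and>
       expectation (\<lambda>\<omega>. \<bar>\<Prod>j<l. X (a j) (\<kappa> j) \<omega>\<bar>) \<le> C"
proof -
  obtain B where B: "\<forall>r k. (r, k) \<in> input_index \<longrightarrow>
    integrable M (\<lambda>\<omega>. \<bar>X r k \<omega>\<bar> ^ l) \<and> expectation (\<lambda>\<omega>. \<bar>X r k \<omega>\<bar> ^ l) \<le> B"
    by (rule input_moment_bound[of l])
  have res: "integrable M (\<lambda>\<omega>. \<Prod>j<l. X (a j) (\<kappa> j) \<omega>) \<and>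
       expectation (\<lambda>\<omega>. \<bar>\<Prod>j<l. X (a j) (\<kappa> j) \<omega>\<bar>) \<le> real l * max 0 B"
    if v: "\<And>j. j < l \<Longrightarrow> (a j, \<kappa> j) \<in> input_index" for a \<kappa>
  proof -
    have dom: "integrable M (\<lambda>\<omega>. \<Sum>j<l. \<bar>X (a j) (\<kappa> j) \<omega>\<bar> ^ l)"
      using B v by (intro Bochner_Integration.integrable_sum) auto
    have bd: "\<bar>\<Prod>j<l. X (a j) (\<kappa> j) \<omega>\<bar> \<le> (\<Sum>j<l. \<bar>X (a j) (\<kappa> j) \<omega>\<bar> ^ l)" for \<omega>
      by (rule prod_abs_le_sum_power[OF l])
    have int: "integrable M (\<lambda>\<omega>. \<Prod>j<l. X (a j) (\<kappa> j) \<omega>)"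
    proof (rule Bochner_Integration.integrable_bound[OF dom])
      show "(\<lambda>\<omega>. \<Prod>j<l. X (a j) (\<kappa> j) \<omega>) \<in> borel_measurable M"
        by (intro borel_measurable_prod input_measurable v) simp
      show "AE \<omega> in M. norm (\<Prod>j<l. X (a j) (\<kappa> j) \<omega>) \<le> norm (\<Sum>j<l. \<bar>X (a j) (\<kappa> j) \<omega>\<bar> ^ l)"
        by (rule AE_I2) (use bd in \<open>simp add: abs_of_nonneg[OF sum_nonneg]\<close>)
    qed
    have "expectation (\<lambda>\<omega>. \<bar>\<Prod>j<l. X (a j) (\<kappa> j) \<omega>\<bar>) \<le> expectation (\<lambda>\<omega>. \<Sum>j<l. \<bar>X (a j) (\<kappa> j) \<omega>\<bar> ^ l)"
      by (rule integral_mono) (use int dom bd in auto)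
    also have "\<dots> = (\<Sum>j<l. expectation (\<lambda>\<omega>. \<bar>X (a j) (\<kappa> j) \<omega>\<bar> ^ l))"
      using B v by (intro Bochner_Integration.integral_sum) auto
    also have "\<dots> \<le> (\<Sum>j<l. max 0 B)"
      by (rule sum_mono) (use B v in \<open>auto simp: le_max_iff_disj\<close>)
    finally show ?thesis using int by simp
  qed
  show thesis
  proof (rule that[of "real l * max 0 B"], simp, intro allI impI)
    fix a :: "nat \<Rightarrow> int list" and \<kappa> assume "\<forall>j<l. (a j, \<kappa> j) \<in> input_index"
    then show "integrable M (\<lambda>\<omega>. \<Prod>j<l. X (a j) (\<kappa> j) \<omega>) \<and>
       expectation (\<lambda>\<omega>. \<bar>\<Prod>j<l. X (a j) (\<kappa> j) \<omega>\<bar>) \<le> real l * max 0 B" by (intro res) simp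
  qed
qed

text \<open>Collecting equal factors leaves powers of distinct input variables, and these are
  independent.\<close>

lemma input_product_expectation:
  fixes v :: "nat \<Rightarrow> int list \<times> nat"
  assumes v: "\<And>j. j < l \<Longrightarrow> v j \<in> input_index"
  shows "expectation (\<lambda>\<omega>. \<Prod>j<l. X (fst (v j)) (snd (v j)) \<omega>)
    = (\<Prod>u\<in>v ` {..<l}. expectation (\<lambda>\<omega>. X (fst u) (snd u) \<omega> ^ card {i. i < l \<and> v i = u}))"
proof -
  let ?U = "v ` {..<l}"
  let ?c = "\<lambda>u. card {i. i < l \<and> v i = u}"
  have U: "?U \<subseteq> input_index" using v by auto
  have "indep_vars (\<lambda>_. borel) (\<lambda>(r, k). X r k) ?U"
    using X U unfolding assumption_I_def by (blast intro: indep_vars_subset)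
  then have "indep_vars (\<lambda>_. borel) (\<lambda>u \<omega>. ((\<lambda>(r, k). X r k) u \<omega>) ^ ?c u) ?U"
    by (rule indep_vars_compose2) auto
  then have ind: "indep_vars (\<lambda>_. borel) (\<lambda>u \<omega>. X (fst u) (snd u) \<omega> ^ ?c u) ?U"
    by (simp add: case_prod_unfold)
  have int: "integrable M (\<lambda>\<omega>. X (fst u) (snd u) \<omega> ^ n)" if "u \<in> ?U" for u n
  proof -
    have u: "(fst u, snd u) \<in> input_index" using U that by auto
    have "integrable M (\<lambda>\<omega>. \<bar>X (fst u) (snd u) \<omega>\<bar> ^ n)"
      by (rule input_moment_bound[of n]) (use u in blast)
    then show ?thesis using input_measurable[OF u]
      by (simp add: power_abs[symmetric] integrable_abs_iff)
  qed
  have "(\<Prod>j<l. X (fst (v j)) (snd (v j)) \<omega>) = (\<Prod>u\<in>?U. X (fst u) (snd u) \<omega> ^ ?c u)" for \<omega>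
  proof -
    have "(\<Prod>j<l. X (fst (v j)) (snd (v j)) \<omega>)
        = (\<Prod>u\<in>?U. \<Prod>j\<in>{j \<in> {..<l}. v j = u}. X (fst (v j)) (snd (v j)) \<omega>)"
      by (rule prod.group[symmetric]) auto
    also have "\<dots> = (\<Prod>u\<in>?U. X (fst u) (snd u) \<omega> ^ ?c u)"
      by (rule prod.cong) auto
    finally show ?thesis .
  qed
  then have "expectation (\<lambda>\<omega>. \<Prod>j<l. X (fst (v j)) (snd (v j)) \<omega>)
      = expectation (\<lambda>\<omega>. \<Prod>u\<in>?U. X (fst u) (snd u) \<omega> ^ ?c u)" by simp
  also have "\<dots> = (\<Prod>u\<in>?U. expectation (\<lambda>\<omega>. X (fst u) (snd u) \<omega> ^ ?c u))"
    by (rule indep_vars_lebesgue_integral[OF _ ind]) (use int in auto)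
  finally show ?thesis .
qed

lemma input_moments:
  assumes "(r, k) \<in> input_index"
  shows "expectation (X r k) = 0" "expectation (\<lambda>\<omega>. X r k \<omega> ^ 2) = 1"
proof -
  have *: "\<forall>(r, k)\<in>input_index. integrable M (X r k) \<and> expectation (X r k) = 0 \<and>
        integrable M (\<lambda>\<omega>. (X r k \<omega>)\<^sup>2) \<and> variance (X r k) = 1"
    using X unfolding assumption_I_def by blast
  then show z: "expectation (X r k) = 0" using assms by auto
  show "expectation (\<lambda>\<omega>. X r k \<omega> ^ 2) = 1" using * assms z by fastforce
qed

lemma input_product_expectation_eq_0:
  fixes v :: "nat \<Rightarrow> int list \<times> nat"
  assumes v: "\<And>j. j < l \<Longrightarrow> v j \<in> input_index" and j: "j < l" "card {i. i < l \<and> v i = v j} = 1"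
  shows "expectation (\<lambda>\<omega>. \<Prod>j<l. X (fst (v j)) (snd (v j)) \<omega>) = 0"
proof -
  have "expectation (\<lambda>\<omega>. X (fst (v j)) (snd (v j)) \<omega> ^ card {i. i < l \<and> v i = v j}) = 0"
    using input_moments(1)[of "fst (v j)" "snd (v j)"] v[OF j(1)] j(2) by simp
  then have "(\<Prod>u\<in>v ` {..<l}. expectation (\<lambda>\<omega>. X (fst u) (snd u) \<omega> ^ card {i. i < l \<and> v i = u})) = 0"
    using j(1) by (intro prod_zero) auto
  then show ?thesis using input_product_expectation[of l v] v by simp
qed

lemma input_product_expectation_eq_1:
  fixes v :: "nat \<Rightarrow> int list \<times> nat"
  assumes v: "\<And>j. j < l \<Longrightarrow> v j \<in> input_index" and p: "paired l v"
  shows "expectation (\<lambda>\<omega>. \<Prod>j<l. X (fst (v j)) (snd (v j)) \<omega>) = 1"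
proof -
  have "(\<Prod>u\<in>v ` {..<l}. expectation (\<lambda>\<omega>. X (fst u) (snd u) \<omega> ^ card {i. i < l \<and> v i = u})) = 1"
  proof (rule prod.neutral, rule ballI)
    fix u assume "u \<in> v ` {..<l}"
    then obtain j where j: "j < l" "u = v j" by auto
    then show "expectation (\<lambda>\<omega>. X (fst u) (snd u) \<omega> ^ card {i. i < l \<and> v i = u}) = 1"
      using p input_moments(2)[of "fst u" "snd u"] v[OF j(1)] by (simp add: paired_def)
  qed
  then show ?thesis using input_product_expectation[of l v] v by simp
qed

text \<open>
  Pairings of positions with equal indices are computed exactly; the other label patterns contribute
  at most the same order \<open>K ^ (l div 2)\<close>, but have fewer labels and hence fewer circuits.
\<close>

lemma block_sum_product_expectation:
  assumes rs: "rs \<noteq> []" "set rs \<subseteq> {1..p}"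
  obtains C where "0 \<le> C"
    "\<forall>lab I K. (\<forall>j<length rs. lab j \<in> Zplus 1 \<union> Zplus 2) \<longrightarrow> (\<forall>r. I r \<subseteq> {1..K}) \<longrightarrow>
      integrable M (\<lambda>\<omega>. \<Prod>j<length rs. \<Sum>k\<in>I (rs ! j). X (lab j) k \<omega>) \<and>
      expectation (\<lambda>\<omega>. \<bar>\<Prod>j<length rs. \<Sum>k\<in>I (rs ! j). X (lab j) k \<omega>\<bar>) \<le> C * real K ^ length rs"
    "\<forall>lab I K. (\<forall>j<length rs. lab j \<in> Zplus 1 \<union> Zplus 2) \<longrightarrow> (\<forall>r. I r \<subseteq> {1..K}) \<longrightarrow>
      (\<forall>r\<in>{1..p}. \<forall>r'\<in>{1..p}. r \<noteq> r' \<longrightarrow> I r \<inter> I r' = {}) \<longrightarrow>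
      \<bar>expectation (\<lambda>\<omega>. \<Prod>j<length rs. \<Sum>k\<in>I (rs ! j). X (lab j) k \<omega>)
        - (if paired (length rs) lab \<and> index_compatible rs lab
           then \<Prod>r=1..p. real (card (I r)) ^ half_count rs r else 0)\<bar>
      \<le> (if card (lab ` {..<length rs}) \<le> (length rs - 1) div 2 then C * real K ^ (length rs div 2) else 0)"
proof -
  let ?l = "length rs"
  let ?q = "?l div 2"
  have l: "0 < ?l" using rs by simp
  obtain C where C0: "0 \<le> C" "\<forall>a \<kappa>. (\<forall>j<?l. (a j, \<kappa> j) \<in> input_index) \<longrightarrow>
       integrable M (\<lambda>\<omega>. \<Prod>j<?l. X (a j) (\<kappa> j) \<omega>) \<and>
       expectation (\<lambda>\<omega>. \<bar>\<Prod>j<?l. X (a j) (\<kappa> j) \<omega>\<bar>) \<le> C"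
    by (rule input_product_bound[OF l])
  have C: "0 \<le> C" "\<And>a \<kappa>. (\<And>j. j < ?l \<Longrightarrow> (a j, \<kappa> j) \<in> input_index) \<Longrightarrow>
       integrable M (\<lambda>\<omega>. \<Prod>j<?l. X (a j) (\<kappa> j) \<omega>) \<and>
       expectation (\<lambda>\<omega>. \<bar>\<Prod>j<?l. X (a j) (\<kappa> j) \<omega>\<bar>) \<le> C"
    using C0 by blast+
  \<comment> \<open>One constant for both estimates: \<open>C\<close> is the bound for a single
    product, and \<open>C * ?q ^ ?l\<close> accounts for the choice of index tuples with at most
    \<open>?q\<close> values.\<close>
  define D where "D = C * (1 + real ?q ^ ?l)"
  have fin: "finite (I r)" if "\<And>r. I r \<subseteq> {1..K::nat}" for I and r :: nat and K
    using finite_subset[OF that] by simp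
  have expand: "(\<Prod>j<?l. \<Sum>k\<in>I (rs ! j). X (lab j) k \<omega>)
      = (\<Sum>\<kappa>\<in>(\<Pi>\<^sub>E j\<in>{..<?l}. I (rs ! j)). \<Prod>j<?l. X (lab j) (\<kappa> j) \<omega>)"
    if "\<And>r. I r \<subseteq> {1..K}" for I lab \<omega> K
    by (rule prod_sum_PiE) (use fin[OF that] in auto)
  have idx: "(lab j, \<kappa> j) \<in> input_index"
    if "\<And>j. j < ?l \<Longrightarrow> lab j \<in> Zplus 1 \<union> Zplus 2" "\<And>r. I r \<subseteq> {1..K}"
      "\<kappa> \<in> (\<Pi>\<^sub>E j\<in>{..<?l}. I (rs ! j))" "j < ?l" for lab \<kappa> I K j
  proof -
    have "\<kappa> j \<in> I (rs ! j)" using PiE_mem[OF that(3), of j] that(4) by simp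
    then have "1 \<le> \<kappa> j" using that(2)[of "rs ! j"] by auto
    then show ?thesis using that(1)[OF that(4)] by (simp add: input_index_def)
  qed
  have one: "integrable M (\<lambda>\<omega>. \<Prod>j<?l. \<Sum>k\<in>I (rs ! j). X (lab j) k \<omega>) \<and>
      expectation (\<lambda>\<omega>. \<bar>\<Prod>j<?l. \<Sum>k\<in>I (rs ! j). X (lab j) k \<omega>\<bar>) \<le> D * real K ^ ?l"
    if lab: "\<And>j. j < ?l \<Longrightarrow> lab j \<in> Zplus 1 \<union> Zplus 2" and I: "\<And>r. I r \<subseteq> {1..K}" for lab I K
  proof -
    let ?E = "\<Pi>\<^sub>E j\<in>{..<?l}. I (rs ! j)"
    have ex: "(\<Prod>j<?l. \<Sum>k\<in>I (rs ! j). X (lab j) k \<omega>) = (\<Sum>\<kappa>\<in>?E. \<Prod>j<?l. X (lab j) (\<kappa> j) \<omega>)" for \<omega>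
      by (rule expand[of I K lab]) (rule I)
    have prodC: "integrable M (\<lambda>\<omega>. \<Prod>j<?l. X (lab j) (\<kappa> j) \<omega>) \<and>
        expectation (\<lambda>\<omega>. \<bar>\<Prod>j<?l. X (lab j) (\<kappa> j) \<omega>\<bar>) \<le> C" if "\<kappa> \<in> ?E" for \<kappa>
    proof (rule C(2))
      show "(lab j, \<kappa> j) \<in> input_index" if "j < ?l" for j
        by (rule idx[of lab I K \<kappa> j, OF lab I \<open>\<kappa> \<in> ?E\<close> that])
    qed
    have c: "integrable M (\<lambda>\<omega>. \<Prod>j<?l. X (lab j) (\<kappa> j) \<omega>)"
      "expectation (\<lambda>\<omega>. \<bar>\<Prod>j<?l. X (lab j) (\<kappa> j) \<omega>\<bar>) \<le> C" if "\<kappa> \<in> ?E" for \<kappa>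
      using prodC[OF that] by auto
    have i: "integrable M (\<lambda>\<omega>. \<Prod>j<?l. \<Sum>k\<in>I (rs ! j). X (lab j) k \<omega>)"
      unfolding ex by (intro Bochner_Integration.integrable_sum c(1))
    have "expectation (\<lambda>\<omega>. \<bar>\<Prod>j<?l. \<Sum>k\<in>I (rs ! j). X (lab j) k \<omega>\<bar>)
        \<le> expectation (\<lambda>\<omega>. \<Sum>\<kappa>\<in>?E. \<bar>\<Prod>j<?l. X (lab j) (\<kappa> j) \<omega>\<bar>)"
    proof (rule integral_mono)
      show "integrable M (\<lambda>\<omega>. \<Sum>\<kappa>\<in>?E. \<bar>\<Prod>j<?l. X (lab j) (\<kappa> j) \<omega>\<bar>)"
        by (intro Bochner_Integration.integrable_sum integrable_abs c(1))
      show "\<bar>\<Prod>j<?l. \<Sum>k\<in>I (rs ! j). X (lab j) k \<omega>\<bar> \<le> (\<Sum>\<kappa>\<in>?E. \<bar>\<Prod>j<?l. X (lab j) (\<kappa> j) \<omega>\<bar>)" for \<omega>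
        unfolding ex by (rule sum_abs)
    qed (intro integrable_abs i)
    also have "\<dots> = (\<Sum>\<kappa>\<in>?E. expectation (\<lambda>\<omega>. \<bar>\<Prod>j<?l. X (lab j) (\<kappa> j) \<omega>\<bar>))"
      by (intro Bochner_Integration.integral_sum integrable_abs c(1))
    also have "\<dots> \<le> (\<Sum>\<kappa>\<in>?E. C)" by (rule sum_mono) (rule c(2))
    also have "\<dots> = real (card ?E) * C" by simp
    also have "\<dots> \<le> real K ^ ?l * D"
    proof (rule mult_mono)
      have "card ?E \<le> (\<Prod>j<?l. K)"
        unfolding card_PiE[OF finite_lessThan]
      proof (rule prod_mono)
        fix j show "0 \<le> card (I (rs ! j)) \<and> card (I (rs ! j)) \<le> K"
          using card_mono[OF _ I, of "rs ! j"] by simp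
      qed
      then have "real (card ?E) \<le> real (\<Prod>j<?l. K)" by (rule of_nat_mono)
      then show "real (card ?E) \<le> real K ^ ?l" by simp
      show "C \<le> D" using C(1) by (simp add: D_def algebra_simps)
    qed (use C(1) in auto)
    finally show ?thesis using i by (simp add: mult.commute)
  qed
  have two: "\<bar>expectation (\<lambda>\<omega>. \<Prod>j<?l. \<Sum>k\<in>I (rs ! j). X (lab j) k \<omega>)
        - (if paired ?l lab \<and> index_compatible rs lab then \<Prod>r=1..p. real (card (I r)) ^ half_count rs r else 0)\<bar>
      \<le> (if card (lab ` {..<?l}) \<le> (?l - 1) div 2 then D * real K ^ ?q else 0)"
    if lab: "\<And>j. j < ?l \<Longrightarrow> lab j \<in> Zplus 1 \<union> Zplus 2" and I: "\<And>r. I r \<subseteq> {1..K}"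
      and disj: "\<And>r r'. r \<in> {1..p} \<Longrightarrow> r' \<in> {1..p} \<Longrightarrow> r \<noteq> r' \<Longrightarrow> I r \<inter> I r' = {}" for lab I K
  proof -
    let ?E = "\<Pi>\<^sub>E j\<in>{..<?l}. I (rs ! j)"
    have ex: "(\<Prod>j<?l. \<Sum>k\<in>I (rs ! j). X (lab j) k \<omega>) = (\<Sum>\<kappa>\<in>?E. \<Prod>j<?l. X (lab j) (\<kappa> j) \<omega>)" for \<omega>
      by (rule expand[of I K lab]) (rule I)
    have prodC: "integrable M (\<lambda>\<omega>. \<Prod>j<?l. X (lab j) (\<kappa> j) \<omega>) \<and>
        expectation (\<lambda>\<omega>. \<bar>\<Prod>j<?l. X (lab j) (\<kappa> j) \<omega>\<bar>) \<le> C" if "\<kappa> \<in> ?E" for \<kappa>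
    proof (rule C(2))
      show "(lab j, \<kappa> j) \<in> input_index" if "j < ?l" for j
        by (rule idx[of lab I K \<kappa> j, OF lab I \<open>\<kappa> \<in> ?E\<close> that])
    qed
    define e where "e \<kappa> = expectation (\<lambda>\<omega>. \<Prod>j<?l. X (lab j) (\<kappa> j) \<omega>)" for \<kappa>
    define v where "v \<kappa> j = (lab j, \<kappa> j)" for \<kappa> :: "nat \<Rightarrow> nat" and j
    have finE: "finite ?E" using fin[OF I] by (intro finite_PiE) auto
    have F: "expectation (\<lambda>\<omega>. \<Prod>j<?l. \<Sum>k\<in>I (rs ! j). X (lab j) k \<omega>) = (\<Sum>\<kappa>\<in>?E. e \<kappa>)"
      unfolding ex e_def
      using prodC by (intro Bochner_Integration.integral_sum) auto
    have vi: "v \<kappa> j \<in> input_index" if "\<kappa> \<in> ?E" "j < ?l" for \<kappa> j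
      unfolding v_def by (rule idx[of lab I K \<kappa> j, OF lab I that])
    have e0: "e \<kappa> = 0" if "\<kappa> \<in> ?E" "j < ?l" "card {i. i < ?l \<and> v \<kappa> i = v \<kappa> j} = 1" for \<kappa> j
      using input_product_expectation_eq_0[of ?l "v \<kappa>", OF vi[OF that(1)] that(2,3)] by (simp add: e_def v_def)
    have e1: "e \<kappa> = 1" if "\<kappa> \<in> ?E" "paired ?l (v \<kappa>)" for \<kappa>
      using input_product_expectation_eq_1[of ?l "v \<kappa>", OF vi[OF that(1)] that(2)] by (simp add: e_def v_def)
    have sub: "{i. i < ?l \<and> v \<kappa> i = v \<kappa> j} \<subseteq> {i. i < ?l \<and> lab i = lab j}" for \<kappa> j
      by (auto simp: v_def)
    have rhs: "0 \<le> (if card (lab ` {..<?l}) \<le> (?l - 1) div 2 then D * real K ^ ?q else 0)"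
      using C(1) by (simp add: D_def)
    \<comment> \<open>A unique label leaves a centred variable alone in every product. A pairing is
      evaluated exactly. In the remaining case every label recurs but the classes are not all pairs,
      so there are at most \<open>(?l - 1) div 2\<close> labels.\<close>
    consider (single) j where "j < ?l" "card {i. i < ?l \<and> lab i = lab j} = 1"
      | (pair) "paired ?l lab" | (few) "\<And>j. j < ?l \<Longrightarrow> card {i. i < ?l \<and> lab i = lab j} \<noteq> 1" "\<not> paired ?l lab"
      by blast
    then show ?thesis
    proof cases
      case single
      have "e \<kappa> = 0" if "\<kappa> \<in> ?E" for \<kappa>
      proof (rule e0[OF that single(1)])
        have "card {i. i < ?l \<and> v \<kappa> i = v \<kappa> j} \<le> 1"
          unfolding single(2)[symmetric] by (rule card_mono[OF _ sub]) simp
        moreover have "card {i. i < ?l \<and> v \<kappa> i = v \<kappa> j} \<noteq> 0" using single(1) by auto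
        ultimately show "card {i. i < ?l \<and> v \<kappa> i = v \<kappa> j} = 1" by linarith
      qed
      moreover have "\<not> paired ?l lab" using single by (auto simp: paired_def)
      ultimately show ?thesis using rhs unfolding F by simp
    next
      case pair
      define S where "S = {\<kappa> \<in> ?E. \<forall>i<?l. \<forall>j<?l. lab i = lab j \<longrightarrow> \<kappa> i = \<kappa> j}"
      have eS: "e \<kappa> = (if \<kappa> \<in> S then 1 else 0)" if k: "\<kappa> \<in> ?E" for \<kappa>
      proof (cases "\<kappa> \<in> S")
        case True
        then have const: "\<forall>i<?l. \<forall>j<?l. lab i = lab j \<longrightarrow> \<kappa> i = \<kappa> j"
          unfolding S_def mem_Collect_eq by (rule conjunct2)
        have "paired ?l (v \<kappa>)"
          unfolding paired_def
        proof (intro allI impI)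
          fix j assume j: "j < ?l"
          have "{i. i < ?l \<and> v \<kappa> i = v \<kappa> j} = {i. i < ?l \<and> lab i = lab j}"
            using const j unfolding v_def prod.inject by blast
          then show "card {i. i < ?l \<and> v \<kappa> i = v \<kappa> j} = 2" using pair j by (simp add: paired_def)
        qed
        then show ?thesis using e1[OF k] True by simp
      next
        case False
        \<comment> \<open>The two positions of one label carry different walk indices, so the
          variable at \<open>j\<close> occurs only once and its mean 0 kills the product.\<close>
        then obtain i j where ij: "i < ?l" "j < ?l" "lab i = lab j" "\<kappa> i \<noteq> \<kappa> j"
          using k unfolding S_def by blast
        have "{a. a < ?l \<and> v \<kappa> a = v \<kappa> j} \<subset> {a. a < ?l \<and> lab a = lab j}"
          using sub[of \<kappa> j] ij by (auto simp: v_def)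
        then have "card {a. a < ?l \<and> v \<kappa> a = v \<kappa> j} < card {a. a < ?l \<and> lab a = lab j}"
          by (intro psubset_card_mono) auto
        also have "\<dots> = 2" using pair ij(2) unfolding paired_def by blast
        finally have "card {a. a < ?l \<and> v \<kappa> a = v \<kappa> j} < 2" .
        moreover have "card {a. a < ?l \<and> v \<kappa> a = v \<kappa> j} \<noteq> 0" using ij(2) by auto
        ultimately have "e \<kappa> = 0" by (intro e0[OF k ij(2)]) linarith
        then show ?thesis using False by simp
      qed
      have SE: "S \<subseteq> ?E" by (auto simp: S_def)
      have FS: "(\<Sum>\<kappa>\<in>?E. e \<kappa>) = real (card S)"
      proof -
        have "(\<Sum>\<kappa>\<in>?E. e \<kappa>) = (\<Sum>\<kappa>\<in>?E. if \<kappa> \<in> S then 1 else 0)"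
          by (rule sum.cong[OF refl eS])
        also have "\<dots> = (\<Sum>\<kappa>\<in>?E \<inter> S. 1)" using finE by (simp add: sum.If_cases)
        also have "?E \<inter> S = S" using SE by blast
        finally show ?thesis by simp
      qed
      have "real (card S) = (if index_compatible rs lab then \<Prod>r=1..p. real (card (I r)) ^ half_count rs r else 0)"
      proof (cases "index_compatible rs lab")
        case True
        have finI: "finite (I r)" for r by (rule finite_subset[OF I]) simp
        have "card S = (\<Prod>r\<in>{1..p}. card (I r) ^ half_count rs r)"
          unfolding S_def
        proof (rule card_class_functions[OF pair _ finI rs(2)])
          fix i j assume "i < ?l" "j < ?l" "lab i = lab j"
          then show "rs ! i = rs ! j" using True unfolding index_compatible_def by blast
        qed simp
        then show ?thesis using True by simp
      next
        case False
        then obtain i j where ij: "i < ?l" "j < ?l" "lab i = lab j" "rs ! i \<noteq> rs ! j"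
          unfolding index_compatible_def by blast
        \<comment> \<open>Two paired positions with different indices would need a common walk
          index, but their blocks are disjoint.\<close>
        have "S = {}"
        proof (rule ccontr)
          assume "S \<noteq> {}"
          then obtain \<kappa> where k: "\<kappa> \<in> S" by blast
          then have "\<kappa> i = \<kappa> j" using ij unfolding S_def by blast
          moreover have "\<kappa> i \<in> I (rs ! i)" "\<kappa> j \<in> I (rs ! j)"
            using PiE_mem[OF subsetD[OF SE k], of i] PiE_mem[OF subsetD[OF SE k], of j] ij(1,2) by simp_all
          moreover have "rs ! i \<in> {1..p}" "rs ! j \<in> {1..p}"
            using rs(2) nth_mem[OF ij(1)] nth_mem[OF ij(2)] by blast+
          ultimately show False using disj[of "rs ! i" "rs ! j"] ij(4) by (metis IntI empty_iff)
        qed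
        then show ?thesis using False by simp
      qed
      then show ?thesis using rhs pair unfolding F FS by simp
    next
      case few
      have fewl: "card (lab ` {..<?l}) \<le> (?l - 1) div 2" by (rule card_image_le_half(2)[OF few])
      let ?S = "{\<kappa> \<in> {..<?l} \<rightarrow>\<^sub>E {1..K}. card (\<kappa> ` {..<?l}) \<le> ?q}"
      have finS: "finite ?S"
        by (rule finite_subset[of _ "{..<?l} \<rightarrow>\<^sub>E {1..K}"]) (auto intro!: finite_PiE)
      have eC: "\<bar>e \<kappa>\<bar> \<le> C" if "\<kappa> \<in> ?E" for \<kappa>
        unfolding e_def
        by (rule order_trans[OF integral_abs_bound conjunct2[OF prodC[OF that]]])
      \<comment> \<open>In a nonvanishing product each pair of label and walk index occurs at least
        twice, so there are at most \<open>?q\<close> such pairs and hence at most \<open>?q\<close>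
        walk indices.\<close>
      have out: "e \<kappa> = 0" if k: "\<kappa> \<in> ?E" and n: "\<kappa> \<notin> ?S" for \<kappa>
      proof -
        have "\<kappa> \<in> {..<?l} \<rightarrow>\<^sub>E {1..K}" 
          using k PiE_mono[of "{..<?l}" "\<lambda>j. I (rs ! j)" "\<lambda>_. {1..K}", OF I] by (rule rev_subsetD)
        then have big: "?q < card (\<kappa> ` {..<?l})" using n by simp
        have "\<kappa> ` {..<?l} = snd ` v \<kappa> ` {..<?l}" by (simp add: image_image v_def)
        then have "card (\<kappa> ` {..<?l}) \<le> card (v \<kappa> ` {..<?l})" by (simp add: card_image_le)
        then have "\<not> card (v \<kappa> ` {..<?l}) \<le> ?q" using big by linarith
        then obtain j where "j < ?l" "card {i. i < ?l \<and> v \<kappa> i = v \<kappa> j} = 1"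
          using card_image_le_half(1)[of ?l "v \<kappa>"] by blast
        then show ?thesis by (rule e0[OF k])
      qed
      have "\<bar>\<Sum>\<kappa>\<in>?E. e \<kappa>\<bar> = \<bar>\<Sum>\<kappa>\<in>?E \<inter> ?S. e \<kappa>\<bar>"
        by (rule arg_cong[where f=abs], rule sum.mono_neutral_right) (use finE out in auto)
      also have "\<dots> \<le> (\<Sum>\<kappa>\<in>?E \<inter> ?S. \<bar>e \<kappa>\<bar>)" by (rule sum_abs)
      also have "\<dots> \<le> (\<Sum>\<kappa>\<in>?E \<inter> ?S. C)" by (rule sum_mono) (use eC in blast)
      also have "\<dots> = real (card (?E \<inter> ?S)) * C" by simp
      also have "\<dots> \<le> real (?q ^ ?l * K ^ ?q) * C"
      proof (rule mult_right_mono[OF _ C(1)])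
        have "card (?E \<inter> ?S) \<le> card ?S" by (rule card_mono[OF finS]) blast
        also have "\<dots> \<le> ?q ^ ?l * card {1..K} ^ ?q" by (rule card_PiE_small_image[OF _ l]) simp
        finally show "real (card (?E \<inter> ?S)) \<le> real (?q ^ ?l * K ^ ?q)" by (intro of_nat_mono) simp
      qed
      also have "\<dots> \<le> D * real K ^ ?q" using C(1) by (simp add: D_def algebra_simps)
      finally show ?thesis using few(2) fewl unfolding F by simp
    qed
  qed
  show thesis
  proof (rule that[of D])
    show "0 \<le> D" using C(1) by (simp add: D_def)
  qed (intro allI impI one two; blast)+
qed

end
end

section \<open>The expected trace\<close>

lemma A_incr_carrier: "A_incr \<alpha> Ld X N\<alpha> t n \<omega> r \<in> carrier_mat n n"
  by (auto simp: A_incr_def A_mat_def)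

lemma A_incr_entry:
  assumes "i \<in> {1..n}" "j \<in> {1..n}"
  shows "A_incr \<alpha> Ld X N\<alpha> t n \<omega> r $$ (i - 1, j - 1) = real n powr (- (1 + \<alpha>) / 2) *
    (stopped_walk X N\<alpha> (Ld n i j) n (t r) \<omega> - stopped_walk X N\<alpha> (Ld n i j) n (t (r - 1)) \<omega>)"
proof -
  have ij: "i - 1 < n" "j - 1 < n" "i - 1 + 1 = i" "j - 1 + 1 = j" using assms by auto
  have "real n powr (- (1 + \<alpha>) / 2) = real n powr (- 1 / 2) * real n powr (- \<alpha> / 2)"
    by (simp add: powr_add[symmetric] field_simps)
  then show ?thesis
    using ij by (simp add: A_incr_def A_mat_def right_diff_distrib mult.assoc)
qed

lemma mat_trace_A_incr:
  assumes "rs \<noteq> []"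
  shows "mat_trace (monomial_mat n (A_incr \<alpha> Ld X N\<alpha> t n \<omega>) rs)
    = real n powr (- (1 + \<alpha>) / 2 * real (length rs)) *
      (\<Sum>\<pi>\<in>circuits n (length rs). \<Prod>j<length rs.
        stopped_walk X N\<alpha> (link_label Ld n \<pi> j) n (t (rs ! j)) \<omega>
        - stopped_walk X N\<alpha> (link_label Ld n \<pi> j) n (t (rs ! j - 1)) \<omega>)"
proof -
  have "(\<Prod>j<length rs. A_incr \<alpha> Ld X N\<alpha> t n \<omega> (rs ! j) $$ (\<pi> j - 1, \<pi> (Suc j) - 1))
      = (real n powr (- (1 + \<alpha>) / 2)) ^ length rs * (\<Prod>j<length rs.
        stopped_walk X N\<alpha> (link_label Ld n \<pi> j) n (t (rs ! j)) \<omega>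
        - stopped_walk X N\<alpha> (link_label Ld n \<pi> j) n (t (rs ! j - 1)) \<omega>)"
    if "\<pi> \<in> circuits n (length rs)" for \<pi>
  proof -
    have p: "\<pi> \<in> {0..length rs} \<rightarrow>\<^sub>E {1..n}" using that by (simp add: circuits_def)
    have "A_incr \<alpha> Ld X N\<alpha> t n \<omega> (rs ! j) $$ (\<pi> j - 1, \<pi> (Suc j) - 1) = real n powr (- (1 + \<alpha>) / 2) *
        (stopped_walk X N\<alpha> (link_label Ld n \<pi> j) n (t (rs ! j)) \<omega>
        - stopped_walk X N\<alpha> (link_label Ld n \<pi> j) n (t (rs ! j - 1)) \<omega>)" if "j < length rs" for j
      unfolding link_label_def using that by (intro A_incr_entry PiE_mem[OF p]) auto
    then show ?thesis by (simp add: prod.distrib)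
  qed
  moreover have "(real n powr (- (1 + \<alpha>) / 2)) ^ length rs = real n powr (- (1 + \<alpha>) / 2 * real (length rs))"
    using assms by (cases "n = 0") (simp_all add: powr_realpow[symmetric] powr_powr power_0_left)
  ultimately show ?thesis
    unfolding mat_trace_monomial_mat[OF A_incr_carrier] by (simp add: sum_distrib_left)
qed

lemma sum_diff_initial_segments:
  fixes f :: "nat \<Rightarrow> real"
  assumes "a \<le> b" shows "(\<Sum>k=1..b. f k) - (\<Sum>k=1..a. f k) = (\<Sum>k\<in>{a<..b}. f k)"
proof -
  have "{1..b} = {1..a} \<union> {a<..b}" using assms by auto
  then have "(\<Sum>k=1..b. f k) = (\<Sum>k=1..a. f k) + (\<Sum>k\<in>{a<..b}. f k)"
    by (simp only:, intro sum.union_disjoint) auto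
  then show ?thesis by simp
qed

context prob_space
begin

context
  fixes N :: "real \<Rightarrow> 'a \<Rightarrow> nat" and L :: "real \<Rightarrow> 'a \<Rightarrow> real" and \<alpha> :: real
    and X :: "int list \<Rightarrow> nat \<Rightarrow> 'a \<Rightarrow> real" and Ld :: "nat \<Rightarrow> nat \<Rightarrow> nat \<Rightarrow> int list" and d p :: nat
    and t :: "nat \<Rightarrow> real" and rs :: "nat list"
  assumes \<alpha>: "0 < \<alpha>" and L: "inverse_stable_subordinator \<alpha> L" and N: "unit_poisson_process N"
    and indL: "indep_families {0..} L {0..} (\<lambda>s \<omega>. real (N s \<omega>))"
    and d: "d \<in> {1, 2}" and Ld: "link_function d Ld" and B: "property_B d Ld"
    and X: "assumption_I X"
    and indX: "indep_families input_index (\<lambda>(r, k). X r k) {0..} (\<lambda>s \<omega>. real (fractional_poisson N L s \<omega>))"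
    and t0: "0 \<le> t 0" and t: "\<And>r. r < p \<Longrightarrow> t r < t (Suc r)"
    and rs: "rs \<noteq> []" "set rs \<subseteq> {1..p}"
begin

private abbreviation (input) "N\<alpha> \<equiv> fractional_poisson N L"
private abbreviation (input) "l \<equiv> length rs"
private abbreviation (input) "tr \<equiv> \<lambda>n \<omega>. mat_trace (monomial_mat n (A_incr \<alpha> Ld X N\<alpha> t n \<omega>) rs)"
private abbreviation (input) "gen_X \<equiv> gen_measure input_index (\<lambda>(r, k). X r k)"
private abbreviation (input) "gen_N \<equiv> gen_measure {0..} (\<lambda>s \<omega>. real (N\<alpha> s \<omega>))"

private lemma indG: "indep_set (sets gen_X) (sets gen_N)"
  using indX by (simp add: indep_families_def sets_gen_measure)

private lemma N_gen: assumes "0 \<le> s" shows "N\<alpha> s \<in> measurable gen_N (count_space UNIV)"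
proof -
  have "(\<lambda>\<omega>. real (N\<alpha> s \<omega>)) \<in> borel_measurable gen_N"
    using measurable_gen_measure[of s "{0..}" "\<lambda>s \<omega>. real (N\<alpha> s \<omega>)"] assms by simp
  then have "(\<lambda>\<omega>. nat \<lfloor>real (N\<alpha> s \<omega>)\<rfloor>) \<in> measurable gen_N (count_space UNIV)" by measurable
  then show ?thesis by simp
qed

private lemma N_meas: "0 \<le> s \<Longrightarrow> N\<alpha> s \<in> measurable M (count_space UNIV)"
  by (rule indep_set_measurable(2)[OF indG _ _ N_gen]) simp_all

private lemma Nr_meas: "0 \<le> s \<Longrightarrow> (\<lambda>\<omega>. real (N\<alpha> s \<omega>)) \<in> borel_measurable M"
  by (rule measurable_compose[OF N_meas]) simp_all

private lemma X_gen: "(r, k) \<in> input_index \<Longrightarrow> X r k \<in> borel_measurable gen_X"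
  using measurable_gen_measure[of "(r, k)" input_index "\<lambda>(r, k). X r k"] by simp

private lemma time_mono: "r < p \<Longrightarrow> t r \<le> t (Suc r)" using t by (simp add: less_imp_le)

private lemma time_nonneg: "r \<le> p \<Longrightarrow> 0 \<le> t r"
proof (induction r)
  case (Suc r)
  then show ?case using t[of r] by simp
qed (use t0 in simp)

private lemma rs_range: "j < l \<Longrightarrow> 1 \<le> rs ! j \<and> rs ! j \<le> p"
  using subsetD[OF rs(2) nth_mem[of j rs]] by simp

private lemma label_index:
  assumes "\<pi> \<in> circuits n l" "j < l" shows "link_label Ld n \<pi> j \<in> Zplus 1 \<union> Zplus 2"
  using link_label_in_Zplus[OF Ld, of \<pi> l n j] assms d by (auto simp: circuits_def)

private lemma tr_meas: "tr n \<in> borel_measurable M"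
proof -
  have sw: "stopped_walk X N\<alpha> r n s \<in> borel_measurable M"
    if r: "r \<in> Zplus 1 \<union> Zplus 2" and s: "0 \<le> s" for r s
  proof -
    have "(\<lambda>\<omega>. \<Sum>k=1..N\<alpha> (real n * s) \<omega>. X r k \<omega>) \<in> borel_measurable M"
    proof (rule measurable_compose_countable'[where I=UNIV and f="\<lambda>m \<omega>. \<Sum>k=1..m. X r k \<omega>"])
      show "(\<lambda>\<omega>. \<Sum>k=1..m. X r k \<omega>) \<in> borel_measurable M" for m
        by (intro borel_measurable_sum input_measurable[OF X]) (use r in \<open>simp add: input_index_def\<close>)
    qed (use N_meas s in simp_all)
    then show ?thesis by (simp add: stopped_walk_def[abs_def])
  qed
  show ?thesis
    unfolding mat_trace_A_incr[OF rs(1)]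
    by (intro borel_measurable_times borel_measurable_const borel_measurable_sum borel_measurable_prod
        borel_measurable_diff sw label_index time_nonneg) (auto dest: rs_range)
qed

section \<open>The trace with frozen walk times\<close>

private definition ordered :: "nat list \<Rightarrow> bool" where
  "ordered v \<longleftrightarrow> (\<forall>r<p. v ! r \<le> v ! Suc r)"

text \<open>The walk indices that make up the \<open>r\<close>-th increment. The block is empty
  outside \<open>{1..p}\<close>, so that all blocks lie in \<open>{1..v ! p}\<close> as
  \<open>block_sum_product_expectation\<close> asks.\<close>

private definition block :: "nat list \<Rightarrow> nat \<Rightarrow> nat set" where
  "block v r = (if r \<in> {1..p} then {v ! (r - 1)<..v ! r} else {})"

private lemma ordered_le:
  assumes v: "ordered v" and ab: "a \<le> b" "b \<le> p" shows "v ! a \<le> v ! b"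
  using ab(1)
proof (induction rule: inc_induct)
  case (step n)
  have "v ! n \<le> v ! Suc n" using v step(2) ab(2) by (simp add: ordered_def)
  then show ?case using step.IH by simp
qed simp

private lemma block_sub: "ordered v \<Longrightarrow> block v r \<subseteq> {1..v ! p}"
  using ordered_le[of v r p] by (auto simp: block_def)

private lemma block_disj:
  assumes v: "ordered v" and "r \<in> {1..p}" "r' \<in> {1..p}" "r \<noteq> r'" shows "block v r \<inter> block v r' = {}"
proof -
  have "block v a \<inter> block v b = {}" if "a < b" "a \<in> {1..p}" "b \<in> {1..p}" for a b
  proof -
    have "v ! a \<le> v ! (b - 1)" by (rule ordered_le[OF v]) (use that in auto)
    then show ?thesis using that by (auto simp: block_def)
  qed
  then show ?thesis using assms(2-4) by (metis Int_commute linorder_neqE_nat)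
qed

text \<open>The trace without its power of \<open>n\<close>, at given values \<open>v\<close> of the
  counting process. Unordered lists occur with probability 0; the value 0 there keeps integrability
  and the bounds valid for every \<open>v\<close>.\<close>

private definition block_trace :: "nat \<Rightarrow> nat list \<Rightarrow> 'a \<Rightarrow> real" where
  "block_trace n v \<omega> = (if ordered v then \<Sum>\<pi>\<in>circuits n l. \<Prod>j<l. \<Sum>k\<in>block v (rs ! j). X (link_label Ld n \<pi> j) k \<omega> else 0)"

private definition walk_times :: "nat \<Rightarrow> 'a \<Rightarrow> nat list" where
  "walk_times n \<omega> = map (\<lambda>r. N\<alpha> (real n * t r) \<omega>) [0..<Suc p]"

private lemma walk_times_nth: "r \<le> p \<Longrightarrow> walk_times n \<omega> ! r = N\<alpha> (real n * t r) \<omega>"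
  unfolding walk_times_def by (subst nth_map) (auto simp del: upt_Suc)

private lemma N_mono: "AE \<omega> in M. \<forall>s t. 0 \<le> s \<longrightarrow> s \<le> t \<longrightarrow> N\<alpha> s \<omega> \<le> N\<alpha> t \<omega>"
  by (rule fractional_poisson_mono[OF \<alpha> L N indL Nr_meas])

private lemma walk_times_ordered: "AE \<omega> in M. \<forall>n. ordered (walk_times n \<omega>)"
  using N_mono
proof eventually_elim
  case (elim \<omega>)
  show ?case
    unfolding ordered_def
  proof (intro allI impI)
    fix n r assume r: "r < p"
    have "N\<alpha> (real n * t r) \<omega> \<le> N\<alpha> (real n * t (Suc r)) \<omega>"
      using elim[rule_format, of "real n * t r" "real n * t (Suc r)"] time_nonneg[of r] time_mono[OF r] r
      by (simp add: mult_left_mono)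
    then show "walk_times n \<omega> ! r \<le> walk_times n \<omega> ! Suc r" using r by (simp add: walk_times_nth)
  qed
qed

private lemma tr_eq: "AE \<omega> in M. \<forall>n. tr n \<omega> = real n powr (- (1 + \<alpha>) / 2 * real l) * block_trace n (walk_times n \<omega>) \<omega>"
  using walk_times_ordered
proof eventually_elim
  case (elim \<omega>)
  have "stopped_walk X N\<alpha> r n (t (rs ! j)) \<omega> - stopped_walk X N\<alpha> r n (t (rs ! j - 1)) \<omega>
      = (\<Sum>k\<in>block (walk_times n \<omega>) (rs ! j). X r k \<omega>)" if j: "j < l" for r n j
  proof -
    note rj = rs_range[OF j]
    have le: "walk_times n \<omega> ! (rs ! j - 1) \<le> walk_times n \<omega> ! (rs ! j)"
      by (rule ordered_le) (use elim rj in auto)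
    have "walk_times n \<omega> ! (rs ! j - 1) = N\<alpha> (real n * t (rs ! j - 1)) \<omega>" "walk_times n \<omega> ! (rs ! j) = N\<alpha> (real n * t (rs ! j)) \<omega>"
      using rj walk_times_nth[of "rs ! j - 1" n \<omega>] walk_times_nth[of "rs ! j" n \<omega>] by linarith+
    then show ?thesis
      using sum_diff_initial_segments[OF le, of "\<lambda>k. X r k \<omega>"] rj
      by (simp add: stopped_walk_def block_def)
  qed
  then show ?case using elim by (simp add: mat_trace_A_incr[OF rs(1)] block_trace_def)
qed

private lemma walk_times_gen: "walk_times n \<in> measurable gen_N (count_space UNIV)"
  unfolding walk_times_def by (rule measurable_list_count_space, rule N_gen) (simp add: time_nonneg)

private lemma walk_times_meas: "walk_times n \<in> measurable M (count_space UNIV)"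
  by (rule indep_set_measurable(2)[OF indG _ _ walk_times_gen]) simp_all

private lemma block_trace_gen: "block_trace n v \<in> borel_measurable gen_X"
proof (cases "ordered v")
  case True
  have "(\<lambda>\<omega>. \<Sum>\<pi>\<in>circuits n l. \<Prod>j<l. \<Sum>k\<in>block v (rs ! j). X (link_label Ld n \<pi> j) k \<omega>) \<in> borel_measurable gen_X"
  proof (intro borel_measurable_sum borel_measurable_prod X_gen)
    fix \<pi> j k assume a: "\<pi> \<in> circuits n l" "j \<in> {..<l}" "k \<in> block v (rs ! j)"
    then have "1 \<le> k" using block_sub[OF True, of "rs ! j"] by auto
    then show "(link_label Ld n \<pi> j, k) \<in> input_index"
      using label_index[OF a(1), of j] a(2) by (simp add: input_index_def)
  qed
  then show ?thesis using True by (simp add: block_trace_def[abs_def])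
qed (simp add: block_trace_def[abs_def])

private definition increment_prod :: "nat list \<Rightarrow> real" where
  "increment_prod v = (\<Prod>r<p. (real (v ! Suc r) - real (v ! r)) ^ half_count rs (Suc r))"

private lemma expectation_block_trace:
  obtains C where "0 \<le> C"
    "\<forall>n v. integrable M (block_trace n v) \<and> expectation (\<lambda>\<omega>. \<bar>block_trace n v \<omega>\<bar>) \<le> C * real (card (circuits n l)) * real (v ! p) ^ l"
    "\<forall>n v. ordered v \<longrightarrow> \<bar>expectation (block_trace n v) - real (card (good_circuits Ld n rs)) * increment_prod v\<bar>
      \<le> C * real n ^ (1 + (l - 1) div 2) * real (v ! p) ^ (l div 2)"
proof -
  obtain C where C: "0 \<le> C"
    "\<forall>lab I K. (\<forall>j<l. lab j \<in> Zplus 1 \<union> Zplus 2) \<longrightarrow> (\<forall>r. I r \<subseteq> {1..K}) \<longrightarrow>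
      integrable M (\<lambda>\<omega>. \<Prod>j<l. \<Sum>k\<in>I (rs ! j). X (lab j) k \<omega>) \<and>
      expectation (\<lambda>\<omega>. \<bar>\<Prod>j<l. \<Sum>k\<in>I (rs ! j). X (lab j) k \<omega>\<bar>) \<le> C * real K ^ l"
    "\<forall>lab I K. (\<forall>j<l. lab j \<in> Zplus 1 \<union> Zplus 2) \<longrightarrow> (\<forall>r. I r \<subseteq> {1..K}) \<longrightarrow>
      (\<forall>r\<in>{1..p}. \<forall>r'\<in>{1..p}. r \<noteq> r' \<longrightarrow> I r \<inter> I r' = {}) \<longrightarrow>
      \<bar>expectation (\<lambda>\<omega>. \<Prod>j<l. \<Sum>k\<in>I (rs ! j). X (lab j) k \<omega>)
        - (if paired l lab \<and> index_compatible rs lab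
           then \<Prod>r=1..p. real (card (I r)) ^ half_count rs r else 0)\<bar>
      \<le> (if card (lab ` {..<l}) \<le> (l - 1) div 2 then C * real K ^ (l div 2) else 0)"
    by (rule block_sum_product_expectation[OF X rs])
  obtain b where b: "\<And>n r i. r \<in> Zplus d \<Longrightarrow> i \<in> {1..n} \<Longrightarrow> card {j \<in> {1..n}. Ld n i j = r} \<le> b"
    using property_BE[OF B] by metis
  define c where "c = real (\<Prod>i<l. 1 + i * b)"
  \<comment> \<open>Because \<open>1 \<le> c\<close>, the single constant \<open>C * c\<close> also
    serves the crude bound.\<close>
  have c1: "1 \<le> c"
  proof -
    have "1 \<le> (\<Prod>i<l. 1 + i * b)" by (rule prod_ge_1) simp
    then show ?thesis unfolding c_def by (metis of_nat_1 of_nat_le_iff)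
  qed
  define f where "f n v \<pi> \<omega> = (\<Prod>j<l. \<Sum>k\<in>block v (rs ! j). X (link_label Ld n \<pi> j) k \<omega>)" for n v \<pi> \<omega>
  have Yf: "block_trace n v = (\<lambda>\<omega>. \<Sum>\<pi>\<in>circuits n l. f n v \<pi> \<omega>)" if "ordered v" for n v
    using that by (simp add: block_trace_def[abs_def] f_def)
  have f1: "integrable M (f n v \<pi>)" "expectation (\<lambda>\<omega>. \<bar>f n v \<pi> \<omega>\<bar>) \<le> C * real (v ! p) ^ l"
    if "ordered v" "\<pi> \<in> circuits n l" for n v \<pi>
  proof -
    have "\<forall>j<l. link_label Ld n \<pi> j \<in> Zplus 1 \<union> Zplus 2" using label_index[OF that(2)] by blast
    moreover have "\<forall>r. block v r \<subseteq> {1..v ! p}" using block_sub[OF that(1)] by blast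
    ultimately have "integrable M (\<lambda>\<omega>. f n v \<pi> \<omega>) \<and> expectation (\<lambda>\<omega>. \<bar>f n v \<pi> \<omega>\<bar>) \<le> C * real (v ! p) ^ l"
      unfolding f_def using C(2) by blast
    then show "integrable M (f n v \<pi>)" "expectation (\<lambda>\<omega>. \<bar>f n v \<pi> \<omega>\<bar>) \<le> C * real (v ! p) ^ l" by auto
  qed
  have f2: "\<bar>expectation (f n v \<pi>) - (if \<pi> \<in> good_circuits Ld n rs then increment_prod v else 0)\<bar>
      \<le> (if card (link_label Ld n \<pi> ` {..<l}) \<le> (l - 1) div 2 then C * real (v ! p) ^ (l div 2) else 0)"
    if v: "ordered v" and pi: "\<pi> \<in> circuits n l" for n v \<pi>
  proof -
    have a: "\<forall>j<l. link_label Ld n \<pi> j \<in> Zplus 1 \<union> Zplus 2" using label_index[OF pi] by blast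
    have b: "\<forall>r. block v r \<subseteq> {1..v ! p}" using block_sub[OF v] by blast
    have c: "\<forall>r\<in>{1..p}. \<forall>r'\<in>{1..p}. r \<noteq> r' \<longrightarrow> block v r \<inter> block v r' = {}"
      using block_disj[OF v] by blast
    have "(\<Prod>r=1..p. real (card (block v r)) ^ half_count rs r) = (\<Prod>r<p. real (card (block v (Suc r))) ^ half_count rs (Suc r))"
      by (simp add: prod.atLeast1_atMost_eq)
    also have "\<dots> = increment_prod v"
      unfolding increment_prod_def
    proof (rule prod.cong[OF refl])
      fix r assume "r \<in> {..<p}"
      then have "v ! r \<le> v ! Suc r" "block v (Suc r) = {v ! r<..v ! Suc r}"
        using v by (auto simp: ordered_def block_def)
      then show "real (card (block v (Suc r))) ^ half_count rs (Suc r)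
          = (real (v ! Suc r) - real (v ! r)) ^ half_count rs (Suc r)" by (simp add: of_nat_diff)
    qed
    finally have Pv: "(\<Prod>r=1..p. real (card (block v r)) ^ half_count rs r) = increment_prod v" .
    have "\<pi> \<in> good_circuits Ld n rs \<longleftrightarrow> paired l (link_label Ld n \<pi>) \<and> index_compatible rs (link_label Ld n \<pi>)"
      using pi by (simp add: good_circuits_def)
    then show ?thesis
      using C(3)[rule_format, of "link_label Ld n \<pi>" "block v" "v ! p"] a b c
      unfolding f_def[abs_def] Pv by simp
  qed
  show thesis
  proof (rule that[of "C * c"])
    show "0 \<le> C * c" using C(1) c1 by simp
    show "\<forall>n v. integrable M (block_trace n v) \<and> expectation (\<lambda>\<omega>. \<bar>block_trace n v \<omega>\<bar>) \<le> C * c * real (card (circuits n l)) * real (v ! p) ^ l"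
    proof (intro allI)
      fix n v
      show "integrable M (block_trace n v) \<and> expectation (\<lambda>\<omega>. \<bar>block_trace n v \<omega>\<bar>) \<le> C * c * real (card (circuits n l)) * real (v ! p) ^ l"
      proof (cases "ordered v")
        case True
        have int: "integrable M (block_trace n v)"
          unfolding Yf[OF True] by (intro Bochner_Integration.integrable_sum f1(1) True)
        have "expectation (\<lambda>\<omega>. \<bar>block_trace n v \<omega>\<bar>) \<le> expectation (\<lambda>\<omega>. \<Sum>\<pi>\<in>circuits n l. \<bar>f n v \<pi> \<omega>\<bar>)"
        proof (rule integral_mono)
          show "integrable M (\<lambda>\<omega>. \<Sum>\<pi>\<in>circuits n l. \<bar>f n v \<pi> \<omega>\<bar>)"
            by (intro Bochner_Integration.integrable_sum integrable_abs f1(1) True)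
          show "\<bar>block_trace n v \<omega>\<bar> \<le> (\<Sum>\<pi>\<in>circuits n l. \<bar>f n v \<pi> \<omega>\<bar>)" for \<omega>
            unfolding Yf[OF True] by (rule sum_abs)
        qed (intro integrable_abs int)
        also have "\<dots> = (\<Sum>\<pi>\<in>circuits n l. expectation (\<lambda>\<omega>. \<bar>f n v \<pi> \<omega>\<bar>))"
          by (intro Bochner_Integration.integral_sum integrable_abs f1(1) True)
        also have "\<dots> \<le> (\<Sum>\<pi>\<in>circuits n l. C * real (v ! p) ^ l)"
          by (intro sum_mono f1(2) True)
        also have "\<dots> = (C * real (card (circuits n l)) * real (v ! p) ^ l) * 1" by simp
        also have "\<dots> \<le> (C * real (card (circuits n l)) * real (v ! p) ^ l) * c"
          using C(1) c1 by (intro mult_left_mono) auto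
        finally show ?thesis using int by (simp add: mult_ac)
      next
        case False
        then have "block_trace n v = (\<lambda>_. 0)" by (simp add: block_trace_def[abs_def])
        then show ?thesis using C(1) c1 by simp
      qed
    qed
    show "\<forall>n v. ordered v \<longrightarrow> \<bar>expectation (block_trace n v) - real (card (good_circuits Ld n rs)) * increment_prod v\<bar>
      \<le> C * c * real n ^ (1 + (l - 1) div 2) * real (v ! p) ^ (l div 2)"
    proof (intro allI impI)
      fix n v assume v: "ordered v"
      let ?few = "{\<pi> \<in> circuits n l. card (link_label Ld n \<pi> ` {..<l}) \<le> (l - 1) div 2}"
      have "expectation (block_trace n v) = (\<Sum>\<pi>\<in>circuits n l. expectation (f n v \<pi>))"
        unfolding Yf[OF v] by (intro Bochner_Integration.integral_sum f1(1) v)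
      moreover have "real (card (good_circuits Ld n rs)) * increment_prod v = (\<Sum>\<pi>\<in>circuits n l. if \<pi> \<in> good_circuits Ld n rs then increment_prod v else 0)"
      proof -
        have "circuits n l \<inter> good_circuits Ld n rs = good_circuits Ld n rs" by (auto simp: good_circuits_def)
        then show ?thesis by (simp add: sum.If_cases)
      qed
      ultimately have "\<bar>expectation (block_trace n v) - real (card (good_circuits Ld n rs)) * increment_prod v\<bar>
        = \<bar>\<Sum>\<pi>\<in>circuits n l. expectation (f n v \<pi>) - (if \<pi> \<in> good_circuits Ld n rs then increment_prod v else 0)\<bar>"
        by (simp only: sum_subtractf)
      also have "\<dots> \<le> (\<Sum>\<pi>\<in>circuits n l. \<bar>expectation (f n v \<pi>) - (if \<pi> \<in> good_circuits Ld n rs then increment_prod v else 0)\<bar>)"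
        by (rule sum_abs)
      also have "\<dots> \<le> (\<Sum>\<pi>\<in>circuits n l. if card (link_label Ld n \<pi> ` {..<l}) \<le> (l - 1) div 2 then C * real (v ! p) ^ (l div 2) else 0)"
        by (intro sum_mono f2 v)
      also have "\<dots> = real (card ?few) * (C * real (v ! p) ^ (l div 2))"
        by (simp add: sum.If_cases Int_def)
      also have "\<dots> \<le> (c * real n ^ (1 + (l - 1) div 2)) * (C * real (v ! p) ^ (l div 2))"
      proof (rule mult_right_mono)
        have "card ?few \<le> card {\<pi> \<in> {0..l} \<rightarrow>\<^sub>E {1..n}. card (link_label Ld n \<pi> ` {..<l}) \<le> (l - 1) div 2}"
        proof (rule card_mono)
          show "finite {\<pi> \<in> {0..l} \<rightarrow>\<^sub>E {1..n}. card (link_label Ld n \<pi> ` {..<l}) \<le> (l - 1) div 2}"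
            by (rule finite_subset[of _ "{0..l} \<rightarrow>\<^sub>E {1..n}"]) (auto intro!: finite_PiE)
        qed (auto simp: circuits_def)
        also have "\<dots> \<le> (\<Prod>i<l. 1 + i * b) * n ^ (1 + (l - 1) div 2)"
          by (rule card_paths_few_labels[OF Ld b])
        finally have "real (card ?few) \<le> real ((\<Prod>i<l. 1 + i * b) * n ^ (1 + (l - 1) div 2))" by (rule of_nat_mono)
        then show "real (card ?few) \<le> c * real n ^ (1 + (l - 1) div 2)" by (simp only: c_def of_nat_mult of_nat_power)
      qed (use C(1) in simp)
      finally show "\<bar>expectation (block_trace n v) - real (card (good_circuits Ld n rs)) * increment_prod v\<bar>
        \<le> C * c * real n ^ (1 + (l - 1) div 2) * real (v ! p) ^ (l div 2)" by (simp add: mult_ac)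
    qed
  qed
qed

private lemma increment_prod_walk_times:
  "increment_prod (walk_times n \<omega>) = (\<Prod>r<p. (real (N\<alpha> (real n * t (Suc r)) \<omega>)
      - real (N\<alpha> (real n * t r) \<omega>)) ^ half_count rs (Suc r))"
  unfolding increment_prod_def by (intro prod.cong) (auto simp: walk_times_nth)

text \<open>Averaging over the walk times by freezing. The good circuits share one factor, and the
  error grows like the moment of order \<open>l div 2\<close> of the number of steps.\<close>

private lemma expectation_tr:
  obtains D where "\<forall>n\<ge>1. integrable M (tr n)"
    "\<forall>n\<ge>1. \<bar>expectation (tr n) - real n powr (- (1 + \<alpha>) / 2 * real l) *
        (real (card (good_circuits Ld n rs)) * expectation (\<lambda>\<omega>. increment_prod (walk_times n \<omega>)))\<bar>
      \<le> real n powr (- (1 + \<alpha>) / 2 * real l) * (D * (real n ^ (1 + (l - 1) div 2) * (real n powr \<alpha>) ^ (l div 2)))"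
proof -
  obtain C where C: "0 \<le> C"
    "\<forall>n v. integrable M (block_trace n v) \<and> expectation (\<lambda>\<omega>. \<bar>block_trace n v \<omega>\<bar>) \<le> C * real (card (circuits n l)) * real (v ! p) ^ l"
    "\<forall>n v. ordered v \<longrightarrow> \<bar>expectation (block_trace n v) - real (card (good_circuits Ld n rs)) * increment_prod v\<bar>
      \<le> C * real n ^ (1 + (l - 1) div 2) * real (v ! p) ^ (l div 2)"
    by (rule expectation_block_trace)
  have tp: "0 \<le> t p" by (rule time_nonneg) simp
  \<comment> \<open>The moment of order \<open>l\<close> supplies the integrability needed for
    freezing, the one of order \<open>l div 2\<close> the size of the error.\<close>
  obtain C1 where C1: "\<And>n. 1 \<le> n \<Longrightarrow> integrable M (\<lambda>\<omega>. real (N\<alpha> (real n * t p) \<omega>) ^ l) \<and>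
      expectation (\<lambda>\<omega>. real (N\<alpha> (real n * t p) \<omega>) ^ l) \<le> C1 * (real n powr \<alpha>) ^ l"
    using fractional_poisson_moment_bound[OF \<alpha> L N indL Nr_meas tp, of l] by blast
  obtain C2 where C2: "\<And>n. 1 \<le> n \<Longrightarrow> integrable M (\<lambda>\<omega>. real (N\<alpha> (real n * t p) \<omega>) ^ (l div 2)) \<and>
      expectation (\<lambda>\<omega>. real (N\<alpha> (real n * t p) \<omega>) ^ (l div 2)) \<le> C2 * (real n powr \<alpha>) ^ (l div 2)"
    using fractional_poisson_moment_bound[OF \<alpha> L N indL Nr_meas tp, of "l div 2"] by blast
  have main: "integrable M (tr n) \<and> \<bar>expectation (tr n) - real n powr (- (1 + \<alpha>) / 2 * real l) *
        (real (card (good_circuits Ld n rs)) * expectation (\<lambda>\<omega>. increment_prod (walk_times n \<omega>)))\<bar>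
      \<le> real n powr (- (1 + \<alpha>) / 2 * real l) * ((C * C2) * (real n ^ (1 + (l - 1) div 2) * (real n powr \<alpha>) ^ (l div 2)))"
    if n: "1 \<le> n" for n
  proof -
    let ?a = "real n powr (- (1 + \<alpha>) / 2 * real l)"
    let ?G = "real (card (good_circuits Ld n rs))"
    let ?Y = "\<lambda>\<omega>. block_trace n (walk_times n \<omega>) \<omega>"
    let ?E = "\<lambda>\<omega>. expectation (block_trace n (walk_times n \<omega>))"
    have wp: "walk_times n \<omega> ! p = N\<alpha> (real n * t p) \<omega>" for \<omega> by (rule walk_times_nth) simp
    have mc: "(\<lambda>\<omega>. g (walk_times n \<omega>)) \<in> borel_measurable M" for g :: "nat list \<Rightarrow> real"
      by (rule measurable_compose[OF walk_times_meas]) simp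
    have bound: "integrable M (\<lambda>\<omega>. expectation (\<lambda>\<omega>'. \<bar>block_trace n (walk_times n \<omega>) \<omega>'\<bar>))"
    proof (rule Bochner_Integration.integrable_bound[OF integrable_mult_right[OF conjunct1[OF C1[OF n]],
            of "C * real (card (circuits n l))"] mc], rule AE_I2)
      fix \<omega>
      have "0 \<le> expectation (\<lambda>\<omega>'. \<bar>block_trace n (walk_times n \<omega>) \<omega>'\<bar>)"
        by (rule Bochner_Integration.integral_nonneg) simp
      moreover have "expectation (\<lambda>\<omega>'. \<bar>block_trace n (walk_times n \<omega>) \<omega>'\<bar>)
          \<le> C * real (card (circuits n l)) * real (N\<alpha> (real n * t p) \<omega>) ^ l"
        using C(2) wp by metis
      ultimately show "norm (expectation (\<lambda>\<omega>'. \<bar>block_trace n (walk_times n \<omega>) \<omega>'\<bar>))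
          \<le> norm (C * real (card (circuits n l)) * real (N\<alpha> (real n * t p) \<omega>) ^ l)"
        by simp
    qed
    have intY: "integrable M (block_trace n v)" for v using C(2) by blast
    note fr = freeze_expectation[where Y="block_trace n" and T="walk_times n",
        OF indG space_gen_measure space_gen_measure block_trace_gen intY walk_times_gen bound]
    have ae: "AE \<omega> in M. ?a * ?Y \<omega> = tr n \<omega>" using tr_eq by eventually_elim simp
    have int_tr: "integrable M (tr n)"
      by (rule integrable_cong_AE_imp[OF integrable_mult_right[OF fr(1)] tr_meas])
        (use ae in \<open>eventually_elim, simp\<close>)
    have "expectation (tr n) = expectation (\<lambda>\<omega>. ?a * ?Y \<omega>)"
      by (rule integral_cong_AE) (use ae fr(1) int_tr in \<open>auto elim!: eventually_mono\<close>)
    also have "\<dots> = ?a * expectation ?E" using fr by simp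
    finally have E_tr: "expectation (tr n) = ?a * expectation ?E" .
    have intE: "integrable M ?E"
    proof (rule Bochner_Integration.integrable_bound[OF bound mc], rule AE_I2)
      show "norm (?E \<omega>) \<le> norm (expectation (\<lambda>\<omega>'. \<bar>block_trace n (walk_times n \<omega>) \<omega>'\<bar>))" for \<omega>
        using integral_abs_bound[of M "block_trace n (walk_times n \<omega>)"] by simp
    qed
    have intP: "integrable M (\<lambda>\<omega>. increment_prod (walk_times n \<omega>))"
      unfolding increment_prod_walk_times
      by (rule fractional_poisson_increments_moment(1)[OF \<alpha> L N indL Nr_meas t0 time_mono]) (use n in simp_all)
    have bd: "AE \<omega> in M. \<bar>?E \<omega> - ?G * increment_prod (walk_times n \<omega>)\<bar>
        \<le> C * real n ^ (1 + (l - 1) div 2) * real (N\<alpha> (real n * t p) \<omega>) ^ (l div 2)"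
      using walk_times_ordered
    proof eventually_elim
      case (elim \<omega>)
      show ?case unfolding wp[symmetric] by (rule C(3)[rule_format]) (use elim in blast)
    qed
    have "\<bar>expectation ?E - ?G * expectation (\<lambda>\<omega>. increment_prod (walk_times n \<omega>))\<bar>
        = \<bar>expectation (\<lambda>\<omega>. ?E \<omega> - ?G * increment_prod (walk_times n \<omega>))\<bar>"
      using intE intP by simp
    also have "\<dots> \<le> expectation (\<lambda>\<omega>. \<bar>?E \<omega> - ?G * increment_prod (walk_times n \<omega>)\<bar>)"
      by (rule integral_abs_bound)
    also have "\<dots> \<le> expectation (\<lambda>\<omega>. C * real n ^ (1 + (l - 1) div 2) * real (N\<alpha> (real n * t p) \<omega>) ^ (l div 2))"
      by (rule integral_mono_AE[OF _ _ bd])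
        (use intE intP C2[OF n] in \<open>auto intro!: integrable_abs Bochner_Integration.integrable_diff integrable_mult_right\<close>)
    also have "\<dots> = C * real n ^ (1 + (l - 1) div 2) * expectation (\<lambda>\<omega>. real (N\<alpha> (real n * t p) \<omega>) ^ (l div 2))"
      by (rule integral_mult_right_zero)
    also have "\<dots> \<le> C * real n ^ (1 + (l - 1) div 2) * (C2 * (real n powr \<alpha>) ^ (l div 2))"
      by (rule mult_left_mono) (use C2[OF n] C(1) in auto)
    finally have fin: "\<bar>expectation ?E - ?G * expectation (\<lambda>\<omega>. increment_prod (walk_times n \<omega>))\<bar>
        \<le> (C * C2) * (real n ^ (1 + (l - 1) div 2) * (real n powr \<alpha>) ^ (l div 2))"
      by (simp add: mult_ac)
    have "\<bar>expectation (tr n) - ?a * (?G * expectation (\<lambda>\<omega>. increment_prod (walk_times n \<omega>)))\<bar>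
        = ?a * \<bar>expectation ?E - ?G * expectation (\<lambda>\<omega>. increment_prod (walk_times n \<omega>))\<bar>"
      unfolding E_tr right_diff_distrib[symmetric] abs_mult by simp
    also have "\<dots> \<le> ?a * ((C * C2) * (real n ^ (1 + (l - 1) div 2) * (real n powr \<alpha>) ^ (l div 2)))"
      by (rule mult_left_mono[OF fin]) simp
    finally show ?thesis using int_tr by simp
  qed
  show thesis by (rule that[of "C * C2"]) (use main in blast)+
qed

section \<open>Integrability and limits of the expected trace\<close>

lemma integrable_trace: "1 \<le> n \<Longrightarrow> integrable M (tr n)"
  by (rule expectation_tr) blast

lemma expected_trace_odd_tendsto:
  assumes m: "1 \<le> m" "l = 2 * m - 1"
  shows "(\<lambda>n. expectation (tr n) / real n) \<longlonglongrightarrow> 0"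
proof -
  obtain D where D: "\<forall>n\<ge>1. \<bar>expectation (tr n) - real n powr (- (1 + \<alpha>) / 2 * real l) *
        (real (card (good_circuits Ld n rs)) * expectation (\<lambda>\<omega>. increment_prod (walk_times n \<omega>)))\<bar>
      \<le> real n powr (- (1 + \<alpha>) / 2 * real l) * (D * (real n ^ (1 + (l - 1) div 2) * (real n powr \<alpha>) ^ (l div 2)))"
    by (rule expectation_tr)
  have odd: "odd l" using m by simp
  \<comment> \<open>An odd number of positions has no pairing, so the whole expectation is error
    term.\<close>
  have "good_circuits Ld n rs = {}" for n
  proof -
    have "\<not> paired l v" for v :: "nat \<Rightarrow> int list"
      using paired_card[of l v] odd by (metis dvd_triv_left)
    then show ?thesis unfolding good_circuits_def by blast
  qed
  then have good: "card (good_circuits Ld n rs) = 0" for n by simp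
  have half: "(l - 1) div 2 = m - 1" "l div 2 = m - 1" "real l = 2 * real m - 1" using m by auto
  show ?thesis
  proof (rule Lim_null_comparison)
    show "\<forall>\<^sub>F n in sequentially. norm (expectation (tr n) / real n) \<le> D * real n powr (- (1 + \<alpha>) / 2)"
      using eventually_ge_at_top[of "1::nat"]
    proof eventually_elim
      case (elim n)
      then have n: "0 < real n" by simp
      have "real n powr (- (1 + \<alpha>) / 2 * real l) * (real n ^ (1 + (m - 1)) * (real n powr \<alpha>) ^ (m - 1)) / real n
          = real n powr (- (1 + \<alpha>) / 2 * real l + (real m + \<alpha> * real (m - 1)) - 1)"
      proof -
        have comb: "real n powr a * (real n powr b * real n powr c) / real n = real n powr (a + (b + c) - 1)" for a b c
          using n by (simp add: powr_add powr_diff)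
        have "real n ^ (1 + (m - 1)) = real n powr real m"
          "(real n powr \<alpha>) ^ (m - 1) = real n powr (\<alpha> * real (m - 1))"
          using n m(1) powr_realpow[of "real n powr \<alpha>" "m - 1"] by (simp_all add: powr_realpow powr_powr)
        then show ?thesis by (simp only: comb)
      qed
      \<comment> \<open>Circuits give n^m and the step moment n^(\<alpha> (m - 1)); the
        normalisation exceeds these by half a power each of n^\<alpha> and, after the division by n,
        of n.\<close>
      also have "- (1 + \<alpha>) / 2 * real l + (real m + \<alpha> * real (m - 1)) - 1 = - (1 + \<alpha>) / 2"
        using m(1) by (simp add: half(3) of_nat_diff field_simps)
      finally have e: "real n powr (- (1 + \<alpha>) / 2 * real l) * (real n ^ (1 + (m - 1)) * (real n powr \<alpha>) ^ (m - 1)) / real n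
          = real n powr (- (1 + \<alpha>) / 2)" .
      have "norm (expectation (tr n) / real n) = \<bar>expectation (tr n)\<bar> / real n" using n by simp
      also have "\<dots> \<le> (real n powr (- (1 + \<alpha>) / 2 * real l) * (D * (real n ^ (1 + (m - 1)) * (real n powr \<alpha>) ^ (m - 1)))) / real n"
        using D[rule_format, OF elim] n unfolding half(1,2) good by (intro divide_right_mono) simp_all
      also have "\<dots> = D * (real n powr (- (1 + \<alpha>) / 2 * real l) * (real n ^ (1 + (m - 1)) * (real n powr \<alpha>) ^ (m - 1)) / real n)"
        by simp
      finally show ?case unfolding e .
    qed
    have "(\<lambda>n. real n powr (- (1 + \<alpha>) / 2)) \<longlonglongrightarrow> 0"
      using \<alpha> by (intro tendsto_neg_powr filterlim_real_sequentially) simp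
    then show "(\<lambda>n. D * real n powr (- (1 + \<alpha>) / 2)) \<longlonglongrightarrow> 0" by (rule tendsto_mult_right_zero)
  qed
qed

lemma expected_trace_even_tendsto:
  assumes m: "1 \<le> m" "l = 2 * m"
    and conv: "\<And>w. w \<in> pair_indexed_words rs \<Longrightarrow>
      convergent (\<lambda>n. real (card (word_circuits Ld n (drop_indices w))) / real n ^ (1 + m))"
  shows "(\<lambda>n. expectation (tr n) / real n) \<longlonglongrightarrow>
    expectation (\<lambda>\<omega>. \<Prod>r<p. (L (t (Suc r)) \<omega> - L (t r) \<omega>) ^ half_count rs (Suc r)) *
    (\<Sum>w\<in>pair_indexed_words rs. lim (\<lambda>n. real (card (word_circuits Ld n (drop_indices w))) / real n ^ (1 + m)))"
    (is "_ \<longlonglongrightarrow> ?E0 * ?S")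
proof -
  obtain D where D: "\<forall>n\<ge>1. \<bar>expectation (tr n) - real n powr (- (1 + \<alpha>) / 2 * real l) *
        (real (card (good_circuits Ld n rs)) * expectation (\<lambda>\<omega>. increment_prod (walk_times n \<omega>)))\<bar>
      \<le> real n powr (- (1 + \<alpha>) / 2 * real l) * (D * (real n ^ (1 + (l - 1) div 2) * (real n powr \<alpha>) ^ (l div 2)))"
    by (rule expectation_tr)
  have half: "(l - 1) div 2 = m - 1" "l div 2 = m" "real l = 2 * real m" using m by auto
  let ?g = "\<lambda>n. real (card (good_circuits Ld n rs)) / real n ^ (1 + m)"
  let ?e = "\<lambda>n. expectation (\<lambda>\<omega>. increment_prod (walk_times n \<omega>)) / (real n powr \<alpha>) ^ m"
  have g: "?g \<longlonglongrightarrow> ?S"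
  proof -
    have "?g = (\<lambda>n. \<Sum>w\<in>pair_indexed_words rs. real (card (word_circuits Ld n (drop_indices w))) / real n ^ (1 + m))"
      unfolding card_good_circuits of_nat_sum sum_divide_distrib ..
    then show ?thesis using conv by (simp only:) (intro tendsto_sum, simp add: convergent_LIMSEQ_iff)
  qed
  have ge: "(\<lambda>n. ?g n * ?e n) \<longlonglongrightarrow> ?S * ?E0"
  proof (cases "pair_indexed_words rs = {}")
    \<comment> \<open>Here the exponents need not add up to \<open>m\<close>, so the limit of the
      increment moments is not at hand; but the circuit counts are identically 0.\<close>
    case True
    then show ?thesis by (simp add: card_good_circuits)
  next
    case False
    then obtain v where v: "v \<in> pair_indexed_words rs" by blast
    have "(\<Sum>r\<in>{1..p}. half_count rs r) = m"
      using pair_indexed_words_count_even[OF v rs(2)] half by simp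
    then have k: "(\<Sum>r<p. half_count rs (Suc r)) = m" by (simp add: sum.atLeast1_atMost_eq)
    have "?e \<longlonglongrightarrow> ?E0"
      using fractional_poisson_increments_moment_tendsto[OF \<alpha> L N indL Nr_meas t0 time_mono,
          where p=p and k="\<lambda>r. half_count rs (Suc r)"]
      unfolding increment_prod_walk_times k by simp
    then show ?thesis by (rule tendsto_mult[OF g])
  qed
  have "(\<lambda>n. expectation (tr n) / real n - ?g n * ?e n) \<longlonglongrightarrow> 0"
  proof (rule Lim_null_comparison)
    show "\<forall>\<^sub>F n in sequentially. norm (expectation (tr n) / real n - ?g n * ?e n) \<le> D * inverse (real n)"
      using eventually_ge_at_top[of "1::nat"]
    proof eventually_elim
      case (elim n)
      then have n: "0 < real n" by simp
      \<comment> \<open>Half of the normalisation goes to each count: n^m, with the division by n,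
        scales the number of circuits, and n^(\<alpha> m) scales the product of increments.\<close>
      have a: "real n powr (- (1 + \<alpha>) / 2 * real l) = inverse (real n ^ m * (real n powr \<alpha>) ^ m)"
      proof -
        have "- (1 + \<alpha>) / 2 * real l = - (real m + \<alpha> * real m)"
          by (simp add: half(3) field_simps)
        then have "real n powr (- (1 + \<alpha>) / 2 * real l) = inverse (real n powr real m * real n powr (\<alpha> * real m))"
          by (simp only: powr_minus powr_add)
        moreover have "(real n powr \<alpha>) ^ m = real n powr (\<alpha> * real m)"
          using n powr_realpow[of "real n powr \<alpha>" m] by (simp add: powr_powr)
        ultimately show ?thesis using n by (simp add: powr_realpow)
      qed
      let ?x = "expectation (\<lambda>\<omega>. increment_prod (walk_times n \<omega>))"
      have main: "real n powr (- (1 + \<alpha>) / 2 * real l) * (real (card (good_circuits Ld n rs)) * ?x) / real n = ?g n * ?e n"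
        unfolding a by (simp add: divide_inverse mult_ac)
      \<comment> \<open>At most \<open>m - 1\<close> labels instead of \<open>m\<close> cost exactly
        one factor n.\<close>
      have err: "real n powr (- (1 + \<alpha>) / 2 * real l) * (D * (real n ^ (1 + (m - 1)) * (real n powr \<alpha>) ^ m)) / real n
          = D * inverse (real n)"
        unfolding a using n m(1) by (simp add: field_simps)
      have "norm (expectation (tr n) / real n - ?g n * ?e n)
          = \<bar>expectation (tr n) - real n powr (- (1 + \<alpha>) / 2 * real l) * (real (card (good_circuits Ld n rs)) * ?x)\<bar> / real n"
        unfolding main[symmetric] diff_divide_distrib[symmetric] using n by simp
      also have "\<dots> \<le> real n powr (- (1 + \<alpha>) / 2 * real l) * (D * (real n ^ (1 + (m - 1)) * (real n powr \<alpha>) ^ m)) / real n"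
        using D[rule_format, OF elim] n unfolding half(1,2) by (intro divide_right_mono) simp_all
      finally show ?case unfolding err .
    qed
    have "(\<lambda>n. inverse (real n)) \<longlonglongrightarrow> 0" by (rule lim_inverse_n)
    then show "(\<lambda>n. D * inverse (real n)) \<longlonglongrightarrow> 0" by (rule tendsto_mult_right_zero)
  qed
  from tendsto_add[OF this ge] show ?thesis by (simp add: mult.commute)
qed

text \<open>Change of variables to the joint law of the values of \<open>L\<close>. The indicator of
  the nonnegative orthant is almost surely 1 there, because \<open>L\<close> is almost surely
  nonnegative.\<close>

lemma fdd_measure_increments_integral:
  fixes k :: "nat \<Rightarrow> nat" and S :: real
  defines "f \<equiv> \<lambda>x. (\<Prod>r = 1..p. (x r - x (r - 1)) ^ k r) * S"
  shows "set_integrable (fdd_measure M L t p) ({0..p} \<rightarrow>\<^sub>E {0..}) f"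
    and "(LINT x:({0..p} \<rightarrow>\<^sub>E {0..})|fdd_measure M L t p. f x)
      = expectation (\<lambda>\<omega>. \<Prod>r<p. (L (t (Suc r)) \<omega> - L (t r) \<omega>) ^ k (Suc r)) * S"
proof -
  let ?P = "PiM {0..p} (\<lambda>_. borel) :: (nat \<Rightarrow> real) measure"
  let ?V = "\<lambda>\<omega>. \<lambda>r\<in>{0..p}. L (t r) \<omega>"
  define h where "h x = indicator ({0..p} \<rightarrow>\<^sub>E {0..}) x *\<^sub>R f x" for x
  note Lm = inverse_subordinator_measurable[OF \<alpha> L N indL Nr_meas]
  have V: "?V \<in> measurable M ?P" by (intro measurable_restrict Lm time_nonneg) simp_all
  have "({0..p} \<rightarrow>\<^sub>E {0..}) \<in> sets ?P" by (rule sets_PiM_I_finite) auto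
  moreover have "f \<in> borel_measurable ?P"
    unfolding f_def
    by (intro borel_measurable_times borel_measurable_prod borel_measurable_power borel_measurable_diff
        measurable_component_singleton borel_measurable_const) auto
  ultimately have h: "h \<in> borel_measurable ?P"
    unfolding h_def[abs_def] by (intro borel_measurable_scaleR borel_measurable_indicator)
  let ?g = "\<lambda>\<omega>. (\<Prod>r<p. (L (t (Suc r)) \<omega> - L (t r) \<omega>) ^ k (Suc r)) * S"
  have int: "integrable M ?g"
    by (intro integrable_mult_left
        inverse_subordinator_increments_integrable(2)[OF \<alpha> L N indL Nr_meas t0 time_mono, where k="\<lambda>r. k (Suc r)"])
  have ae: "AE \<omega> in M. h (?V \<omega>) = ?g \<omega>"
    using inverse_subordinator_mono[OF L]
  proof eventually_elim
    case (elim \<omega>)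
    have "0 \<le> L (t r) \<omega>" if "r \<le> p" for r using elim time_nonneg[OF that] by blast
    then have "?V \<omega> \<in> ({0..p} \<rightarrow>\<^sub>E {0..})" by auto
    moreover have "(\<Prod>r = 1..p. (?V \<omega> r - ?V \<omega> (r - 1)) ^ k r) = (\<Prod>r<p. (L (t (Suc r)) \<omega> - L (t r) \<omega>) ^ k (Suc r))"
      by (simp add: prod.atLeast1_atMost_eq)
    ultimately show ?case by (simp add: h_def f_def)
  qed
  have hV: "(\<lambda>\<omega>. h (?V \<omega>)) \<in> borel_measurable M" by (rule measurable_compose[OF V h])
  have "integrable M (\<lambda>\<omega>. h (?V \<omega>))"
    by (rule integrable_cong_AE_imp[OF int hV]) (use ae in \<open>eventually_elim, simp\<close>)
  then show "set_integrable (fdd_measure M L t p) ({0..p} \<rightarrow>\<^sub>E {0..}) f"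
    unfolding set_integrable_def fdd_measure_def h_def[symmetric] by (simp add: integrable_distr_eq[OF V h])
  have "(LINT x:({0..p} \<rightarrow>\<^sub>E {0..})|fdd_measure M L t p. f x) = expectation (\<lambda>\<omega>. h (?V \<omega>))"
    unfolding set_lebesgue_integral_def fdd_measure_def h_def[symmetric] by (rule integral_distr[OF V h])
  also have "\<dots> = expectation ?g"
    by (rule integral_cong_AE) (use hV int ae in auto)
  finally show "(LINT x:({0..p} \<rightarrow>\<^sub>E {0..})|fdd_measure M L t p. f x)
      = expectation (\<lambda>\<omega>. \<Prod>r<p. (L (t (Suc r)) \<omega> - L (t r) \<omega>) ^ k (Suc r)) * S"
    by simp
qed

end
end

text \<open>The Lebesgue integral of a non-integrable function is 0 by convention; the integrability
  claims in the conclusion ensure that the limits concern genuine expectations and a genuine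
  integral.\<close>

theorem theorem4p2:
  fixes M :: "'a measure"
    and \<alpha> :: real and d p :: nat
    and L :: "real \<Rightarrow> 'a \<Rightarrow> real" and N :: "real \<Rightarrow> 'a \<Rightarrow> nat"
    and X :: "int list \<Rightarrow> nat \<Rightarrow> 'a \<Rightarrow> real"
    and Ld :: "nat \<Rightarrow> nat \<Rightarrow> nat \<Rightarrow> int list"
    and t :: "nat \<Rightarrow> real" and rs :: "nat list"
  defines "N\<alpha> \<equiv> fractional_poisson N L"
  defines "tr \<equiv> \<lambda>n \<omega>. mat_trace (monomial_mat n (A_incr \<alpha> Ld X N\<alpha> t n \<omega>) rs)"
  defines "c \<equiv> \<lambda>m w n. real (card (word_circuits Ld n (drop_indices w))) / real n ^ (1 + m)"
  defines "integrand \<equiv> \<lambda>m x. (\<Prod>r = 1..p. (x r - x (r - 1)) ^ half_count rs r) *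
             (\<Sum>w\<in>pair_indexed_words rs. lim (c m w))"
  assumes "prob_space M"
    and "0 < \<alpha>" and "\<alpha> \<le> 1"
    and "prob_space.inverse_stable_subordinator M \<alpha> L"
    and "prob_space.unit_poisson_process M N"
    and "prob_space.indep_families M {0..} L {0..} (\<lambda>s \<omega>. real (N s \<omega>))"
    and "d \<in> {1, 2}"
    and "link_function d Ld" and "symmetric_link Ld" and "property_B d Ld"
    and "prob_space.assumption_I M X"
    and "prob_space.indep_families M input_index (\<lambda>(r, k). X r k) {0..} (\<lambda>s \<omega>. real (N\<alpha> s \<omega>))"
    and "0 \<le> t 0" and "\<And>r. r < p \<Longrightarrow> t r < t (Suc r)"
    and "rs \<noteq> []" and "set rs \<subseteq> {1..p}"
    and "\<And>m w. 1 \<le> m \<Longrightarrow> length rs = 2 * m \<Longrightarrow> w \<in> pair_indexed_words rs \<Longrightarrow> convergent (c m w)"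
  shows "(\<forall>n\<ge>1. integrable M (tr n)) \<and>
    (\<forall>m\<ge>1. length rs = 2 * m - 1 \<longrightarrow>
       (\<lambda>n. (\<integral>\<omega>. tr n \<omega> \<partial>M) / real n) \<longlonglongrightarrow> 0) \<and>
    (\<forall>m\<ge>1. length rs = 2 * m \<longrightarrow>
       set_integrable (fdd_measure M L t p) ({0..p} \<rightarrow>\<^sub>E {0..}) (integrand m) \<and>
       (\<lambda>n. (\<integral>\<omega>. tr n \<omega> \<partial>M) / real n) \<longlonglongrightarrow>
         (LINT x:({0..p} \<rightarrow>\<^sub>E {0..})|fdd_measure M L t p. integrand m x))"
proof -
  interpret prob_space M by fact
  have base: "0 < \<alpha>" "inverse_stable_subordinator \<alpha> L" "unit_poisson_process N"
    "indep_families {0..} L {0..} (\<lambda>s \<omega>. real (N s \<omega>))" "d \<in> {1, 2}" "link_function d Ld"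
    "property_B d Ld" "assumption_I X"
    "indep_families input_index (\<lambda>(r, k). X r k) {0..} (\<lambda>s \<omega>. real (fractional_poisson N L s \<omega>))"
    "0 \<le> t 0" "\<And>r. r < p \<Longrightarrow> t r < t (Suc r)" "rs \<noteq> []" "set rs \<subseteq> {1..p}"
    using assms by simp_all
  have integrable: "integrable M (tr n)" if "n \<ge> 1" for n
    unfolding tr_def N\<alpha>_def using that by (intro integrable_trace[where d=d and p=p] base)
  have odd: "(\<lambda>n. (\<integral>\<omega>. tr n \<omega> \<partial>M) / real n) \<longlonglongrightarrow> 0" if "1 \<le> m" "length rs = 2 * m - 1" for m
    unfolding tr_def N\<alpha>_def by (rule expected_trace_odd_tendsto[where d=d and p=p and m=m]) (fact base that)+
  have even: "set_integrable (fdd_measure M L t p) ({0..p} \<rightarrow>\<^sub>E {0..}) (integrand m) \<and>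
       (\<lambda>n. (\<integral>\<omega>. tr n \<omega> \<partial>M) / real n) \<longlonglongrightarrow>
         (LINT x:({0..p} \<rightarrow>\<^sub>E {0..})|fdd_measure M L t p. integrand m x)"
    if m: "1 \<le> m" "length rs = 2 * m" for m
  proof -
    have conv: "convergent (\<lambda>n. real (card (word_circuits Ld n (drop_indices w))) / real n ^ (1 + m))"
      if "w \<in> pair_indexed_words rs" for w
      using assms(21)[OF m that] unfolding c_def .
    have lim: "(\<lambda>n. (\<integral>\<omega>. tr n \<omega> \<partial>M) / real n) \<longlonglongrightarrow>
        expectation (\<lambda>\<omega>. \<Prod>r<p. (L (t (Suc r)) \<omega> - L (t r) \<omega>) ^ half_count rs (Suc r)) *
        (\<Sum>w\<in>pair_indexed_words rs. lim (c m w))"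
      unfolding tr_def N\<alpha>_def c_def
      by (rule expected_trace_even_tendsto[where d=d and p=p and m=m]) (fact base m conv)+
    have "set_integrable (fdd_measure M L t p) ({0..p} \<rightarrow>\<^sub>E {0..}) (integrand m)"
      unfolding integrand_def
      by (rule fdd_measure_increments_integral(1)[where k="half_count rs" and d=d]) (fact base)+
    moreover have "(LINT x:({0..p} \<rightarrow>\<^sub>E {0..})|fdd_measure M L t p. integrand m x)
        = expectation (\<lambda>\<omega>. \<Prod>r<p. (L (t (Suc r)) \<omega> - L (t r) \<omega>) ^ half_count rs (Suc r)) *
          (\<Sum>w\<in>pair_indexed_words rs. lim (c m w))"
      unfolding integrand_def
      by (rule fdd_measure_increments_integral(2)[where k="half_count rs" and d=d]) (fact base)+
    ultimately show ?thesis using lim by simp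
  qed
  show ?thesis using integrable odd even by blast
qed

end
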